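(* Let $d\ge 2$ be an integer. For $p\in(2,2^* )$ let $\mathsf C_{\rm GN}(p)$ denote the optimal (i.e. smallest) constant in the Gagliardo-Nirenberg-Sobolev inequality $$\|u\|_{L^p(\mathbb R^d)}^2\le \mathsf C_{\rm GN}(p)\,\|\nabla u\|_{L^2(\mathbb R^d)}^{2\,\vartheta(p,d)}\,\|u\|_{L^2(\mathbb R^d)}^{2\,(1-\vartheta(p,d))}\qquad\forall\,u\in H^1(\mathbb R^d),$$ where $\vartheta(p,d)=\frac{d\,(p-2)}{2\,p}$. Then $$\lim_{p\to2_+}\frac{\mathsf C_{\rm GN}(p)-1}{p-2}=\frac d4\,\log \mathsf C_{\rm LS}\,,\qquad\text{where}\quad \mathsf C_{\rm LS}=\frac{2}{\pi\,d\,e}\,.$$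
   Context: $2^*:=\frac{2d}{d-2}$ if $d\ge3$ and $2^*:=\infty$ if $d=2$. The number $\mathsf C_{\rm LS}=\frac{2}{\pi d e}$ (with $e=\exp(1)$) is the optimal constant in the logarithmic Sobolev inequality in Weissler's form: $\int_{\mathbb R^d}|u|^2\log|u|^2\,dx\le\frac d2\log\big(\mathsf C_{\rm LS}\,\|\nabla u\|_{L^2(\mathbb R^d)}^2\big)$ for all $u\in H^1(\mathbb R^d)$ with $\|u\|_{L^2(\mathbb R^d)}=1$. *)

theory Defs
  imports "HOL-Analysis.Analysis"
begin

text \<open>
  The Euclidean space \<open>\<real>\<^sup>d\<close> is a type \<open>'a :: euclidean_space\<close> with \<open>d = DIM('a)\<close>.
  In the inequality, the value type \<open>'b\<close> is a finite-dimensional commutative normed field over the reals,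
  that is \<open>real\<close> or \<open>complex\<close> up to isomorphism.
\<close>

definition Lp_space :: "real \<Rightarrow> ('a::euclidean_space \<Rightarrow> 'b::euclidean_space) set" where
  "Lp_space p = {f \<in> borel_measurable lborel. integrable lborel (\<lambda>x. norm (f x) powr p)}"

definition Lp_norm :: "real \<Rightarrow> ('a::euclidean_space \<Rightarrow> 'b::euclidean_space) \<Rightarrow> real" where
  "Lp_norm p f = (LINT x|lborel. norm (f x) powr p) powr (1 / p)"

fun C_k :: "nat \<Rightarrow> ('a::euclidean_space \<Rightarrow> real) \<Rightarrow> bool" where
  "C_k 0 f \<longleftrightarrow> continuous_on UNIV f"
| "C_k (Suc k) f \<longleftrightarrow> (\<forall>x. f differentiable (at x)) \<and>
     (\<forall>v. C_k k (\<lambda>x. frechet_derivative f (at x) v))"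

definition test_function :: "('a::euclidean_space \<Rightarrow> real) \<Rightarrow> bool" where
  "test_function \<phi> \<longleftrightarrow> (\<forall>k. C_k k \<phi>) \<and> compact (closure {x. \<phi> x \<noteq> 0})"

text \<open>\<open>G i\<close> is the weak partial derivative of \<open>u\<close> in the direction of the basis vector \<open>i\<close>.\<close>

definition has_weak_L2_gradient ::
  "('a::euclidean_space \<Rightarrow> 'b::euclidean_space) \<Rightarrow> ('a \<Rightarrow> 'a \<Rightarrow> 'b) \<Rightarrow> bool" where
  "has_weak_L2_gradient u G \<longleftrightarrow>
     (\<forall>i\<in>Basis. G i \<in> Lp_space 2 \<and>
       (\<forall>\<phi>. test_function \<phi> \<longrightarrow>
         (LINT x|lborel. frechet_derivative \<phi> (at x) i *\<^sub>R u x) =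
         - (LINT x|lborel. \<phi> x *\<^sub>R G i x)))"

definition H1 :: "('a::euclidean_space \<Rightarrow> 'b::euclidean_space) set" where
  "H1 = {u \<in> Lp_space 2. \<exists>G. has_weak_L2_gradient u G}"

definition gradient_L2_norm :: "('a::euclidean_space \<Rightarrow> 'a \<Rightarrow> 'b::euclidean_space) \<Rightarrow> real" where
  "gradient_L2_norm G = Lp_norm 2 (\<lambda>x. L2_set (\<lambda>i. norm (G i x)) Basis)"

text \<open>The critical exponent \<open>2\<^sup>*\<close>, for \<open>d \<ge> 2\<close>.\<close>

definition critical_exponent :: "nat \<Rightarrow> ereal" where
  "critical_exponent d = (if d = 2 then \<infinity> else ereal (2 * real d / (real d - 2)))"

definition GN_theta :: "real \<Rightarrow> nat \<Rightarrow> real" where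
  "GN_theta p d = real d * (p - 2) / (2 * p)"

text \<open>
  The requirement \<open>u \<in> Lp_space p\<close> expresses that the left-hand side is finite: the integral
  in \<open>Lp_norm\<close> would be \<open>0\<close> for a non-integrable function. Weak gradients are unique up to null
  sets, so quantifying over all of them amounts to speaking of \<open>\<nabla>u\<close>.
\<close>

definition GN_inequality ::
  "'a::euclidean_space itself \<Rightarrow> 'b::{real_normed_field,euclidean_space} itself \<Rightarrow>
   real \<Rightarrow> real \<Rightarrow> bool" where
  "GN_inequality _ _ p C \<longleftrightarrow>
     (\<forall>u \<in> (H1 :: ('a \<Rightarrow> 'b) set). \<forall>G. has_weak_L2_gradient u G \<longrightarrow>
        u \<in> Lp_space p \<and>
        (Lp_norm p u)\<^sup>2 \<le>
          C * gradient_L2_norm G powr (2 * GN_theta p DIM('a)) *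
          Lp_norm 2 u powr (2 * (1 - GN_theta p DIM('a))))"

definition C_GN ::
  "'a::euclidean_space itself \<Rightarrow> 'b::{real_normed_field,euclidean_space} itself \<Rightarrow>
   real \<Rightarrow> real" where
  "C_GN A B p = Inf {C. GN_inequality A B p C}"

definition C_LS :: "nat \<Rightarrow> real" where
  "C_LS d = 2 / (pi * real d * exp 1)"

end

(*
  Write p = 2 + 2 s. For the upper bound let f = |w|^2 with w continuous and compactly supported, and
  let T be the triangular (Knothe) transport map of f to a product of Gaussians truncated to [-K, K],
  so that f = m * prod_b (exp (-T_b^2 / 2) / N * d_b T_b). Raising this to the power s and applying the
  weighted arithmetic-geometric mean inequality to the factors (d_b T_b)^s bounds the integral of
  f^(1 + s) by integrals of f |T|^2 and of f d_b T_b. Integrating by parts and completing the square in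
  the latter yields the Dirichlet energy of w and exactly cancels the term of order s in |T|^2. The
  result is a Gagliardo-Nirenberg inequality with a constant that is explicit up to O(s^2) and sharp to
  first order as s -> 0 and then K -> infinity. It extends to H^1 by Steklov averages and cut-offs,
  since it needs only L^2 bounds on difference quotients. The lower bound comes from a Gaussian.
*)

theory Submission
  imports Defs "HOL-Probability.Distributions"
begin

text \<open>The truncation makes the estimates uniform: every \<open>T b\<close> is bounded by
  \<open>K\<close>, so the second-order error is \<open>s\<^sup>2 * D\<close> times the mass of f,
  with D depending only on d and K, and no moment of f has to be finite. The price is a Gaussian
  mass N below sqrt (2 * pi), recovered only after the limit in p; this fixes the order of the two
  limits. The triangular map is built from one-dimensional quantile functions. Its components have
  classical derivatives in their own directions wherever f > 0, and only this diagonal of the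
  Jacobian is used, so the regularity theory of optimal transport is avoided. As each component is
  nondecreasing in its own direction, Fatou's lemma bounds the integral of f d_b T_b from above,
  which is the direction needed. The target has a fixed scale, whereas the inequality is invariant
  under dilations. A free parameter l restores this; to first order its best value is l^2 = d m / (4
  A), with m the mass and A the Dirichlet energy. With N^2 tending to 2 pi the slope becomes -(d/4)
  (log (pi d / 2) + 1) = (d/4) log C_LS, and exp (-|x|^2 / 4) gives the same slope from
  below.\<close>

section \<open>Triangular transport to truncated Gaussians\<close>

text \<open>This is the inverse distribution function of the Gaussian conditioned to [-K, K]. It is
  continued by the constants -K and K outside (0, 1), so that it stays monotone and bounded on the
  whole line and can be composed with any quotient.\<close>

lemma truncated_gaussian_quantile:
  fixes K :: real
  assumes K: "K > 0"
  defines "N \<equiv> integral {-K..K} (\<lambda>y. exp (-(y\<^sup>2) / 2))"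
  obtains \<Psi> :: "real \<Rightarrow> real"
  where "mono \<Psi>" "\<And>r. \<bar>\<Psi> r\<bar> \<le> K"
    "\<And>r. 0 < r \<Longrightarrow> r < 1 \<Longrightarrow> (\<Psi> has_real_derivative (N / exp (-(\<Psi> r)\<^sup>2 / 2))) (at r)"
proof -
  define g where "g = (\<lambda>y::real. exp (-(y\<^sup>2) / 2))"
  \<comment> \<open>One unit of room on either side of [-K, K] gives the primitive \<open>H\<close>
    two-sided derivatives at the end points -K and K as well.\<close>
  define a where "a = - K - 1"
  define H where "H = (\<lambda>y. integral {a..y} g)"
  have cg: "continuous_on A g" for A
    unfolding g_def by (intro continuous_intros) auto
  have DH: "(H has_real_derivative g y) (at y)" if "a < y" "y < K + 1" for y
  proof -
    have "(H has_real_derivative g y) (at y within {a..K+1})"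
      unfolding H_def by (rule integral_has_real_derivative) (use that cg in auto)
    then show ?thesis using that by (simp add: at_within_Icc_at)
  qed
  have Hmono: "H x < H y" if "a < x" "x < y" "y < K+1" for x y
    proof (rule DERIV_pos_imp_increasing[OF that(2)])
    fix z assume "x \<le> z" "z \<le> y"
    then show "\<exists>D. (H has_real_derivative D) (at z) \<and> 0 < D"
      using that DH[of z] by (intro exI[of _ "g z"]) (auto simp: g_def)
  qed
  have N: "N = H K - H (-K)"
    unfolding N_def H_def g_def[symmetric]
    using Henstock_Kurzweil_Integration.integral_combine[of a "-K" K g, OF _ _ integrable_continuous_real[OF cg]] K
    by (simp add: a_def)
  have N0: "N > 0" unfolding N using Hmono[of "-K" K] K by (auto simp: a_def)
  define P where "P = (\<lambda>y. (H y - H (-K)) / N)"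
  have DP: "(P has_real_derivative g y / N) (at y)" if "a < y" "y < K + 1" for y
    unfolding P_def using DERIV_cdivide[OF DERIV_diff[OF DH[OF that] DERIV_const]] by simp
  have Pmono: "P x < P y" if "a < x" "x < y" "y < K+1" for x y
    unfolding P_def using Hmono[OF that] N0 by (simp add: divide_strict_right_mono)
  have P0: "P (-K) = 0" and P1: "P K = 1" unfolding P_def using N N0 by auto
  have contP: "isCont P y" if "a < y" "y < K + 1" for y using DP[OF that] by (rule DERIV_isCont)
  have ex: "\<exists>y. \<bar>y\<bar> < K \<and> P y = r" if "0 < r" "r < 1" for r
  proof -
    have "\<exists>y\<ge>-K. y \<le> K \<and> P y = r"
      by (rule IVT) (use that P0 P1 K contP in \<open>auto simp: a_def\<close>)
    then obtain y where y: "-K \<le> y" "y \<le> K" "P y = r" by blast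
    with that P0 P1 have "y \<noteq> -K" "y \<noteq> K" by auto
    with y show ?thesis by (intro exI[of _ y]) auto
  qed
  define Q where "Q = (\<lambda>r. SOME y. \<bar>y\<bar> < K \<and> P y = r)"
  have Q: "\<bar>Q r\<bar> < K" "P (Q r) = r" if "0 < r" "r < 1" for r
    using someI_ex[OF ex[OF that]] unfolding Q_def by auto
  have QP: "Q (P y) = y" if "\<bar>y\<bar> < K" for y
  proof -
    have "0 < P y" "P y < 1"
      using Pmono[of "-K" y] Pmono[of y K] that P0 P1 by (auto simp: a_def)
    from Q[OF this] have "\<bar>Q (P y)\<bar> < K" "P (Q (P y)) = P y" by auto
    with that have "\<not> y < Q (P y)" "\<not> Q (P y) < y"
      using Pmono[of y "Q (P y)"] Pmono[of "Q (P y)" y] unfolding a_def by linarith+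
    then show ?thesis by simp
  qed
  define \<Psi> where "\<Psi> = (\<lambda>r. if r \<le> 0 then -K else if r \<ge> 1 then K else Q r)"
  have bound: "\<bar>\<Psi> r\<bar> \<le> K" for r
    unfolding \<Psi>_def using Q(1)[of r] K by auto
  have "mono \<Psi>"
  proof (rule monoI)
    fix x y :: real assume xy: "x \<le> y"
    show "\<Psi> x \<le> \<Psi> y"
    proof (cases "0 < x \<and> y < 1")
      case True
      then have *: "0 < x" "x < 1" "0 < y" "y < 1" using xy by auto
      have "\<not> Q y < Q x"
        using Pmono[of "Q y" "Q x"] Q[OF *(1,2)] Q[OF *(3,4)] xy unfolding a_def by linarith
      then show ?thesis using * by (simp add: \<Psi>_def)
    next
      case False
      then show ?thesis using bound[of x] bound[of y] xy K
        unfolding \<Psi>_def by (auto split: if_splits)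
    qed
  qed
  moreover have "(\<Psi> has_real_derivative (N / exp (-(\<Psi> r)\<^sup>2 / 2))) (at r)" if r: "0 < r" "r < 1" for r
  proof -
    have eq: "\<Psi> t = Q t" if "0 < t" "t < 1" for t using that by (simp add: \<Psi>_def)
    define z where "z = Q r"
    have z: "\<bar>z\<bar> < K" "P z = r" using Q[OF r] by (auto simp: z_def)
    \<comment> \<open>The midpoints between \<open>z\<close> and the ends -K and K bound an interval
      around \<open>z\<close>, inside (-K, K), on which \<open>Q\<close> inverts
      \<open>P\<close>.\<close>
    have "isCont Q (P z)"
    proof (rule isCont_inverse_function2[where f = P and x = z and a = "(z - K) / 2" and b = "(z + K) / 2"])
      have *: "\<bar>t\<bar> < K" if "(z - K) / 2 \<le> t" "t \<le> (z + K) / 2" for t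
        using that z(1) by (simp add: abs_less_iff)
      show "Q (P t) = t" if "(z - K) / 2 \<le> t" "t \<le> (z + K) / 2" for t
        using *[OF that] by (rule QP)
      show "isCont P t" if "(z - K) / 2 \<le> t" "t \<le> (z + K) / 2" for t
        using *[OF that] by (intro contP) (auto simp: a_def)
    qed (use z in \<open>auto simp: abs_less_iff\<close>)
    then have cQ: "isCont Q r" by (simp add: z)
    have "(Q has_real_derivative inverse (g z / N)) (at r)"
    proof (rule DERIV_inverse_function[where f = P and a = 0 and b = 1])
      show "(P has_real_derivative g z / N) (at (Q r))"
        using DP[of z] z by (auto simp: a_def z_def[symmetric])
      show "g z / N \<noteq> 0" using N0 by (simp add: g_def)
    qed (use r Q cQ in auto)
    then have "(\<Psi> has_real_derivative inverse (g z / N)) (at r)"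
      by (rule DERIV_cong_ev[THEN iffD1, rotated -1])
         (use r eq in \<open>auto intro!: eventually_mono[OF eventually_nhds_in_open[of "{0<..<1}"]]\<close>)
    moreover have "inverse (g z / N) = N / exp (-(\<Psi> r)\<^sup>2 / 2)"
      by (simp add: g_def z_def eq[OF r] inverse_eq_divide)
    ultimately show ?thesis by metis
  qed
  ultimately show thesis using that bound by blast
qed

text \<open>The point \<open>x + (t - x \<bullet> b) *\<^sub>R b\<close> is x with its b-coordinate
  replaced by t, so \<open>h\<close> is the marginal of \<open>g\<close> with that coordinate
  integrated out, and g / h is the conditional density along the line through x. \<open>T\<close>
  composes the conditional distribution function F / h with the Gaussian quantile. Since
  \<open>h\<close> is constant along the line, the chain rule gives the stated derivative and the
  monotonicity of F gives that of \<open>T\<close>.\<close>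

lemma knothe_step:
  fixes g :: "'a::euclidean_space \<Rightarrow> real" and K R :: real
  assumes K: "K > 0" and cont: "continuous_on UNIV g" and nonneg: "\<And>x. 0 \<le> g x"
    and supp: "\<forall>x. g x \<noteq> 0 \<longrightarrow> \<bar>x \<bullet> b\<bar> \<le> R" and b: "b \<in> Basis"
  defines "N \<equiv> integral {-K..K} (\<lambda>y. exp (-(y\<^sup>2) / 2))"
  defines "h \<equiv> \<lambda>x. LINT t|lborel. g (x + (t - x \<bullet> b) *\<^sub>R b)"
  shows "continuous_on UNIV h" "\<And>x. 0 \<le> h x" "\<And>x. g x > 0 \<Longrightarrow> h x > 0"
    "\<And>x r. h (x + r *\<^sub>R b) = h x"
    "\<And>x. integrable lborel (\<lambda>t. g (x + (t - x \<bullet> b) *\<^sub>R b))"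
    "\<exists>T. T \<in> borel_measurable borel \<and> (\<forall>x. \<bar>T x\<bar> \<le> K) \<and>
       (\<forall>x t. 0 \<le> t \<longrightarrow> T x \<le> T (x + t *\<^sub>R b)) \<and>
       (\<forall>x. g x > 0 \<longrightarrow>
          ((\<lambda>t. T (x + t *\<^sub>R b)) has_real_derivative g x / (h x * (exp (-(T x)\<^sup>2 / 2) / N))) (at 0))"
proof -
  define s where "s = (\<lambda>x t. g (x + (t - x \<bullet> b) *\<^sub>R b))"
  have bb: "b \<bullet> b = 1" using b by (simp add: inner_same_Basis)
  have s0: "s x t = 0" if "\<bar>t\<bar> > R" for x t
  proof (rule ccontr)
    assume "s x t \<noteq> 0"
    then have "\<bar>(x + (t - x \<bullet> b) *\<^sub>R b) \<bullet> b\<bar> \<le> R" unfolding s_def using supp by blast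
    then show False using that by (simp add: inner_add_left bb)
  qed
  have sR: "-R \<le> t \<and> t \<le> R" if "s x t \<noteq> 0" for x t
    using s0[of t x] that by linarith
  have s_shift: "s (x + r *\<^sub>R b) t = s x t" for x r t
    unfolding s_def by (simp add: inner_add_left bb algebra_simps)
  have s_self: "s x (x \<bullet> b) = g x" for x unfolding s_def by simp
  have conts: "continuous_on A (\<lambda>(x, t). s x t)" for A
    unfolding s_def split_def
    by (rule continuous_on_compose2[OF cont]) (auto intro!: continuous_intros)
  have conts1: "continuous_on A (s x)" for A x
    unfolding s_def
    by (rule continuous_on_compose2[OF cont]) (auto intro!: continuous_intros)
  have snn: "0 \<le> s x t" for x t using nonneg by (simp add: s_def)
  have LI: "set_integrable lborel {l..u} (s x)" for l u x
    using borel_integrable_atLeastAtMost'[OF conts1] .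
  have eqI: "integral {l..u} (s x) = (LINT t|lborel. indicator {l..u} t * s x t)" for l u x
    using set_borel_integral_eq_integral(2)[OF LI] by (simp add: set_lebesgue_integral_def)
  have h_s: "h x = (LINT t|lborel. s x t)" for x by (simp add: h_def s_def)
  have h_eq: "h x = integral {-r..r} (s x)" if "r \<ge> R" for x r
    unfolding eqI h_s
    by (rule Bochner_Integration.integral_cong) (use sR that in \<open>force simp: indicator_def\<close>)+
  show inth: "integrable lborel (\<lambda>t. g (x + (t - x \<bullet> b) *\<^sub>R b))" for x
  proof -
    have "(\<lambda>t. indicator {-R..R} t *\<^sub>R s x t) = s x"
    proof
      show "indicator {-R..R} t *\<^sub>R s x t = s x t" for t
        using sR[of x t] by (cases "s x t = 0") (auto simp: indicator_def)
    qed
    with LI[of "-R" R x] show ?thesis by (simp add: set_integrable_def s_def)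
  qed
  show "continuous_on UNIV h"
  proof -
    have "continuous_on UNIV (\<lambda>x. integral (cbox (-R) R) (s x))"
      by (rule integral_continuous_on_param) (rule conts)
    then show ?thesis by (simp add: h_eq[OF order_refl])
  qed
  show hnn: "0 \<le> h x" for x unfolding h_def using nonneg by simp
  show hshift: "h (x + r *\<^sub>R b) = h x" for x r
    unfolding h_s s_shift ..
  define F where "F = (\<lambda>x. LINT t|lborel. indicator {..x \<bullet> b} t * s x t)"
  have F_eq: "F x = integral {-r..x \<bullet> b} (s x)" if "r \<ge> R" for x r
    unfolding eqI F_def
    by (rule Bochner_Integration.integral_cong) (use sR that in \<open>force simp: indicator_def\<close>)+
  have Fint: "integrable lborel (\<lambda>t. indicator {..a} t * s x t)" for a x
    using integrable_mult_indicator[OF _ inth[of x], of "{..a}"] by (simp add: s_def)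
  have Fmono: "F x \<le> F (x + r *\<^sub>R b)" if "r \<ge> 0" for x r
    unfolding F_def s_shift using that snn
    by (intro integral_mono Fint) (auto simp: indicator_def inner_add_left bb)
  have F0: "0 \<le> F x" for x unfolding F_def using snn by simp
  have Fh: "F x \<le> h x" for x
    unfolding F_def h_s using snn inth[of x]
    by (intro integral_mono Fint) (auto simp: indicator_def s_def)
  have DF: "((\<lambda>r. F (x + r *\<^sub>R b)) has_real_derivative g x) (at 0)" for x
  proof -
    define r0 where "r0 = max R (\<bar>x \<bullet> b\<bar> + 1)"
    have r0: "r0 \<ge> R" "- r0 < x \<bullet> b" "x \<bullet> b < r0" unfolding r0_def by linarith+
    have "((\<lambda>u. integral {-r0..u} (s x)) has_real_derivative s x (x \<bullet> b)) (at (x \<bullet> b) within {-r0..r0})"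
      by (rule integral_has_real_derivative) (use r0 conts1 in auto)
    then have "((\<lambda>u. integral {-r0..u} (s x)) has_real_derivative g x) (at (x \<bullet> b))"
      using r0 by (simp add: at_within_Icc_at s_self)
    then have "((\<lambda>r. integral {-r0..r + x \<bullet> b} (s x)) has_real_derivative g x) (at 0)"
      using DERIV_shift[of "\<lambda>u. integral {-r0..u} (s x)" "g x" 0 "x \<bullet> b"] by (simp add: add.commute)
    moreover have "F (x + r *\<^sub>R b) = integral {-r0..r + x \<bullet> b} (s x)" for r
      using F_eq[OF r0(1), of "x + r *\<^sub>R b"] by (simp add: s_shift[abs_def] inner_add_left bb add.commute)
    ultimately show ?thesis by simp
  qed
  \<comment> \<open>\<open>F\<close> has derivative g x > 0 along the line, so it is strictly
    smaller just before x and strictly larger just after; as its values lie between 0 and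
    \<open>h x\<close>, both inequalities are strict at x. This places F / h in (0, 1), where the
    quantile is differentiable.\<close>
  have strict: "0 < F x \<and> F x < h x" if gx: "g x > 0" for x
  proof -
    obtain d where d: "d > 0" "\<And>k. 0 < k \<Longrightarrow> k < d \<Longrightarrow> F (x + (0 - k) *\<^sub>R b) < F (x + 0 *\<^sub>R b)"
      using DERIV_pos_inc_left[of "\<lambda>r. F (x + r *\<^sub>R b)", OF DF gx] by blast
    obtain e where e: "e > 0" "\<And>k. 0 < k \<Longrightarrow> k < e \<Longrightarrow> F (x + 0 *\<^sub>R b) < F (x + (0 + k) *\<^sub>R b)"
      using DERIV_pos_inc_right[of "\<lambda>r. F (x + r *\<^sub>R b)", OF DF gx] by blast
    from d(2)[of "d/2"] d(1) F0[of "x + (0 - d/2) *\<^sub>R b"] have "0 < F x" by simp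
    moreover from e(2)[of "e/2"] e(1) Fh[of "x + (0 + e/2) *\<^sub>R b"] have "F x < h x"
      by (simp add: hshift)
    ultimately show ?thesis ..
  qed
  show "h x > 0" if "g x > 0" for x using strict[OF that] by simp
  have [measurable]: "g \<in> borel_measurable borel" using cont by (rule borel_measurable_continuous_onI)
  have [measurable]: "F \<in> borel_measurable borel" "h \<in> borel_measurable borel"
    unfolding F_def h_def s_def
    by (auto intro!: lborel.borel_measurable_lebesgue_integral simp: indicator_def[abs_def] atMost_def)
  obtain \<Psi> :: "real \<Rightarrow> real" where \<Psi>: "mono \<Psi>" "\<And>r. \<bar>\<Psi> r\<bar> \<le> K"
    "\<And>r. 0 < r \<Longrightarrow> r < 1 \<Longrightarrow> (\<Psi> has_real_derivative (N / exp (-(\<Psi> r)\<^sup>2 / 2))) (at r)"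
    using truncated_gaussian_quantile[OF K] unfolding N_def by blast
  have [measurable]: "\<Psi> \<in> borel_measurable borel" using \<Psi>(1) by (rule borel_measurable_mono)
  \<comment> \<open>Where \<open>h x = 0\<close> the quotient is 0 by the convention for division;
    \<open>T\<close> remains bounded and monotone there because \<open>\<Psi>\<close> is so on all
    of the real line.\<close>
  define T where "T = (\<lambda>x. \<Psi> (F x / h x))"
  have "T \<in> borel_measurable borel" unfolding T_def by measurable
  moreover have "\<bar>T x\<bar> \<le> K" for x unfolding T_def by (rule \<Psi>)
  moreover have "T x \<le> T (x + t *\<^sub>R b)" if "0 \<le> t" for x t
    unfolding T_def hshift by (intro monoD[OF \<Psi>(1)] divide_right_mono Fmono that hnn)
  moreover have "((\<lambda>t. T (x + t *\<^sub>R b)) has_real_derivative g x / (h x * (exp (-(T x)\<^sup>2 / 2) / N))) (at 0)"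
    if gx: "g x > 0" for x
  proof -
    from strict[OF gx] have *: "0 < F x / h x" "F x / h x < 1" "h x > 0" by auto
    have 1: "((\<lambda>t. F (x + t *\<^sub>R b) / h x) has_real_derivative g x / h x) (at 0)"
      using DF[of x] by (rule DERIV_cdivide)
    have "((\<lambda>t. \<Psi> (F (x + t *\<^sub>R b) / h x)) has_real_derivative
       (N / exp (-(\<Psi> (F x / h x))\<^sup>2 / 2)) * (g x / h x)) (at 0)"
      by (rule DERIV_chain2[OF _ 1]) (use \<Psi>(3)[OF *(1,2)] in simp)
    then show ?thesis unfolding T_def hshift by (simp add: mult.commute)
  qed
  ultimately show "\<exists>T. T \<in> borel_measurable borel \<and> (\<forall>x. \<bar>T x\<bar> \<le> K) \<and>
       (\<forall>x t. 0 \<le> t \<longrightarrow> T x \<le> T (x + t *\<^sub>R b)) \<and>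
       (\<forall>x. g x > 0 \<longrightarrow>
          ((\<lambda>t. T (x + t *\<^sub>R b)) has_real_derivative g x / (h x * (exp (-(T x)\<^sup>2 / 2) / N))) (at 0))"
    by blast
qed

lemma truncated_gaussian_mass_pos:
  fixes K :: real
  assumes "K > 0"
  shows "integral {-K..K} (\<lambda>y. exp (-(y\<^sup>2) / 2)) > 0"
proof -
  have "integral {-K..K} (\<lambda>y::real. exp (-(K\<^sup>2) / 2)) \<le> integral {-K..K} (\<lambda>y. exp (-(y\<^sup>2) / 2))"
  proof (rule integral_le)
    fix y assume "y \<in> {-K..K}"
    then have "y\<^sup>2 \<le> K\<^sup>2" by (simp add: abs_le_square_iff[symmetric] abs_le_iff)
    then show "exp (-(K\<^sup>2) / 2) \<le> exp (-(y\<^sup>2) / 2)" by simp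
  qed (auto intro!: integrable_continuous_real continuous_intros)
  moreover have "integral {-K..K} (\<lambda>y::real. exp (-(K\<^sup>2) / 2)) = 2 * K * exp (-(K\<^sup>2) / 2)"
    using assms by simp
  ultimately show ?thesis using assms by (smt (verit) exp_gt_zero mult_pos_pos)
qed

text \<open>
  A triangular (Knothe) transport map of the density \<open>f\<close> to a product of truncated Gaussians;
  \<open>S b\<close> is the derivative of the component \<open>T b\<close> in its own direction \<open>b\<close>. The component \<open>T b\<close>
  is the conditional quantile transform in the direction \<open>b\<close> of the marginal of \<open>f\<close> in which the
  previously treated directions are integrated out, and the product formula telescopes.
\<close>

lemma knothe_map:
  fixes f :: "'a::euclidean_space \<Rightarrow> real" and K R :: real
  assumes K: "K > 0" and cont: "continuous_on UNIV f" and nonneg: "\<And>x. 0 \<le> f x"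
    and supp: "\<forall>x. \<forall>b\<in>Basis. f x \<noteq> 0 \<longrightarrow> \<bar>x \<bullet> b\<bar> \<le> R"
  defines "N \<equiv> integral {-K..K} (\<lambda>y. exp (-(y\<^sup>2) / 2))"
  shows "\<exists>T S. (\<forall>b\<in>Basis. T b \<in> borel_measurable borel \<and> S b \<in> borel_measurable borel \<and>
        (\<forall>x. \<bar>T b x\<bar> \<le> K \<and> 0 \<le> S b x \<and> (\<forall>t\<ge>0. T b x \<le> T b (x + t *\<^sub>R b)) \<and>
          (f x > 0 \<longrightarrow> ((\<lambda>t. T b (x + t *\<^sub>R b)) has_real_derivative S b x) (at 0)))) \<and>
      (\<forall>x. f x > 0 \<longrightarrow>
        f x = (LINT x|lborel. f x) * (\<Prod>b\<in>Basis. exp (-(T b x)\<^sup>2 / 2) / N * S b x))"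
proof -
  \<comment> \<open>The coordinates in \<open>J\<close> are taken from \<open>y\<close>, the others
    from \<open>x\<close>.\<close>
  define sub where "sub = (\<lambda>J x y. \<Sum>b\<in>Basis. (if b \<in> J then y b else x \<bullet> b) *\<^sub>R (b::'a))"
  have N0: "N > 0" unfolding N_def using K by (rule truncated_gaussian_mass_pos)
  interpret product_sigma_finite "\<lambda>_::'a. lborel :: real measure" ..
  have [measurable]: "f \<in> borel_measurable borel" using cont by (rule borel_measurable_continuous_onI)
  \<comment> \<open>The invariant over the set \<open>J\<close> of treated directions:
    \<open>g\<close> is the marginal of \<open>f\<close> with the coordinates in \<open>J\<close>
    integrated out. It is stated as a nonnegative integral, so that Tonelli applies without
    integrability. For J = Basis the marginal is the constant total mass of
    \<open>f\<close>.\<close>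
  define good where "good = (\<lambda>J g T S.
      continuous_on UNIV g \<and> (\<forall>x. 0 \<le> g x) \<and>
      (\<forall>x b. g x \<noteq> 0 \<longrightarrow> b \<in> Basis - J \<longrightarrow> \<bar>x \<bullet> b\<bar> \<le> R) \<and>
      (\<forall>x. ennreal (g x) = (\<integral>\<^sup>+ y. ennreal (f (sub J x y)) \<partial>Pi\<^sub>M J (\<lambda>_. lborel))) \<and>
      (\<forall>b\<in>J. T b \<in> borel_measurable borel \<and> S b \<in> borel_measurable borel \<and>
        (\<forall>x. \<bar>T b x\<bar> \<le> K \<and> 0 \<le> S b x \<and> (\<forall>t\<ge>0. T b x \<le> T b (x + t *\<^sub>R b)) \<and>
          (f x > 0 \<longrightarrow> ((\<lambda>t. T b (x + t *\<^sub>R b)) has_real_derivative S b x) (at 0)))) \<and>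
      (\<forall>x. f x > 0 \<longrightarrow> g x > 0 \<and>
        f x = g x * (\<Prod>b\<in>J. exp (-(T b x)\<^sup>2 / 2) / N * S b x)))"
  have ex: "\<exists>g T S. good J g T S" if "finite J" "J \<subseteq> Basis" for J
    using that
  proof (induction J rule: finite_induct)
    case empty
    have "sub {} x y = x" for x y by (simp add: sub_def euclidean_representation)
    then have "(\<integral>\<^sup>+ y. ennreal (f (sub {} x y)) \<partial>Pi\<^sub>M {} (\<lambda>_. lborel)) = ennreal (f x)" for x
      by (subst nn_integral_empty) simp_all
    then have "good {} f T S" for T S
      unfolding good_def by (simp add: cont nonneg supp del: nn_integral_const)
    then show ?case by blast
  next
    case (insert b J)
    then have b: "b \<in> Basis" and J: "J \<subseteq> Basis" "finite J" "b \<notin> J" by auto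
    have bb: "b \<bullet> b = 1" using b by (simp add: inner_same_Basis)
    from insert obtain g T S where "good J g T S" by auto
    then have g: "continuous_on UNIV g" "\<And>x. 0 \<le> g x"
      "\<And>x b. g x \<noteq> 0 \<Longrightarrow> b \<in> Basis - J \<Longrightarrow> \<bar>x \<bullet> b\<bar> \<le> R"
      "\<And>x. ennreal (g x) = (\<integral>\<^sup>+ y. ennreal (f (sub J x y)) \<partial>Pi\<^sub>M J (\<lambda>_. lborel))"
      and T: "\<And>b. b \<in> J \<Longrightarrow> T b \<in> borel_measurable borel \<and> S b \<in> borel_measurable borel \<and>
        (\<forall>x. \<bar>T b x\<bar> \<le> K \<and> 0 \<le> S b x \<and> (\<forall>t\<ge>0. T b x \<le> T b (x + t *\<^sub>R b)) \<and>
          (f x > 0 \<longrightarrow> ((\<lambda>t. T b (x + t *\<^sub>R b)) has_real_derivative S b x) (at 0)))"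
      and fg: "\<And>x. f x > 0 \<Longrightarrow> g x > 0"
        "\<And>x. f x > 0 \<Longrightarrow> f x = g x * (\<Prod>b\<in>J. exp (-(T b x)\<^sup>2 / 2) / N * S b x)"
      unfolding good_def by blast+
    have [measurable]: "g \<in> borel_measurable borel" using g(1) by (rule borel_measurable_continuous_onI)
    have suppb: "\<forall>x. g x \<noteq> 0 \<longrightarrow> \<bar>x \<bullet> b\<bar> \<le> R" using g(3) b J by blast
    define h where "h x = (LINT t|lborel. g (x + (t - x \<bullet> b) *\<^sub>R b))" for x
    note step = knothe_step[OF K g(1,2) suppb b, folded h_def N_def]
    from step(6) obtain T' where T'0: "T' \<in> borel_measurable borel \<and> (\<forall>x. \<bar>T' x\<bar> \<le> K) \<and>
       (\<forall>x t. 0 \<le> t \<longrightarrow> T' x \<le> T' (x + t *\<^sub>R b)) \<and>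
       (\<forall>x. g x > 0 \<longrightarrow>
          ((\<lambda>t. T' (x + t *\<^sub>R b)) has_real_derivative g x / (h x * (exp (-(T' x)\<^sup>2 / 2) / N))) (at 0))"
      by (elim exE)
    have T': "T' \<in> borel_measurable borel" "\<And>x. \<bar>T' x\<bar> \<le> K"
      "\<And>x t. 0 \<le> t \<Longrightarrow> T' x \<le> T' (x + t *\<^sub>R b)"
      "\<And>x. g x > 0 \<Longrightarrow>
          ((\<lambda>t. T' (x + t *\<^sub>R b)) has_real_derivative g x / (h x * (exp (-(T' x)\<^sup>2 / 2) / N))) (at 0)"
      using T'0 by simp_all
    have [measurable]: "h \<in> borel_measurable borel" using step(1) by (rule borel_measurable_continuous_onI)
    note [measurable] = T'(1)
    define S' where "S' = (\<lambda>x. g x / (h x * (exp (-(T' x)\<^sup>2 / 2) / N)))"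
    have "good (insert b J) h (T(b := T')) (S(b := S'))"
      unfolding good_def
    proof (intro conjI allI impI ballI)
      show "continuous_on UNIV h" "0 \<le> h x" for x by (fact step)+
      show "\<bar>x \<bullet> c\<bar> \<le> R" if "h x \<noteq> 0" "c \<in> Basis - insert b J" for x c
      proof -
        have "\<exists>t. g (x + (t - x \<bullet> b) *\<^sub>R b) \<noteq> 0"
          using that(1) unfolding h_def by (metis (no_types, lifting) Bochner_Integration.integral_zero Bochner_Integration.integral_cong)
        then obtain t where "g (x + (t - x \<bullet> b) *\<^sub>R b) \<noteq> 0" ..
        with g(3)[OF this, of c] that(2) b show ?thesis
          by (auto simp: inner_add_left inner_not_same_Basis)
      qed
      show "ennreal (h x) = (\<integral>\<^sup>+ y. ennreal (f (sub (insert b J) x y)) \<partial>Pi\<^sub>M (insert b J) (\<lambda>_. lborel))" for x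
      proof -
        have "sub (insert b J) x (y(b := t)) = sub J (x + (t - x \<bullet> b) *\<^sub>R b) y" for y t
          unfolding sub_def
          by (rule sum.cong) (use J b in \<open>auto simp: inner_add_left bb inner_not_same_Basis\<close>)
        moreover have "ennreal (h x) = (\<integral>\<^sup>+ t. ennreal (g (x + (t - x \<bullet> b) *\<^sub>R b)) \<partial>lborel)"
          unfolding h_def by (rule nn_integral_eq_integral[symmetric]) (use step(5) g(2) in auto)
        moreover have "(\<integral>\<^sup>+ y. ennreal (f (sub (insert b J) x y)) \<partial>Pi\<^sub>M (insert b J) (\<lambda>_. lborel)) =
          (\<integral>\<^sup>+ t. (\<integral>\<^sup>+ y. ennreal (f (sub (insert b J) x (y(b := t)))) \<partial>Pi\<^sub>M J (\<lambda>_. lborel)) \<partial>lborel)"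
        proof (rule product_nn_integral_insert_rev)
          have "(\<lambda>y. if c \<in> insert b J then y c else x \<bullet> c)
              \<in> borel_measurable (Pi\<^sub>M (insert b J) (\<lambda>_. lborel))" for c
          proof (cases "c \<in> insert b J")
            case True
            then have "(\<lambda>y. y c) \<in> measurable (Pi\<^sub>M (insert b J) (\<lambda>_. lborel)) (lborel :: real measure)"
              by (rule measurable_component_singleton)
            with True show ?thesis by (simp only: if_True) simp
          qed simp
          then have "sub (insert b J) x \<in> borel_measurable (Pi\<^sub>M (insert b J) (\<lambda>_. lborel))"
            unfolding sub_def by (intro borel_measurable_sum borel_measurable_scaleR) auto
          then show "(\<lambda>y. ennreal (f (sub (insert b J) x y)))
              \<in> borel_measurable (Pi\<^sub>M (insert b J) (\<lambda>_. lborel))"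
            by measurable
        qed (use J in auto)
        ultimately show ?thesis by (simp add: g(4))
      qed
      show "(T(b := T')) c \<in> borel_measurable borel" "(S(b := S')) c \<in> borel_measurable borel"
        if "c \<in> insert b J" for c
        using that T[of c] by (auto simp: S'_def[abs_def])
      show "\<bar>(T(b := T')) c x\<bar> \<le> K" "0 \<le> (S(b := S')) c x" if "c \<in> insert b J" for c x
        using that T[of c] T'(2) step(2) g(2) N0 by (auto simp: S'_def)
      show "(T(b := T')) c x \<le> (T(b := T')) c (x + t *\<^sub>R c)" if "c \<in> insert b J" "t \<ge> 0" for c x t
        using that T[of c] T'(3) by auto
      show "((\<lambda>t. (T(b := T')) c (x + t *\<^sub>R c)) has_real_derivative (S(b := S')) c x) (at 0)"
        if "c \<in> insert b J" "f x > 0" for c x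
        using that T[of c] T'(4)[OF fg(1)] J by (auto simp: S'_def)
      show "h x > 0" if "f x > 0" for x using that fg(1) step(3) by blast
      show "f x = h x * (\<Prod>c\<in>insert b J. exp (-((T(b := T')) c x)\<^sup>2 / 2) / N * (S(b := S')) c x)"
        if "f x > 0" for x
      proof -
        let ?P = "\<Prod>c\<in>J. exp (-(T c x)\<^sup>2 / 2) / N * S c x"
        have "(\<Prod>c\<in>insert b J. exp (-((T(b := T')) c x)\<^sup>2 / 2) / N * (S(b := S')) c x) =
          exp (-(T' x)\<^sup>2 / 2) / N * S' x *
          (\<Prod>c\<in>J. exp (-((T(b := T')) c x)\<^sup>2 / 2) / N * (S(b := S')) c x)"
          by (subst prod.insert[OF J(2,3)]) (simp only: fun_upd_same)
        also have "(\<Prod>c\<in>J. exp (-((T(b := T')) c x)\<^sup>2 / 2) / N * (S(b := S')) c x) = ?P"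
          using J by (intro prod.cong) auto
        finally have 1: "(\<Prod>c\<in>insert b J. exp (-((T(b := T')) c x)\<^sup>2 / 2) / N * (S(b := S')) c x) =
          exp (-(T' x)\<^sup>2 / 2) / N * S' x * ?P" .
        have 2: "h x * (exp (-(T' x)\<^sup>2 / 2) / N * S' x) = g x"
          using step(3)[OF fg(1)[OF that]] N0 by (simp add: S'_def)
        show ?thesis unfolding 1 mult.assoc[symmetric] unfolding mult.assoc[of "h x"] 2
          using fg(2)[OF that] by simp
      qed
    qed
    then show ?case by blast
  qed
  from ex[of Basis] obtain g T S where "good Basis g T S" by auto
  then have g: "\<And>x. 0 \<le> g x"
      "\<And>x. ennreal (g x) = (\<integral>\<^sup>+ y. ennreal (f (sub Basis x y)) \<partial>Pi\<^sub>M Basis (\<lambda>_. lborel))"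
      and T: "\<And>b. b \<in> Basis \<Longrightarrow> T b \<in> borel_measurable borel \<and> S b \<in> borel_measurable borel \<and>
        (\<forall>x. \<bar>T b x\<bar> \<le> K \<and> 0 \<le> S b x \<and> (\<forall>t\<ge>0. T b x \<le> T b (x + t *\<^sub>R b)) \<and>
          (f x > 0 \<longrightarrow> ((\<lambda>t. T b (x + t *\<^sub>R b)) has_real_derivative S b x) (at 0)))"
      and fg: "\<And>x. f x > 0 \<Longrightarrow> f x = g x * (\<Prod>b\<in>Basis. exp (-(T b x)\<^sup>2 / 2) / N * S b x)"
    unfolding good_def by blast+
  have "g x = (LINT x|lborel. f x)" for x
  proof -
    have "ennreal (g x) = (\<integral>\<^sup>+ y. ennreal (f y) \<partial>lborel)"
      unfolding g(2) sub_def by (subst (2) lborel_eq) (simp add: nn_integral_distr)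
    then have "enn2real (\<integral>\<^sup>+ y. ennreal (f y) \<partial>lborel) = g x"
      using g(1) by (metis enn2real_ennreal)
    then show ?thesis using nonneg by (simp add: integral_eq_nn_integral)
  qed
  with T fg show ?thesis by (intro exI[of _ T] exI[of _ S]) simp
qed

section \<open>The inequality for continuous functions of compact support\<close>

lemma nn_integral_lborel_shift:
  fixes f :: "'a::euclidean_space \<Rightarrow> ennreal"
  assumes "f \<in> borel_measurable borel"
  shows "(\<integral>\<^sup>+ x. f (x + c) \<partial>lborel) = (\<integral>\<^sup>+ x. f x \<partial>lborel)"
proof -
  have "(\<integral>\<^sup>+ x. f x \<partial>lborel) = (\<integral>\<^sup>+ x. f x \<partial>distr lborel borel ((+) c))"
    by (simp add: lborel_distr_plus)
  also have "\<dots> = (\<integral>\<^sup>+ x. f (x + c) \<partial>lborel)"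
    using assms by (subst nn_integral_distr) (simp_all add: add.commute)
  finally show ?thesis ..
qed

lemma integrable_lborel_shift:
  fixes f :: "'a::euclidean_space \<Rightarrow> 'b::{banach, second_countable_topology}"
  assumes "integrable lborel f"
  shows "integrable lborel (\<lambda>x. f (x + c))"
proof -
  have "integrable (distr lborel borel ((+) c)) f" using assms by (simp add: lborel_distr_plus)
  then have "integrable lborel (\<lambda>x. f (c + x))" by (rule integrable_distr[rotated]) simp
  then show ?thesis by (simp add: add.commute)
qed

lemma integral_lborel_shift:
  fixes f :: "'a::euclidean_space \<Rightarrow> 'b::{banach, second_countable_topology}"
  assumes "f \<in> borel_measurable borel"
  shows "(LINT x|lborel. f (x + c)) = (LINT x|lborel. f x)"
proof -
  have "(LINT x|lborel. f x) = (LINT x|distr lborel borel ((+) c). f x)"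
    by (simp add: lborel_distr_plus)
  also have "\<dots> = (LINT x|lborel. f (x + c))"
    using assms by (subst integral_distr) (simp_all add: add.commute)
  finally show ?thesis ..
qed

text \<open>The arithmetic-geometric mean inequality with weight \<open>s\<close> on every
  \<open>a i\<close> and the remaining weight on the number 1. The proof bounds ln by its tangent at
  the mean \<open>M\<close>.\<close>

lemma prod_powr_le_weighted_mean:
  fixes a :: "'i \<Rightarrow> real" and s :: real
  assumes "finite I" and a: "\<And>i. i \<in> I \<Longrightarrow> 0 < a i" and s: "0 \<le> s" "real (card I) * s \<le> 1"
  shows "(\<Prod>i\<in>I. a i powr s) \<le> 1 - real (card I) * s + s * (\<Sum>i\<in>I. a i)"
proof (cases "s = 0 \<or> I = {}")
  case True
  then show ?thesis using a by (fastforce intro!: prod_le_1)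
next
  case False
  define M where "M = 1 - real (card I) * s + s * (\<Sum>i\<in>I. a i)"
  have "(\<Sum>i\<in>I. a i) > 0" using False assms by (intro sum_pos) auto
  then have M: "M > 0" using False s by (auto simp: M_def intro!: add_nonneg_pos)
  have "s * ln (a i) \<le> s * (a i / M - 1 + ln M)" if "i \<in> I" for i
    using ln_le_minus_one[of "a i / M"] M a[OF that] s
    by (intro mult_left_mono) (simp_all add: ln_div)
  then have "(\<Sum>i\<in>I. s * ln (a i)) \<le> (\<Sum>i\<in>I. s * (a i / M - 1 + ln M))"
    by (rule sum_mono)
  also have "\<dots> = s * (\<Sum>i\<in>I. a i) / M + real (card I) * s * (ln M - 1)"
    by (simp add: sum.distrib sum_subtractf sum_distrib_left[symmetric] sum_divide_distrib[symmetric] algebra_simps)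
  also have "\<dots> \<le> ln M"
  proof -
    have "(1 - real (card I) * s) * (- ln M) \<le> (1 - real (card I) * s) * (1 / M - 1)"
      using ln_le_minus_one[of "1 / M"] M s by (intro mult_left_mono) (simp_all add: ln_div)
    moreover have "s * (\<Sum>i\<in>I. a i) / M = (M - (1 - real (card I) * s)) / M" by (simp add: M_def)
    then have "s * (\<Sum>i\<in>I. a i) / M = 1 - (1 - real (card I) * s) * (1 / M)"
      using M by (simp add: diff_divide_distrib)
    ultimately show ?thesis by (simp add: algebra_simps)
  qed
  finally have "exp (\<Sum>i\<in>I. s * ln (a i)) \<le> M"
    using M by (metis exp_le_cancel_iff exp_ln)
  moreover have "exp (\<Sum>i\<in>I. s * ln (a i)) = (\<Prod>i\<in>I. a i powr s)"
  proof -
    have "a i powr s = exp (s * ln (a i))" if "i \<in> I" for i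
      using a[OF that] by (simp add: powr_def)
    then show ?thesis using assms(1) by (simp add: exp_sum)
  qed
  ultimately show ?thesis by (simp add: M_def)
qed

text \<open>The product of 1 - x + x^2/2 and 1 + x + x^2/2 is 1 + x^4/4, and the second factor is at
  most exp x.\<close>

lemma exp_minus_le_quadratic:
  fixes x :: real
  assumes "0 \<le> x"
  shows "exp (- x) \<le> 1 - x + x\<^sup>2 / 2"
proof -
  have "1 \<le> (1 - x + x\<^sup>2 / 2) * (1 + x + x\<^sup>2 / 2)"
    using assms by (simp add: algebra_simps power2_eq_square)
  also have "\<dots> \<le> (1 - x + x\<^sup>2 / 2) * exp x"
  proof (rule mult_left_mono)
    have "0 \<le> ((1 - x)\<^sup>2 + 1) / 2" by simp
    also have "\<dots> = 1 - x + x\<^sup>2 / 2" by (simp add: power2_eq_square field_simps)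
    finally show "0 \<le> 1 - x + x\<^sup>2 / 2" .
  qed (use exp_lower_Taylor_quadratic[OF assms] in simp)
  finally show ?thesis by (simp add: exp_minus field_simps)
qed

lemma integrable_bounded_mult:
  fixes f g :: "'a \<Rightarrow> real"
  assumes "integrable M f" "g \<in> borel_measurable M" "\<And>x. \<bar>g x\<bar> \<le> B"
  shows "integrable M (\<lambda>x. f x * g x)"
proof (rule Bochner_Integration.integrable_bound)
  show "integrable M (\<lambda>x. B * \<bar>f x\<bar>)" using assms(1) by simp
  have "0 \<le> B" using assms(3)[of undefined] by linarith
  then show "AE x in M. norm (f x * g x) \<le> norm (B * \<bar>f x\<bar>)"
    using assms(3) by (intro AE_I2) (auto simp: abs_mult mult.commute[of "\<bar>f _\<bar>"] intro!: mult_right_mono)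
qed (use assms in \<open>auto intro!: borel_measurable_times borel_measurable_integrable\<close>)

text \<open>Integration by parts for |w|^2 times the derivative of \<open>T\<close>, done on
  difference quotients: \<open>w\<close> needs no gradient and \<open>T\<close> no absolute
  continuity. The quotients of \<open>T\<close> are nonnegative by monotonicity, so Fatou's lemma
  passes to the limit. The parameter \<open>l\<close> is the weight used in completing the square,
  chosen so that the term with T^2 has the coefficient 1/2.\<close>

lemma transport_derivative_bound:
  fixes w :: "'a::euclidean_space \<Rightarrow> 'b::euclidean_space" and T S :: "'a \<Rightarrow> real"
  assumes w: "w \<in> borel_measurable borel" "integrable lborel (\<lambda>x. (norm (w x))\<^sup>2)"
    and T: "T \<in> borel_measurable borel" "\<And>x. \<bar>T x\<bar> \<le> K" "\<And>x t. 0 \<le> t \<Longrightarrow> T x \<le> T (x + t *\<^sub>R b)"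
    and S: "S \<in> borel_measurable borel" "\<And>x. 0 \<le> S x"
      "\<And>x. w x \<noteq> 0 \<Longrightarrow> ((\<lambda>t. T (x + t *\<^sub>R b)) has_real_derivative S x) (at 0)"
    and A: "\<And>t. t > 0 \<Longrightarrow> (LINT x|lborel. (norm (w (x + t *\<^sub>R b) - w x))\<^sup>2) \<le> t\<^sup>2 * A"
    and l: "l > 0"
  shows "integrable lborel (\<lambda>x. (norm (w x))\<^sup>2 * S x)"
    "l * (LINT x|lborel. (norm (w x))\<^sup>2 * S x) \<le>
       2 * l\<^sup>2 * A + (LINT x|lborel. (norm (w x))\<^sup>2 * (T x)\<^sup>2) / 2"
proof -
  note [measurable] = w(1) T(1) S(1)
  define f where "f x = (norm (w x))\<^sup>2" for x
  have [measurable]: "f \<in> borel_measurable borel" unfolding f_def by measurable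
  have fi: "integrable lborel f" using w(2) by (simp add: f_def[abs_def])
  have fnn: "0 \<le> f x" for x by (simp add: f_def)
  have K0: "K \<ge> 0" using T(2)[of 0] by linarith
  define I where "I = (LINT x|lborel. f x * (T x)\<^sup>2)"
  have fT2: "integrable lborel (\<lambda>x. f x * (T x)\<^sup>2)"
    by (rule integrable_bounded_mult[OF fi, of _ "K\<^sup>2"])
       (use T(2) K0 in \<open>auto simp: abs_square_le_1 power2_le_iff_abs_le\<close>)
  \<comment> \<open>The last term is the discretization error. It comes from |w (x - h b)| + |w x|
    <= 2 |w x| + h \<delta>, where \<delta> is the quotient below, and it vanishes with h.\<close>
  define B where "B h = 2 * l * A + I / (2 * l) + K * h * A" for h
  define Q where "Q h x = f x * ((T (x + h *\<^sub>R b) - T x) / h)" for h x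
  have Qnn: "0 \<le> Q h x" if "h > 0" for h x
    unfolding Q_def using that T(3)[of h x] fnn by simp
  have Qint: "integrable lborel (Q h)" and QB: "(LINT x|lborel. Q h x) \<le> B h" if h: "h > 0" for h
  proof -
    have 1: "integrable lborel (\<lambda>x. f x * T x)"
      by (rule integrable_bounded_mult[OF fi _ T(2)]) simp
    have 2: "integrable lborel (\<lambda>x. f x * T (x + h *\<^sub>R b))"
      by (rule integrable_bounded_mult[OF fi _ T(2)]) simp
    have 3: "integrable lborel (\<lambda>x. f (x + (- h) *\<^sub>R b) * T x)"
      by (rule integrable_bounded_mult[OF integrable_lborel_shift[OF fi] _ T(2)]) simp
    have Q_eq: "Q h = (\<lambda>x. (f x * T (x + h *\<^sub>R b) - f x * T x) / h)"
      by (auto simp: Q_def right_diff_distrib)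
    show "integrable lborel (Q h)" unfolding Q_eq using 1 2 by simp
    \<comment> \<open>Summation by parts: a translation of the integral moves the increment from
      \<open>T\<close> to \<open>f\<close>.\<close>
    have shift: "(LINT x|lborel. f x * T (x + h *\<^sub>R b)) = (LINT x|lborel. f (x + (- h) *\<^sub>R b) * T x)"
      using integral_lborel_shift[of "\<lambda>x. f x * T (x + h *\<^sub>R b)" "(- h) *\<^sub>R b"] by simp
    define \<delta> where "\<delta> x = norm (w (x + (- h) *\<^sub>R b) - w x) / h" for x
    have \<delta>i: "integrable lborel (\<lambda>x. (\<delta> x)\<^sup>2)"
    proof (rule Bochner_Integration.integrable_bound)
      show "integrable lborel (\<lambda>x. (2 * f (x + (- h) *\<^sub>R b) + 2 * f x) / h\<^sup>2)"
        using fi integrable_lborel_shift[OF fi, of "(- h) *\<^sub>R b"] by simp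
      have "(norm (u - v))\<^sup>2 \<le> 2 * (norm u)\<^sup>2 + 2 * (norm v)\<^sup>2" for u v :: 'b
      proof -
        have "(norm (u - v))\<^sup>2 \<le> (norm u + norm v)\<^sup>2" by (intro power_mono norm_triangle_ineq4) simp
        also have "\<dots> \<le> 2 * (norm u)\<^sup>2 + 2 * (norm v)\<^sup>2"
          using zero_le_power2[of "norm u - norm v"] by (simp add: power2_eq_square algebra_simps)
        finally show ?thesis .
      qed
      then show "AE x in lborel. norm ((\<delta> x)\<^sup>2) \<le> norm ((2 * f (x + (- h) *\<^sub>R b) + 2 * f x) / h\<^sup>2)"
        unfolding \<delta>_def f_def power_divide by (intro AE_I2) (auto simp: abs_of_nonneg intro!: divide_right_mono)
    qed (simp add: \<delta>_def)
    have "(LINT x|lborel. (\<delta> x)\<^sup>2) = (LINT x|lborel. (norm (w (x + (- h) *\<^sub>R b) - w x))\<^sup>2) / h\<^sup>2"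
      by (simp add: \<delta>_def power_divide)
    also have "(LINT x|lborel. (norm (w (x + (- h) *\<^sub>R b) - w x))\<^sup>2) =
      (LINT x|lborel. (norm (w (x + h *\<^sub>R b) - w x))\<^sup>2)"
      using integral_lborel_shift[of "\<lambda>x. (norm (w (x + h *\<^sub>R b) - w x))\<^sup>2" "(- h) *\<^sub>R b"]
      by (simp add: norm_minus_commute)
    also have "\<dots> / h\<^sup>2 \<le> A" using A[OF h] h by (simp add: field_simps)
    finally have \<delta>A: "(LINT x|lborel. (\<delta> x)\<^sup>2) \<le> A" .
    have pw: "(f (x + (- h) *\<^sub>R b) - f x) / h * T x \<le>
       (2 * l + K * h) * (\<delta> x)\<^sup>2 + f x * (T x)\<^sup>2 / (2 * l)" for x
    proof -
      define u where "u = norm (w (x + (- h) *\<^sub>R b))"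
      define v where "v = norm (w x)"
      have d0: "\<delta> x \<ge> 0" and v0: "v \<ge> 0" and u0: "u \<ge> 0" using h by (auto simp: \<delta>_def v_def u_def)
      have uv: "\<bar>u - v\<bar> \<le> h * \<delta> x"
        using h norm_triangle_ineq3[of "w (x + (- h) *\<^sub>R b)" "w x"] by (simp add: \<delta>_def u_def v_def)
      have "(f (x + (- h) *\<^sub>R b) - f x) / h * T x = (u - v) * (u + v) * T x / h"
        unfolding f_def u_def v_def by (simp add: power2_eq_square algebra_simps)
      also have "\<dots> \<le> (\<bar>u - v\<bar> * (u + v) * \<bar>T x\<bar>) / h"
      proof (rule divide_right_mono)
        have "(u - v) * (u + v) * T x \<le> \<bar>(u - v) * (u + v) * T x\<bar>" by (rule abs_ge_self)
        then show "(u - v) * (u + v) * T x \<le> \<bar>u - v\<bar> * (u + v) * \<bar>T x\<bar>"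
          using u0 v0 by (simp add: abs_mult)
      qed (use h in simp)
      also have "\<dots> \<le> (h * \<delta> x * (2 * v + h * \<delta> x) * \<bar>T x\<bar>) / h"
        using uv u0 v0 h d0 by (intro divide_right_mono mult_mono) auto
      also have "\<dots> = 2 * \<delta> x * v * \<bar>T x\<bar> + h * (\<delta> x)\<^sup>2 * \<bar>T x\<bar>"
        using h by (simp add: field_simps power2_eq_square)
      also have "\<dots> \<le> (2 * l * (\<delta> x)\<^sup>2 + v\<^sup>2 * (T x)\<^sup>2 / (2 * l)) + h * (\<delta> x)\<^sup>2 * K"
      proof (intro add_mono mult_left_mono T(2))
        have "0 \<le> (2 * l * \<delta> x - v * \<bar>T x\<bar>)\<^sup>2 / (2 * l)" using l by simp
        also have "\<dots> = 2 * l * (\<delta> x)\<^sup>2 + v\<^sup>2 * (T x)\<^sup>2 / (2 * l) - 2 * \<delta> x * v * \<bar>T x\<bar>"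
          using l by (simp add: power2_diff power_mult_distrib field_simps power2_eq_square)
        finally show "2 * \<delta> x * v * \<bar>T x\<bar> \<le> 2 * l * (\<delta> x)\<^sup>2 + v\<^sup>2 * (T x)\<^sup>2 / (2 * l)" by simp
      qed (use h in auto)
      finally show ?thesis by (simp add: f_def v_def algebra_simps)
    qed
    have "(LINT x|lborel. Q h x) = (LINT x|lborel. (f (x + (- h) *\<^sub>R b) - f x) / h * T x)"
      unfolding Q_eq using 1 2 3 shift by (simp add: left_diff_distrib)
    also have "\<dots> \<le> (LINT x|lborel. (2 * l + K * h) * (\<delta> x)\<^sup>2 + f x * (T x)\<^sup>2 / (2 * l))"
      using 1 3 \<delta>i fT2 by (intro integral_mono pw) (auto simp: left_diff_distrib)
    also have "\<dots> = (2 * l + K * h) * (LINT x|lborel. (\<delta> x)\<^sup>2) + I / (2 * l)"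
      using \<delta>i fT2 by (simp add: I_def)
    also have "\<dots> \<le> (2 * l + K * h) * A + I / (2 * l)"
      using \<delta>A l h K0 by (intro add_mono mult_left_mono) auto
    finally show "(LINT x|lborel. Q h x) \<le> B h" by (simp add: B_def algebra_simps)
  qed
  define h where "h n = 1 / real (Suc n)" for n
  have h0: "h n > 0" for n by (simp add: h_def)
  have hlim: "h \<longlonglongrightarrow> 0" unfolding h_def by (rule LIMSEQ_Suc) (rule lim_const_over_n)
  \<comment> \<open>The derivative of \<open>T\<close> is known only where w does not vanish;
    elsewhere the factor \<open>f x\<close> is zero on both sides.\<close>
  have lim: "(\<lambda>n. Q (h n) x) \<longlonglongrightarrow> f x * S x" for x
  proof (cases "w x = 0")
    case True
    then show ?thesis by (simp add: Q_def f_def)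
  next
    case False
    have "((\<lambda>t. (T (x + t *\<^sub>R b) - T x) / t) \<longlongrightarrow> S x) (at 0)"
      using S(3)[OF False] by (simp add: has_field_derivative_iff)
    then have "(\<lambda>n. (T (x + h n *\<^sub>R b) - T x) / h n) \<longlonglongrightarrow> S x"
      by (rule filterlim_compose)
         (use h0 hlim in \<open>auto simp: filterlim_at less_imp_neq[OF h0, symmetric]\<close>)
    then show ?thesis unfolding Q_def by (rule tendsto_mult_left)
  qed
  have "(\<integral>\<^sup>+ x. ennreal (f x * S x) \<partial>lborel) = (\<integral>\<^sup>+ x. liminf (\<lambda>n. ennreal (Q (h n) x)) \<partial>lborel)"
    using lim by (intro nn_integral_cong lim_imp_Liminf[symmetric] tendsto_ennrealI) auto
  also have "\<dots> \<le> liminf (\<lambda>n. \<integral>\<^sup>+ x. ennreal (Q (h n) x) \<partial>lborel)"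
    by (rule nn_integral_liminf) (simp add: Q_def[abs_def])
  also have "\<dots> \<le> liminf (\<lambda>n. ennreal (B (h n)))"
    by (rule Liminf_mono)
       (use Qint QB Qnn h0 in \<open>auto simp: nn_integral_eq_integral intro!: ennreal_leI always_eventually\<close>)
  also have "\<dots> = ennreal (2 * l * A + I / (2 * l))"
  proof (rule lim_imp_Liminf)
    have "(\<lambda>n. B (h n)) \<longlonglongrightarrow> 2 * l * A + I / (2 * l) + K * 0 * A"
      unfolding B_def by (intro tendsto_intros hlim)
    then show "(\<lambda>n. ennreal (B (h n))) \<longlonglongrightarrow> ennreal (2 * l * A + I / (2 * l))"
      by (intro tendsto_ennrealI) simp
  qed simp
  finally have le: "(\<integral>\<^sup>+ x. ennreal (f x * S x) \<partial>lborel) \<le> ennreal (2 * l * A + I / (2 * l))" .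
  show int: "integrable lborel (\<lambda>x. (norm (w x))\<^sup>2 * S x)"
    unfolding f_def[symmetric]
    by (rule integrableI_nonneg) (use le fnn S(2) in \<open>auto intro: le_less_trans\<close>)
  have "I \<ge> 0" "A \<ge> 0"
  proof -
    show "I \<ge> 0" unfolding I_def using fnn by simp
    have "0 \<le> (LINT x|lborel. (norm (w (x + 1 *\<^sub>R b) - w x))\<^sup>2)" by simp
    also note A[of 1]
    finally show "A \<ge> 0" by simp
  qed
  then have "(LINT x|lborel. f x * S x) \<le> 2 * l * A + I / (2 * l)"
    using le int fnn S(2) l
    by (subst (asm) nn_integral_eq_integral) (auto simp: f_def ennreal_plus[symmetric] simp del: ennreal_plus)
  then have "l * (LINT x|lborel. f x * S x) \<le> l * (2 * l * A + I / (2 * l))"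
    using l by (intro mult_left_mono) auto
  also have "\<dots> = 2 * l\<^sup>2 * A + I / 2" using l by (simp add: field_simps power2_eq_square)
  finally show "l * (LINT x|lborel. (norm (w x))\<^sup>2 * S x) \<le>
       2 * l\<^sup>2 * A + (LINT x|lborel. (norm (w x))\<^sup>2 * (T x)\<^sup>2) / 2"
    by (simp add: f_def I_def)
qed

text \<open>The scale \<open>l\<close> enters by writing each S_b as (l S_b) / l before the mean
  inequality is applied. With q = |T|^2 <= d K^2, the first term of \<open>D\<close> bounds the
  quadratic remainder of exp (- s q / 2), and the second bounds the product of the first-order terms
  - d s and - s q / 2.\<close>

lemma gn_transport_compact_support:
  fixes w :: "'a::euclidean_space \<Rightarrow> 'b::euclidean_space" and A :: "'a \<Rightarrow> real"
  assumes cont: "continuous_on UNIV w"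
    and supp: "\<And>x b. w x \<noteq> 0 \<Longrightarrow> b \<in> Basis \<Longrightarrow> \<bar>x \<bullet> b\<bar> \<le> R"
    and A: "\<And>b t. b \<in> Basis \<Longrightarrow> t > 0 \<Longrightarrow>
      (LINT x|lborel. (norm (w (x + t *\<^sub>R b) - w x))\<^sup>2) \<le> t\<^sup>2 * A b"
    and K: "K > 0" and l: "l > 0" and s: "0 \<le> s" "real DIM('a) * s \<le> 1"
  defines "N \<equiv> integral {-K..K} (\<lambda>y. exp (-(y\<^sup>2) / 2))"
    and "m \<equiv> (LINT x|lborel. (norm (w x))\<^sup>2)"
    and "D \<equiv> (real DIM('a) * K\<^sup>2)\<^sup>2 / 8 + (real DIM('a))\<^sup>2 * K\<^sup>2 / 2"
  shows "integrable lborel (\<lambda>x. norm (w x) powr (2 + 2 * s))"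
    "integrable lborel (\<lambda>x. (norm (w x))\<^sup>2)"
    "(LINT x|lborel. norm (w x) powr (2 + 2 * s)) \<le>
       m powr s * (N * l) powr (- (real DIM('a) * s)) *
       (m * (1 - real DIM('a) * s + s\<^sup>2 * D) + 2 * s * l\<^sup>2 * (\<Sum>b\<in>Basis. A b))"
proof -
  let ?d = "real DIM('a)"
  have N0: "N > 0" unfolding N_def using K by (rule truncated_gaussian_mass_pos)
  define f where "f x = (norm (w x))\<^sup>2" for x
  have fnn: "0 \<le> f x" for x by (simp add: f_def)
  have fcont: "continuous_on UNIV f" unfolding f_def by (intro continuous_intros cont)
  have f0: "f x \<noteq> 0 \<longleftrightarrow> w x \<noteq> 0" "0 < f x \<longleftrightarrow> w x \<noteq> 0" for x by (auto simp: f_def)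
  have [measurable]: "w \<in> borel_measurable borel" "f \<in> borel_measurable borel"
    using cont fcont by (auto intro: borel_measurable_continuous_onI)
  have fi: "integrable lborel f"
  proof -
    let ?B = "cbox (- R *\<^sub>R One) (R *\<^sub>R One :: 'a)"
    have "integrable lborel (\<lambda>x. indicator ?B x *\<^sub>R f x)"
      by (rule borel_integrable_compact) (auto intro: continuous_on_subset[OF fcont])
    moreover have "(\<lambda>x. indicator ?B x *\<^sub>R f x) = f"
    proof
      fix x
      show "indicator ?B x *\<^sub>R f x = f x"
      proof (cases "w x = 0")
        case False
        then have "x \<in> ?B" using supp[of x] by (auto simp: mem_box abs_le_iff minus_le_iff)
        then show ?thesis by simp
      qed (simp add: f_def)
    qed
    ultimately show ?thesis by simp
  qed
  then show wi: "integrable lborel (\<lambda>x. (norm (w x))\<^sup>2)" by (simp add: f_def[abs_def])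
  have m_f: "m = (LINT x|lborel. f x)" by (simp add: m_def f_def)
  have m0: "0 \<le> m" unfolding m_f using fnn by simp
  have suppf: "\<forall>x. \<forall>b\<in>Basis. f x \<noteq> 0 \<longrightarrow> \<bar>x \<bullet> b\<bar> \<le> R"
    using supp f0(1) by blast
  from knothe_map[OF K fcont fnn suppf, folded N_def m_f]
  obtain T S where TS0: "(\<forall>b\<in>Basis. T b \<in> borel_measurable borel \<and> S b \<in> borel_measurable borel \<and>
        (\<forall>x. \<bar>T b x\<bar> \<le> K \<and> 0 \<le> S b x \<and> (\<forall>t\<ge>0. T b x \<le> T b (x + t *\<^sub>R b)) \<and>
          (f x > 0 \<longrightarrow> ((\<lambda>t. T b (x + t *\<^sub>R b)) has_real_derivative S b x) (at 0)))) \<and>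
      (\<forall>x. f x > 0 \<longrightarrow> f x = m * (\<Prod>b\<in>Basis. exp (-(T b x)\<^sup>2 / 2) / N * S b x))"
    by (elim exE)
  note TS1 = bspec[OF conjunct1[OF TS0]]
  have TS: "T b \<in> borel_measurable borel" "S b \<in> borel_measurable borel"
    "\<bar>T b x\<bar> \<le> K" "0 \<le> t \<Longrightarrow> T b x \<le> T b (x + t *\<^sub>R b)" "0 \<le> S b x"
    "f x > 0 \<Longrightarrow> ((\<lambda>t. T b (x + t *\<^sub>R b)) has_real_derivative S b x) (at 0)"
    if "b \<in> Basis" for b x t
    using TS1[OF that] by blast+
  have fprod: "f x = m * (\<Prod>b\<in>Basis. exp (-(T b x)\<^sup>2 / 2) / N * S b x)" if "f x > 0" for x
    using conjunct2[OF TS0] that by blast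
  define q where "q x = (\<Sum>b\<in>Basis. (T b x)\<^sup>2)" for x
  have [measurable]: "q \<in> borel_measurable borel" unfolding q_def using TS(1) by measurable
  have q0: "0 \<le> q x" for x unfolding q_def by (intro sum_nonneg) auto
  have T2: "(T b x)\<^sup>2 \<le> K\<^sup>2" if "b \<in> Basis" for b x
    using TS(3)[OF that, of x] K by (simp add: power2_le_iff_abs_le)
  have qK: "q x \<le> ?d * K\<^sup>2" for x
  proof -
    have "q x \<le> (\<Sum>b\<in>(Basis::'a set). K\<^sup>2)" unfolding q_def by (rule sum_mono) (rule T2)
    then show ?thesis by simp
  qed
  define c where "c = m powr s * (N * l) powr (- (?d * s))"
  have c0: "0 \<le> c" by (simp add: c_def)
  have pw: "f x powr s \<le> c * ((1 - ?d * s) * (1 - s * q x / 2 + s\<^sup>2 * (q x)\<^sup>2 / 8) + s * l * (\<Sum>b\<in>Basis. S b x))"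
    if fx: "f x > 0" for x
  proof -
    have Spos: "S b x > 0" if "b \<in> Basis" for b
    proof (rule ccontr)
      assume "\<not> S b x > 0"
      with TS(5)[OF that, of x] have "S b x = 0" by linarith
      then have "(\<Prod>b\<in>Basis. exp (-(T b x)\<^sup>2 / 2) / N * S b x) = 0"
        using that by (intro prod_zero) auto
      from fprod[OF fx, unfolded this] fx show False by simp
    qed
    have "f x powr s = m powr s * (\<Prod>b\<in>Basis. (exp (-(T b x)\<^sup>2 / 2) / N * S b x) powr s)"
      using arg_cong[OF fprod[OF fx], of "\<lambda>y. y powr s"] by (simp only: powr_mult prod_powr_distrib)
    also have "(\<Prod>b\<in>Basis. (exp (-(T b x)\<^sup>2 / 2) / N * S b x) powr s) =
      (\<Prod>b\<in>Basis. exp (- s * (T b x)\<^sup>2 / 2) * (N * l) powr (- s) * (l * S b x) powr s)"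
    proof (rule prod.cong[OF refl])
      fix b :: 'a assume b: "b \<in> Basis"
      have "exp (-(T b x)\<^sup>2 / 2) / N * S b x = exp (-(T b x)\<^sup>2 / 2) * (inverse (N * l) * (l * S b x))"
        using N0 l by (simp add: field_simps)
      then show "(exp (-(T b x)\<^sup>2 / 2) / N * S b x) powr s =
        exp (- s * (T b x)\<^sup>2 / 2) * (N * l) powr (- s) * (l * S b x) powr s"
        using N0 l Spos[OF b]
        by (simp add: powr_mult exp_powr_real powr_minus inverse_powr mult_ac del: inverse_mult_distrib)
    qed
    also have "\<dots> = exp (- (s * q x / 2)) * (N * l) powr (- (?d * s)) * (\<Prod>b\<in>Basis. (l * S b x) powr s)"
    proof -
      have "(\<Prod>b\<in>(Basis::'a set). (N * l) powr (- s)) = (N * l) powr (- (?d * s))"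
        using N0 l by (simp add: powr_power mult.commute)
      moreover have "(\<Prod>b\<in>Basis. exp (- s * (T b x)\<^sup>2 / 2)) = exp (- (s * q x / 2))"
        by (simp add: exp_sum[symmetric] q_def sum_distrib_left sum_negf sum_divide_distrib)
      ultimately show ?thesis by (simp add: prod.distrib)
    qed
    also have "m powr s * \<dots> = c * (exp (- (s * q x / 2)) * (\<Prod>b\<in>Basis. (l * S b x) powr s))"
      by (simp add: c_def mult_ac)
    also have "\<dots> \<le> c * ((1 - ?d * s) * (1 - s * q x / 2 + s\<^sup>2 * (q x)\<^sup>2 / 8) + s * l * (\<Sum>b\<in>Basis. S b x))"
    proof (rule mult_left_mono[OF _ c0])
      have sq: "0 \<le> s * q x / 2" using s q0 by simp
      have "(\<Prod>b\<in>Basis. (l * S b x) powr s) \<le> 1 - ?d * s + s * (\<Sum>b\<in>Basis. l * S b x)"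
        by (rule prod_powr_le_weighted_mean) (use s l Spos in auto)
      then have "exp (- (s * q x / 2)) * (\<Prod>b\<in>Basis. (l * S b x) powr s) \<le>
        exp (- (s * q x / 2)) * (1 - ?d * s + s * (\<Sum>b\<in>Basis. l * S b x))"
        by (rule mult_left_mono) simp
      also have "\<dots> = exp (- (s * q x / 2)) * (1 - ?d * s) +
        exp (- (s * q x / 2)) * (s * (\<Sum>b\<in>Basis. l * S b x))"
        by (simp add: distrib_left)
      \<comment> \<open>The exponential is expanded only next to the constant 1 - d s. Next to the
        sum, which already carries a factor s, it is bounded by 1, so that the integrals of f * S_b
        enter linearly.\<close>
      also have "\<dots> \<le> (1 - s * q x / 2 + (s * q x / 2)\<^sup>2 / 2) * (1 - ?d * s) +
        1 * (s * (\<Sum>b\<in>Basis. l * S b x))"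
        using exp_minus_le_quadratic[OF sq] s l TS(5) sq
        by (intro add_mono mult_right_mono mult_nonneg_nonneg sum_nonneg) auto
      finally show "exp (- (s * q x / 2)) * (\<Prod>b\<in>Basis. (l * S b x) powr s) \<le>
        (1 - ?d * s) * (1 - s * q x / 2 + s\<^sup>2 * (q x)\<^sup>2 / 8) + s * l * (\<Sum>b\<in>Basis. S b x)"
        by (simp add: sum_distrib_left[symmetric] power_mult_distrib power_divide mult_ac)
    qed
    finally show ?thesis .
  qed
  have w_f: "norm (w x) powr (2 + 2 * s) = f x * f x powr s" for x
  proof (cases "w x = 0")
    case False
    then have "norm (w x) powr 2 = f x" by (simp add: f_def)
    then show ?thesis by (metis powr_add powr_powr)
  qed (simp add: f_def)
  have fS: "integrable lborel (\<lambda>x. f x * S b x)"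
    and lS: "l * (LINT x|lborel. f x * S b x) \<le> 2 * l\<^sup>2 * A b + (LINT x|lborel. f x * (T b x)\<^sup>2) / 2"
    if b: "b \<in> Basis" for b
  proof -
    have *: "w \<in> borel_measurable borel" by measurable
    have **: "\<And>x. w x \<noteq> 0 \<Longrightarrow> ((\<lambda>t. T b (x + t *\<^sub>R b)) has_real_derivative S b x) (at 0)"
      using TS(6)[OF b] f0 by blast
    note tdb = transport_derivative_bound[of w "T b" K b "S b" "A b" l,
       OF * wi TS(1)[OF b] TS(3)[OF b] TS(4)[OF b] TS(2)[OF b] TS(5)[OF b] ** A[OF b] l]
    show "integrable lborel (\<lambda>x. f x * S b x)"
      and "l * (LINT x|lborel. f x * S b x) \<le> 2 * l\<^sup>2 * A b + (LINT x|lborel. f x * (T b x)\<^sup>2) / 2"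
      using tdb by (simp_all add: f_def)
  qed
  have fq: "integrable lborel (\<lambda>x. f x * q x)"
    by (rule integrable_bounded_mult[OF fi, of _ "?d * K\<^sup>2"]) (use q0 qK in auto)
  have q2K: "(q x)\<^sup>2 \<le> (?d * K\<^sup>2)\<^sup>2" for x using q0 qK by (intro power_mono) auto
  have fq2: "integrable lborel (\<lambda>x. f x * (q x)\<^sup>2)"
    by (rule integrable_bounded_mult[OF fi, of _ "(?d * K\<^sup>2)\<^sup>2"]) (use q2K in auto)
  have fT2: "integrable lborel (\<lambda>x. f x * (T b x)\<^sup>2)" if "b \<in> Basis" for b
    by (rule integrable_bounded_mult[OF fi, of _ "K\<^sup>2"]) (use T2 TS(1) that in auto)
  define P where "P x = c * ((1 - ?d * s) * (f x - s / 2 * (f x * q x) + s\<^sup>2 / 8 * (f x * (q x)\<^sup>2)) +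
     s * l * (\<Sum>b\<in>Basis. f x * S b x))" for x
  have Pint: "integrable lborel P"
    unfolding P_def using fi fq fq2 fS by (intro integrable_mult_right integrable_add integrable_diff integrable_sum) auto
  have wP: "norm (w x) powr (2 + 2 * s) \<le> P x" for x
  proof (cases "f x = 0")
    case True
    then show ?thesis by (simp add: w_f P_def)
  next
    case False
    then have fx: "f x > 0" using fnn[of x] by simp
    show ?thesis unfolding w_f P_def
      using mult_left_mono[OF pw[OF fx] less_imp_le[OF fx]]
      by (simp add: algebra_simps sum_distrib_left)
  qed
  show int: "integrable lborel (\<lambda>x. norm (w x) powr (2 + 2 * s))"
    by (rule Bochner_Integration.integrable_bound[OF Pint])
       (use wP in \<open>auto intro: order_trans[OF _ abs_ge_self]\<close>)
  define Q where "Q = (LINT x|lborel. f x * q x)"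
  define Q2 where "Q2 = (LINT x|lborel. f x * (q x)\<^sup>2)"
  have QK: "Q \<le> ?d * K\<^sup>2 * m"
  proof -
    have "Q \<le> (LINT x|lborel. ?d * K\<^sup>2 * f x)"
      unfolding Q_def using fq fi qK fnn
      by (intro integral_mono) (auto simp: mult.commute[of "f _"] intro!: mult_right_mono)
    then show ?thesis by (simp add: m_f)
  qed
  have Q2K: "Q2 \<le> (?d * K\<^sup>2)\<^sup>2 * m"
  proof -
    have "Q2 \<le> (LINT x|lborel. (?d * K\<^sup>2)\<^sup>2 * f x)"
      unfolding Q2_def using fq2 fi q2K fnn
      by (intro integral_mono) (auto simp: mult.commute[of "f _"] intro!: mult_right_mono)
    then show ?thesis by (simp add: m_f)
  qed
  have Q_sum: "Q = (\<Sum>b\<in>Basis. LINT x|lborel. f x * (T b x)\<^sup>2)"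
    unfolding Q_def q_def sum_distrib_left using fT2 by (subst Bochner_Integration.integral_sum) auto
  have "(LINT x|lborel. norm (w x) powr (2 + 2 * s)) \<le> (LINT x|lborel. P x)"
    by (rule integral_mono[OF int Pint wP])
  also have "\<dots> = c * ((1 - ?d * s) * (m - s / 2 * Q + s\<^sup>2 / 8 * Q2) +
      s * (\<Sum>b\<in>Basis. l * (LINT x|lborel. f x * S b x)))"
    unfolding P_def using fi fq fq2 fS
    by (simp add: m_f Q_def Q2_def Bochner_Integration.integral_sum sum_distrib_left mult.assoc)
  also have "\<dots> \<le> c * ((1 - ?d * s) * (m - s / 2 * Q + s\<^sup>2 / 8 * Q2) +
      s * (\<Sum>b\<in>Basis. 2 * l\<^sup>2 * A b + (LINT x|lborel. f x * (T b x)\<^sup>2) / 2))"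
    by (intro mult_left_mono[OF _ c0] add_left_mono mult_left_mono[OF _ s(1)] sum_mono lS)
  \<comment> \<open>The contribution - s Q / 2 of the exponential cancels against s Q / 2 from the
    derivative bounds. What survives of \<open>Q\<close> is its product with d s, of second
    order.\<close>
  also have "\<dots> = c * ((1 - ?d * s) * m + (1 - ?d * s) * (s\<^sup>2 / 8 * Q2) + ?d * s\<^sup>2 / 2 * Q
      + 2 * s * l\<^sup>2 * (\<Sum>b\<in>Basis. A b))"
  proof -
    have "(\<Sum>b\<in>Basis. 2 * l\<^sup>2 * A b + (LINT x|lborel. f x * (T b x)\<^sup>2) / 2) =
      2 * l\<^sup>2 * (\<Sum>b\<in>Basis. A b) + Q / 2"
      unfolding Q_sum by (simp add: sum.distrib sum_distrib_left sum_divide_distrib)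
    from this show ?thesis by (simp only:) (simp add: field_simps power2_eq_square)
  qed
  also have "\<dots> \<le> c * ((1 - ?d * s) * m + 1 * (s\<^sup>2 / 8 * ((?d * K\<^sup>2)\<^sup>2 * m)) + ?d * s\<^sup>2 / 2 * (?d * K\<^sup>2 * m)
      + 2 * s * l\<^sup>2 * (\<Sum>b\<in>Basis. A b))"
  proof (intro mult_left_mono[OF _ c0] add_mono order_refl)
    have "0 \<le> Q2" unfolding Q2_def using fnn by simp
    then show "(1 - ?d * s) * (s\<^sup>2 / 8 * Q2) \<le> 1 * (s\<^sup>2 / 8 * ((?d * K\<^sup>2)\<^sup>2 * m))"
      using s by (intro mult_mono mult_left_mono[OF Q2K]) auto
    show "?d * s\<^sup>2 / 2 * Q \<le> ?d * s\<^sup>2 / 2 * (?d * K\<^sup>2 * m)"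
      using s by (intro mult_left_mono[OF QK]) auto
  qed
  also have "\<dots> = c * (m * (1 - ?d * s + s\<^sup>2 * D) + 2 * s * l\<^sup>2 * (\<Sum>b\<in>Basis. A b))"
    by (simp add: D_def algebra_simps power2_eq_square)
  finally show "(LINT x|lborel. norm (w x) powr (2 + 2 * s)) \<le>
       m powr s * (N * l) powr (- (?d * s)) *
       (m * (1 - ?d * s + s\<^sup>2 * D) + 2 * s * l\<^sup>2 * (\<Sum>b\<in>Basis. A b))"
    by (simp add: c_def)
qed

section \<open>Test functions\<close>

text \<open>A class that contains all directional derivatives of its members, so that
  \<open>C_k\<close> follows for every k at once; products would be awkward in a direct induction on
  \<open>C_k\<close>. In the ridge rule \<open>D\<close> is a sequence in which each function is the
  derivative of its predecessor, evaluated on an affine functional.\<close>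

inductive smooth_fn :: "('a::euclidean_space \<Rightarrow> real) \<Rightarrow> bool" where
  smooth_fn_ridge: "(\<And>n t. (D n has_real_derivative D (Suc n) t) (at t)) \<Longrightarrow>
    smooth_fn (\<lambda>x. D (k::nat) (x \<bullet> v + c))"
| smooth_fn_const: "smooth_fn (\<lambda>x. c)"
| smooth_fn_add: "smooth_fn f \<Longrightarrow> smooth_fn g \<Longrightarrow> smooth_fn (\<lambda>x. f x + g x)"
| smooth_fn_mult: "smooth_fn f \<Longrightarrow> smooth_fn g \<Longrightarrow> smooth_fn (\<lambda>x. f x * g x)"

lemma smooth_fn_derivative:
  assumes "smooth_fn f"
  shows "\<exists>f'. (\<forall>x. (f has_derivative f' x) (at x)) \<and> (\<forall>v. smooth_fn (\<lambda>x. f' x v))"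
  using assms
proof (induction rule: smooth_fn.induct)
  case (smooth_fn_ridge D k v c)
  have "((\<lambda>x. D k (x \<bullet> v + c)) has_derivative (\<lambda>h. D (Suc k) (x \<bullet> v + c) * (h \<bullet> v))) (at x)" for x
  proof -
    have "(D k has_derivative (\<lambda>h. D (Suc k) (x \<bullet> v + c) * h)) (at (x \<bullet> v + c))"
      using smooth_fn_ridge[of k "x \<bullet> v + c"] by (simp add: has_field_derivative_def)
    moreover have "((\<lambda>x. x \<bullet> v + c) has_derivative (\<lambda>h. h \<bullet> v)) (at x)"
      by (auto intro!: derivative_eq_intros)
    ultimately show ?thesis
      using has_derivative_compose[where f = "\<lambda>x. x \<bullet> v + c" and g = "D k" and x = x and s = UNIV]
      by blast
  qed
  moreover have "smooth_fn (\<lambda>x. D (Suc k) (x \<bullet> v + c) * (h \<bullet> v))" for h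
    by (intro smooth_fn.intros smooth_fn_ridge)
  ultimately show ?case
    by (intro exI[of _ "\<lambda>x h. D (Suc k) (x \<bullet> v + c) * (h \<bullet> v)"]) simp
next
  case (smooth_fn_const c)
  have "((\<lambda>x. c) has_derivative (\<lambda>h. 0)) (at x)" for x :: 'a by simp
  moreover have "smooth_fn (\<lambda>x::'a. 0)" by (rule smooth_fn.intros)
  ultimately show ?case
    by (intro exI[of _ "\<lambda>x h. 0"]) simp
next
  case (smooth_fn_add f g)
  then obtain f' g' where *: "\<And>x. (f has_derivative f' x) (at x)" "\<And>v. smooth_fn (\<lambda>x. f' x v)"
    "\<And>x. (g has_derivative g' x) (at x)" "\<And>v. smooth_fn (\<lambda>x. g' x v)" by blast
  have "((\<lambda>x. f x + g x) has_derivative (\<lambda>h. f' x h + g' x h)) (at x)" for x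
    by (rule has_derivative_add[OF *(1,3)])
  moreover have "smooth_fn (\<lambda>x. f' x h + g' x h)" for h
    by (intro smooth_fn.intros *)
  ultimately show ?case
    by (intro exI[of _ "\<lambda>x h. f' x h + g' x h"]) simp
next
  case (smooth_fn_mult f g)
  then obtain f' g' where *: "\<And>x. (f has_derivative f' x) (at x)" "\<And>v. smooth_fn (\<lambda>x. f' x v)"
    "\<And>x. (g has_derivative g' x) (at x)" "\<And>v. smooth_fn (\<lambda>x. g' x v)" by blast
  have "((\<lambda>x. f x * g x) has_derivative (\<lambda>h. f x * g' x h + f' x h * g x)) (at x)" for x
    by (rule has_derivative_mult[OF *(1,3)])
  moreover have "smooth_fn (\<lambda>x. f x * g' x h + f' x h * g x)" for h
    by (intro smooth_fn.intros * smooth_fn_mult.hyps)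
  ultimately show ?case
    by (intro exI[of _ "\<lambda>x h. f x * g' x h + f' x h * g x"]) simp
qed

lemma smooth_fn_frechet:
  assumes "smooth_fn f"
  shows "f differentiable (at x)" "smooth_fn (\<lambda>x. frechet_derivative f (at x) v)"
proof -
  obtain f' where f': "\<And>x. (f has_derivative f' x) (at x)" "\<And>v. smooth_fn (\<lambda>x. f' x v)"
    using smooth_fn_derivative[OF assms] by blast
  then show "f differentiable (at x)" unfolding differentiable_def by blast
  have "frechet_derivative f (at x) = f' x" for x
    using frechet_derivative_at[OF f'(1)] by simp
  then show "smooth_fn (\<lambda>x. frechet_derivative f (at x) v)" using f'(2) by simp
qed

lemma smooth_fn_continuous: "smooth_fn f \<Longrightarrow> continuous_on A f"
  by (rule continuous_at_imp_continuous_on)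
     (blast intro: differentiable_imp_continuous_within smooth_fn_frechet(1))

lemma smooth_fn_C_k: "smooth_fn f \<Longrightarrow> C_k k f"
  by (induction k arbitrary: f) (auto simp: smooth_fn_continuous smooth_fn_frechet)

lemma smooth_fn_prod: "finite I \<Longrightarrow> (\<And>i. i \<in> I \<Longrightarrow> smooth_fn (f i)) \<Longrightarrow> smooth_fn (\<lambda>x. \<Prod>i\<in>I. f i x)"
  by (induction I rule: finite_induct) (simp_all add: smooth_fn_const smooth_fn_mult)

lemma smooth_fn_test_function:
  assumes "smooth_fn f" "bounded {x. f x \<noteq> 0}"
  shows "test_function f"
  unfolding test_function_def using assms by (auto simp: smooth_fn_C_k compact_closure)

text \<open>Recovers a derivative sequence from a member of the class on the line. This is the form
  required by the ridge rule, and it allows a one-dimensional bump to be used as a function of a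
  single coordinate.\<close>

lemma smooth_fn_real_family:
  fixes g :: "real \<Rightarrow> real"
  assumes "smooth_fn g"
  obtains D :: "nat \<Rightarrow> real \<Rightarrow> real"
  where "D 0 = g" "\<And>n t. (D n has_real_derivative D (Suc n) t) (at t)"
proof -
  have "\<exists>D. \<forall>n. (smooth_fn (D n) \<and> (n = 0 \<longrightarrow> D n = g)) \<and>
      (\<forall>t. (D n has_real_derivative D (Suc n) t) (at t))"
  proof (rule dependent_nat_choice)
    fix f :: "real \<Rightarrow> real" and n :: nat
    assume f: "smooth_fn f \<and> (n = 0 \<longrightarrow> f = g)"
    then obtain f' where f': "\<And>x. (f has_derivative f' x) (at x)" "\<And>v. smooth_fn (\<lambda>x. f' x v)"
      using smooth_fn_derivative by blast
    have "(f has_real_derivative f' t 1) (at t)" for t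
    proof -
      have "f' t = (\<lambda>h. f' t 1 * h)"
      proof
        fix h show "f' t h = f' t 1 * h"
          using linear_cmul[OF has_derivative_linear[OF f'(1)[of t]], of h 1] by (simp add: mult.commute)
      qed
      then show ?thesis using f'(1)[of t] unfolding has_field_derivative_def by metis
    qed
    then show "\<exists>f'. (smooth_fn f' \<and> (Suc n = 0 \<longrightarrow> f' = g)) \<and>
        (\<forall>t. (f has_real_derivative f' t) (at t))"
      using f'(2)[of 1] by auto
  qed (use assms in auto)
  then obtain D where D: "\<forall>n. (smooth_fn (D n) \<and> (n = 0 \<longrightarrow> D n = g)) \<and>
      (\<forall>t. (D n has_real_derivative D (Suc n) t) (at t))" ..
  show thesis
  proof (rule that)
    show "D 0 = g" using D by simp
    show "(D n has_real_derivative D (Suc n) t) (at t)" for n t using D by blast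
  qed
qed

text \<open>The flat function exp (-1/t) with a polynomial factor in 1/t. The factor makes the
  family stable under differentiation, which maps the polynomial p (y) to y^2 (p (y) - p'
  (y)).\<close>

definition exp_germ :: "real poly \<Rightarrow> real \<Rightarrow> real" where
  "exp_germ p t = (if t > 0 then poly p (1 / t) * exp (- (1 / t)) else 0)"

lemma exp_germ_tendsto_0: "((\<lambda>t. exp_germ p t) \<longlongrightarrow> 0) (at 0)"
proof -
  have "((\<lambda>y::real. poly p y * exp (- y)) \<longlongrightarrow> 0) at_top"
  proof -
    have "((\<lambda>y::real. \<Sum>i\<le>degree p. coeff p i * (y ^ i / exp y)) \<longlongrightarrow> (\<Sum>i\<le>degree p. coeff p i * 0)) at_top"
      by (intro tendsto_sum tendsto_mult_left tendsto_power_div_exp_0)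
    then show ?thesis by (simp add: poly_altdef exp_minus sum_distrib_right divide_inverse mult.assoc)
  qed
  then have "((\<lambda>t. poly p (1 / t) * exp (- (1 / t))) \<longlongrightarrow> 0) (at_right (0::real))"
    by (rule filterlim_compose) (simp add: filterlim_inverse_at_top_right flip: inverse_eq_divide)
  then have "((\<lambda>t. exp_germ p t) \<longlongrightarrow> 0) (at_right 0)"
    by (rule Lim_transform_eventually) (auto simp: exp_germ_def eventually_at_right_less intro!: eventually_at_rightI[of 0 1])
  moreover have "((\<lambda>t. exp_germ p t) \<longlongrightarrow> 0) (at_left 0)"
    by (rule tendsto_eventually) (auto simp: exp_germ_def intro!: eventually_at_leftI[of "-1"])
  ultimately show ?thesis by (simp add: filterlim_split_at)
qed

lemma exp_germ_DERIV:
  "(exp_germ p has_real_derivative exp_germ (pCons 0 (pCons 0 (p - pderiv p))) t) (at t)"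
proof -
  consider "t > 0" | "t < 0" | "t = 0" by linarith
  then show ?thesis
  proof cases
    case 1
    have "((\<lambda>t. poly p (1 / t) * exp (- (1 / t))) has_real_derivative
       exp_germ (pCons 0 (pCons 0 (p - pderiv p))) t) (at t)"
      using 1 by (auto intro!: derivative_eq_intros poly_DERIV[THEN DERIV_chain2]
          simp: exp_germ_def power2_eq_square field_simps)
    then show ?thesis
      by (rule has_field_derivative_transform_within_open[where S = "{0<..}"])
         (use 1 in \<open>auto simp: exp_germ_def\<close>)
  next
    case 2
    have "((\<lambda>t. 0) has_real_derivative exp_germ (pCons 0 (pCons 0 (p - pderiv p))) t) (at t)"
      using 2 by (simp add: exp_germ_def)
    then show ?thesis
      by (rule has_field_derivative_transform_within_open[where S = "{..<0}"])
         (use 2 in \<open>auto simp: exp_germ_def\<close>)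
  next
    case 3
    \<comment> \<open>Dividing by h multiplies the polynomial in 1/h by its variable, so the
      difference quotient at 0 is again a member of the family and tends to 0.\<close>
    have "((\<lambda>h. (exp_germ p (0 + h) - exp_germ p 0) / h) \<longlongrightarrow> 0) (at 0)"
      using exp_germ_tendsto_0[of "pCons 0 p"]
      by (rule Lim_transform_eventually)
         (auto simp: exp_germ_def eventually_at intro!: exI[of _ 1])
    then show ?thesis using 3 by (simp add: DERIV_def exp_germ_def)
  qed
qed

lemma smooth_fn_exp_germ:
  "smooth_fn (\<lambda>x::'a::euclidean_space. exp_germ p (x \<bullet> v + c))"
proof -
  define D where "D n = exp_germ (((\<lambda>p. pCons 0 (pCons 0 (p - pderiv p))) ^^ n) p)" for n
  have "(D n has_real_derivative D (Suc n) t) (at t)" for n t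
    unfolding D_def using exp_germ_DERIV by simp
  then have "smooth_fn (\<lambda>x::'a. D 0 (x \<bullet> v + c))" by (rule smooth_fn_ridge)
  then show ?thesis by (simp add: D_def)
qed

section \<open>Steklov averages and weak gradients\<close>

lemma nn_integral_lborel_reflect:
  fixes f :: "'a::euclidean_space \<Rightarrow> ennreal"
  assumes [measurable]: "f \<in> borel_measurable borel"
  shows "(\<integral>\<^sup>+ x. f (c - x) \<partial>lborel) = (\<integral>\<^sup>+ x. f x \<partial>lborel)"
proof -
  have "(\<integral>\<^sup>+ x. f x \<partial>lborel) =
    (\<integral>\<^sup>+ x. f x \<partial>density (distr lborel borel (\<lambda>x. c + (-1) *\<^sub>R x)) (\<lambda>_. ennreal (\<bar>-1\<bar> ^ DIM('a))))"
    by (subst lborel_affine[of "-1" c]) simp_all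
  also have "\<dots> = (\<integral>\<^sup>+ x. f (c - x) \<partial>lborel)"
    by (subst nn_integral_density) (simp_all add: nn_integral_distr)
  finally show ?thesis ..
qed

text \<open>Young's inequality for an L^1 kernel acting on L^2: Cauchy-Schwarz for the measure with
  density k (y - x), then Tonelli. Extended nonnegative integrals make it valid without finiteness
  conditions.\<close>

lemma young_L1_L2:
  fixes k g :: "'a::euclidean_space \<Rightarrow> ennreal"
  assumes [measurable]: "k \<in> borel_measurable borel" "g \<in> borel_measurable borel"
  shows "(\<integral>\<^sup>+ x. (\<integral>\<^sup>+ y. k (y - x) * g y \<partial>lborel)\<^sup>2 \<partial>lborel) \<le>
    (\<integral>\<^sup>+ x. k x \<partial>lborel)\<^sup>2 * (\<integral>\<^sup>+ x. (g x)\<^sup>2 \<partial>lborel)"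
proof -
  let ?k = "\<integral>\<^sup>+ x. k x \<partial>lborel"
  have "(\<integral>\<^sup>+ y. k (y - x) * g y \<partial>lborel)\<^sup>2 \<le> ?k * (\<integral>\<^sup>+ y. k (y - x) * (g y)\<^sup>2 \<partial>lborel)" for x
  proof -
    let ?M = "density lborel (\<lambda>y. k (y - x))"
    have "(\<integral>\<^sup>+ y. g y * 1 \<partial>?M)\<^sup>2 \<le> (\<integral>\<^sup>+ y. (g y)\<^sup>2 \<partial>?M) * (\<integral>\<^sup>+ y. 1\<^sup>2 \<partial>?M)"
      by (rule Cauchy_Schwarz_nn_integral) auto
    moreover have "(\<integral>\<^sup>+ y. 1\<^sup>2 \<partial>?M) = ?k"
      using nn_integral_lborel_shift[of k "- x"] by (subst nn_integral_density) simp_all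
    ultimately show ?thesis
      by (simp add: nn_integral_density mult.commute)
  qed
  then have "(\<integral>\<^sup>+ x. (\<integral>\<^sup>+ y. k (y - x) * g y \<partial>lborel)\<^sup>2 \<partial>lborel) \<le>
    (\<integral>\<^sup>+ x. ?k * (\<integral>\<^sup>+ y. k (y - x) * (g y)\<^sup>2 \<partial>lborel) \<partial>lborel)"
    by (intro nn_integral_mono)
  also have "\<dots> = ?k * (\<integral>\<^sup>+ x. (\<integral>\<^sup>+ y. k (y - x) * (g y)\<^sup>2 \<partial>lborel) \<partial>lborel)"
    by (rule nn_integral_cmult) measurable
  also have "(\<integral>\<^sup>+ x. (\<integral>\<^sup>+ y. k (y - x) * (g y)\<^sup>2 \<partial>lborel) \<partial>lborel) =
    (\<integral>\<^sup>+ y. (\<integral>\<^sup>+ x. k (y - x) * (g y)\<^sup>2 \<partial>lborel) \<partial>lborel)"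
    by (rule lborel_pair.Fubini') simp
  also have "\<dots> = (\<integral>\<^sup>+ y. ?k * (g y)\<^sup>2 \<partial>lborel)"
    using nn_integral_lborel_reflect[of k] by (simp add: nn_integral_multc)
  also have "\<dots> = ?k * (\<integral>\<^sup>+ y. (g y)\<^sup>2 \<partial>lborel)"
    by (rule nn_integral_cmult) simp
  finally show ?thesis by (simp add: power2_eq_square mult.assoc)
qed

section \<open>Test functions swept along a coordinate direction\<close>

lemma continuous_antiderivative:
  fixes f :: "real \<Rightarrow> real"
  assumes "continuous_on UNIV f"
  obtains F where "\<And>t. (F has_real_derivative f t) (at t)"
proof
  fix t :: real
  let ?a = "- \<bar>t\<bar> - 1" and ?b = "\<bar>t\<bar> + 1"
  have "((\<lambda>u. LBINT y=0..u. f y) has_vector_derivative f t) (at t within {?a..?b})"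
    using interval_integral_FTC2[of ?a 0 ?b f t] continuous_on_subset[OF assms]
    by (auto simp: zero_ereal_def)
  moreover have "t \<in> interior {?a..?b}" by auto
  ultimately show "((\<lambda>u. LBINT y=0..u. f y) has_real_derivative f t) (at t)"
    unfolding has_real_derivative_iff_has_vector_derivative by (simp only: at_within_interior)
qed

lemma differentiable_directional_derivative:
  fixes f :: "'a::euclidean_space \<Rightarrow> real"
  assumes "f differentiable (at y)"
  shows "((\<lambda>r. f (y + r *\<^sub>R v)) has_real_derivative frechet_derivative f (at y) v) (at 0)"
proof -
  have 1: "(f has_derivative frechet_derivative f (at y)) (at (y + 0 *\<^sub>R v))"
    using assms frechet_derivative_works by auto
  have 2: "((\<lambda>r::real. y + r *\<^sub>R v) has_derivative (\<lambda>r. r *\<^sub>R v)) (at 0)"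
    by (auto intro!: derivative_eq_intros)
  have "((\<lambda>r. f (y + r *\<^sub>R v)) has_derivative (\<lambda>r. frechet_derivative f (at y) (r *\<^sub>R v))) (at 0)"
    using has_derivative_compose[OF 2 1] by simp
  moreover have "frechet_derivative f (at y) (r *\<^sub>R v) = frechet_derivative f (at y) v * r" for r
    using linear_cmul[OF has_derivative_linear[OF 1]] by (simp add: mult.commute)
  ultimately show ?thesis by (simp add: has_field_derivative_def)
qed

lemma frechet_derivative_directional:
  fixes f :: "'a::euclidean_space \<Rightarrow> real"
  assumes "f differentiable (at y)" "((\<lambda>r. f (y + r *\<^sub>R v)) has_real_derivative c) (at 0)"
  shows "frechet_derivative f (at y) v = c"
  using differentiable_directional_derivative[OF assms(1)] assms(2) by (rule DERIV_unique)

text \<open>The convolution of the indicator of the cube [0, e]^d with the length measure on the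
  segment from 0 to \<open>h *\<^sub>R j\<close>. It is the kernel that relates increments of cube
  averages to the weak derivative. The cube is closed so that the kernel dominates all smooth
  approximations supported in it.\<close>

definition cube_sweep :: "real \<Rightarrow> real \<Rightarrow> 'a::euclidean_space \<Rightarrow> 'a \<Rightarrow> ennreal" where
  "cube_sweep e h j z =
     (\<integral>\<^sup>+ r. indicator {0..h} r * indicator (cbox 0 (e *\<^sub>R One)) (z - r *\<^sub>R j) \<partial>lborel)"

lemma cube_sweep_measurable [measurable]: "cube_sweep e h j \<in> borel_measurable borel"
  unfolding cube_sweep_def by measurable

lemma nn_integral_cube_sweep:
  fixes j :: "'a::euclidean_space"
  assumes "e > 0" "h > 0"
  shows "(\<integral>\<^sup>+ z. cube_sweep e h j z \<partial>lborel) = ennreal (h * e ^ DIM('a))"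
proof -
  let ?Q = "cbox 0 (e *\<^sub>R One) :: 'a set"
  have Q: "emeasure lborel ?Q = ennreal (e ^ DIM('a))"
    using assms by (subst emeasure_lborel_cbox) (auto simp: inner_simps)
  have sh: "(\<integral>\<^sup>+ z. indicator ?Q (z - v) \<partial>lborel) = emeasure lborel ?Q" for v
    using nn_integral_lborel_shift[of "indicator ?Q" "- v"] by simp
  have "(\<integral>\<^sup>+ z. cube_sweep e h j z \<partial>lborel) =
    (\<integral>\<^sup>+ r. (\<integral>\<^sup>+ z. indicator {0..h} r * indicator ?Q (z - r *\<^sub>R j) \<partial>lborel) \<partial>lborel)"
    unfolding cube_sweep_def by (rule lborel_pair.Fubini') simp
  also have "\<dots> = (\<integral>\<^sup>+ r. indicator {0..h} r * emeasure lborel ?Q \<partial>lborel)"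
    by (simp add: nn_integral_cmult sh)
  also have "\<dots> = ennreal h * ennreal (e ^ DIM('a))"
    using assms by (subst nn_integral_multc) (simp_all add: Q)
  finally show ?thesis using assms by (simp add: ennreal_mult)
qed

text \<open>
  The test function is the average of the translates of a product bump in the direction \<open>j\<close>, so that
  its derivative in that direction is an exact difference of translates.
\<close>

lemma swept_bump_test_function:
  fixes j :: "'a::euclidean_space" and \<theta> :: "real \<Rightarrow> real"
  assumes \<theta>: "smooth_fn \<theta>" "\<And>t. 0 \<le> \<theta> t" "\<And>t. \<theta> t \<le> 1" "\<And>t. \<theta> t \<noteq> 0 \<Longrightarrow> 0 \<le> t \<and> t \<le> e"
    and j: "j \<in> Basis" and h: "h > 0"
  defines "\<psi> \<equiv> \<lambda>y::'a. \<Prod>b\<in>Basis. \<theta> (y \<bullet> b)"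
  obtains \<phi> where "test_function \<phi>"
    "\<And>y. frechet_derivative \<phi> (at y) j = \<psi> (y - x) - \<psi> (y - x - h *\<^sub>R j)"
    "\<And>y. 0 \<le> \<phi> y" "\<And>y. ennreal (\<phi> y) \<le> cube_sweep e h j (y - x)" "continuous_on UNIV \<phi>"
proof -
  obtain D where D: "D 0 = \<theta>" "\<And>n t. (D n has_real_derivative D (Suc n) t) (at t)"
    using smooth_fn_real_family[OF \<theta>(1)] by blast
  obtain P where P: "\<And>t. (P has_real_derivative \<theta> t) (at t)"
    using continuous_antiderivative[OF smooth_fn_continuous[OF \<theta>(1)]] by blast
  have D0: "(\<theta> has_real_derivative D 1 t) (at t)" for t using D(2)[of 0 t] D(1) by simp
  have c\<theta>: "continuous_on A \<theta>" for A by (rule smooth_fn_continuous[OF \<theta>(1)])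
  have [measurable]: "\<theta> \<in> borel_measurable borel" using c\<theta> by (rule borel_measurable_continuous_onI)
  \<comment> \<open>The integral of \<open>\<theta>\<close> over [t - h, t]. The sequence
    \<open>E\<close> lists it together with all its derivatives, the first being \<theta> (t) -
    \<theta> (t - h).\<close>
  define \<Theta> where "\<Theta> t = P t - P (t - h)" for t
  define E where "E n = (case n of 0 \<Rightarrow> \<Theta> | Suc n \<Rightarrow> (\<lambda>t. D n t - D n (t - h)))" for n
  have shift: "((\<lambda>t. f (t - h)) has_real_derivative f') (at t)"
    if "(f has_real_derivative f') (at (t - h))" for f f' t
    using DERIV_shift[of f f' t "- h"] that by simp
  have E: "(E n has_real_derivative E (Suc n) t) (at t)" for n t
  proof (cases n)
    case 0
    show ?thesis unfolding 0 E_def \<Theta>_def using DERIV_diff[OF P shift[OF P]] by (simp add: D(1))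
  next
    case (Suc k)
    show ?thesis unfolding Suc E_def using DERIV_diff[OF D(2) shift[OF D(2)]] by simp
  qed
  define \<phi> where "\<phi> y = E 0 (y \<bullet> j + - (x \<bullet> j)) * (\<Prod>b\<in>Basis - {j}. D 0 (y \<bullet> b + - (x \<bullet> b)))" for y
  have sm: "smooth_fn \<phi>"
    unfolding \<phi>_def
  proof (rule smooth_fn_mult)
    show "smooth_fn (\<lambda>y. E 0 (y \<bullet> j + - (x \<bullet> j)))"
      by (rule smooth_fn_ridge[where D = E, OF E])
    show "smooth_fn (\<lambda>y. \<Prod>b\<in>Basis - {j}. D 0 (y \<bullet> b + - (x \<bullet> b)))"
      by (rule smooth_fn_prod) (simp, rule smooth_fn_ridge[where D = D, OF D(2)])
  qed
  have \<phi>_eq: "\<phi> y = \<Theta> ((y - x) \<bullet> j) * (\<Prod>b\<in>Basis - {j}. \<theta> ((y - x) \<bullet> b))" for y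
    by (simp add: \<phi>_def E_def D(1) inner_diff_left)
  have jj: "j \<bullet> j = 1" using j by (simp add: inner_same_Basis)
  have jb: "j \<bullet> b = 0" if "b \<in> Basis - {j}" for b using that j by (auto simp: inner_not_same_Basis)
  have \<psi>_eq: "\<psi> (z - r *\<^sub>R j) = \<theta> (z \<bullet> j - r) * (\<Prod>b\<in>Basis - {j}. \<theta> (z \<bullet> b))" for z r
  proof -
    have "(\<Prod>b\<in>Basis - {j}. \<theta> ((z - r *\<^sub>R j) \<bullet> b)) = (\<Prod>b\<in>Basis - {j}. \<theta> (z \<bullet> b))"
      by (rule prod.cong) (auto simp: inner_diff_left jb)
    then show ?thesis unfolding \<psi>_def
      by (subst prod.remove[OF finite_Basis j]) (simp add: inner_diff_left jj)
  qed
  define C where "C z = (\<Prod>b\<in>Basis - {j}. \<theta> (z \<bullet> b))" for z :: 'a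
  have C0: "0 \<le> C z" for z unfolding C_def by (intro prod_nonneg ballI \<theta>(2))
  \<comment> \<open>Identifies the test function with the integral of the swept product bump, so
    that a pointwise bound of the bump by the cube's indicator yields the bound by
    \<open>cube_sweep\<close>.\<close>
  have FTC: "(\<integral>\<^sup>+ r. ennreal (\<psi> (z - r *\<^sub>R j)) * indicator {0..h} r \<partial>lborel) = ennreal (\<Theta> (z \<bullet> j) * C z)" for z
  proof -
    have "(\<integral>\<^sup>+ r. ennreal (\<theta> (z \<bullet> j - r) * C z) * indicator {0..h} r \<partial>lborel) =
      ennreal (- P (z \<bullet> j - h) * C z - (- P (z \<bullet> j - 0) * C z))"
    proof (rule nn_integral_FTC_Icc)
      show "((\<lambda>r. - P (z \<bullet> j - r) * C z) has_real_derivative \<theta> (z \<bullet> j - r) * C z) (at r)" for r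
        by (auto intro!: derivative_eq_intros DERIV_chain2[OF P])
    qed (use \<theta>(2) C0 h in auto)
    then show ?thesis by (simp add: \<psi>_eq C_def[symmetric] \<Theta>_def algebra_simps)
  qed
  have \<Theta>0: "0 \<le> \<Theta> t" for t
    unfolding \<Theta>_def using DERIV_nonneg_imp_nondecreasing[of "t - h" t P] P \<theta>(2) h by auto
  have \<Theta>_supp: "0 \<le> t \<and> t \<le> e + h" if "\<Theta> t \<noteq> 0" for t
  proof (rule ccontr)
    assume out: "\<not> (0 \<le> t \<and> t \<le> e + h)"
    have "P (t - h) = P t"
    proof (rule DERIV_isconst_end[where f = P and a = "t - h" and b = t, symmetric])
      fix s assume "t - h < s" "s < t"
      with out \<theta>(4)[of s] h have "\<theta> s = 0" by linarith
      then show "(P has_real_derivative 0) (at s)" using P[of s] by simp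
    qed (use h P in \<open>auto intro!: continuous_at_imp_continuous_on DERIV_isCont\<close>)
    then show False using that by (simp add: \<Theta>_def)
  qed
  have \<psi>_le: "ennreal (\<psi> z) \<le> indicator (cbox 0 (e *\<^sub>R One)) z" for z
  proof (cases "\<psi> z = 0")
    case False
    then have "\<theta> (z \<bullet> b) \<noteq> 0" if "b \<in> Basis" for b
      using that unfolding \<psi>_def by (auto simp: prod_zero_iff)
    then have "z \<in> cbox 0 (e *\<^sub>R One)" using \<theta>(4) by (auto simp: mem_box)
    moreover have "\<psi> z \<le> 1" unfolding \<psi>_def by (intro prod_le_1 conjI \<theta>)
    ultimately show ?thesis by (simp add: ennreal_le_1)
  qed simp
  show thesis
  proof
    have "{y. \<phi> y \<noteq> 0} \<subseteq> cbox x (x + (e + h) *\<^sub>R One)"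
    proof
      fix y assume "y \<in> {y. \<phi> y \<noteq> 0}"
      then have nz: "\<Theta> ((y - x) \<bullet> j) \<noteq> 0" "\<theta> ((y - x) \<bullet> b) \<noteq> 0" if "b \<in> Basis - {j}" for b
        using that by (auto simp: \<phi>_eq prod_zero_iff)
      have nzj: "\<Theta> ((y - x) \<bullet> j) \<noteq> 0" using \<open>y \<in> {y. \<phi> y \<noteq> 0}\<close> by (auto simp: \<phi>_eq)
      show "y \<in> cbox x (x + (e + h) *\<^sub>R One)"
        unfolding mem_box
      proof
        fix b :: 'a assume b: "b \<in> Basis"
        have "0 \<le> (y - x) \<bullet> b \<and> (y - x) \<bullet> b \<le> e + h"
        proof (cases "b = j")
          case True
          then show ?thesis using \<Theta>_supp[OF nzj] by simp
        next
          case False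
          then show ?thesis using \<theta>(4)[OF nz(2), of b] b h by auto
        qed
        then show "x \<bullet> b \<le> y \<bullet> b \<and> y \<bullet> b \<le> (x + (e + h) *\<^sub>R One) \<bullet> b"
          using b by (simp add: inner_diff_left inner_add_left)
      qed
    qed
    then show "test_function \<phi>"
      by (intro smooth_fn_test_function sm bounded_subset[OF bounded_cbox])
    show "frechet_derivative \<phi> (at y) j = \<psi> (y - x) - \<psi> (y - x - h *\<^sub>R j)" for y
    proof (rule frechet_derivative_directional)
      show "\<phi> differentiable (at y)" using sm by (rule smooth_fn_frechet)
      have "((\<lambda>r. \<Theta> ((y - x) \<bullet> j + r)) has_real_derivative \<theta> ((y - x) \<bullet> j) - \<theta> ((y - x) \<bullet> j - h)) (at 0)"
        using E[of 0 "(y - x) \<bullet> j"] DERIV_shift[of \<Theta> _ 0 "(y - x) \<bullet> j"]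
        by (simp add: E_def D(1) add.commute)
      then have "((\<lambda>r. \<Theta> ((y - x) \<bullet> j + r) * C (y - x)) has_real_derivative
        (\<theta> ((y - x) \<bullet> j) - \<theta> ((y - x) \<bullet> j - h)) * C (y - x)) (at 0)"
        by (rule DERIV_cmult_right)
      moreover have "\<phi> (y + r *\<^sub>R j) = \<Theta> ((y - x) \<bullet> j + r) * C (y - x)" for r
      proof -
        have "(\<Prod>b\<in>Basis - {j}. \<theta> ((y + r *\<^sub>R j - x) \<bullet> b)) = C (y - x)"
          unfolding C_def by (rule prod.cong) (auto simp: inner_diff_left inner_add_left jb)
        then show ?thesis by (simp add: \<phi>_eq inner_diff_left inner_add_left jj algebra_simps)
      qed
      moreover have "\<psi> (y - x) = \<theta> ((y - x) \<bullet> j) * C (y - x)"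
        "\<psi> (y - x - h *\<^sub>R j) = \<theta> ((y - x) \<bullet> j - h) * C (y - x)"
        using \<psi>_eq[of "y - x" 0] \<psi>_eq[of "y - x" h] by (simp_all add: C_def)
      ultimately show "((\<lambda>r. \<phi> (y + r *\<^sub>R j)) has_real_derivative \<psi> (y - x) - \<psi> (y - x - h *\<^sub>R j)) (at 0)"
        by (simp add: left_diff_distrib)
    qed
    show "0 \<le> \<phi> y" for y unfolding \<phi>_eq C_def[symmetric] by (intro mult_nonneg_nonneg \<Theta>0 C0)
    show "ennreal (\<phi> y) \<le> cube_sweep e h j (y - x)" for y
      unfolding \<phi>_eq C_def[symmetric] FTC[symmetric] cube_sweep_def
      by (subst mult.commute, intro nn_integral_mono mult_left_mono \<psi>_le) simp
    show "continuous_on UNIV \<phi>" using sm by (rule smooth_fn_continuous)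
  qed
qed

section \<open>Steklov averages of square integrable functions\<close>

lemma Lp_space_2_iff:
  fixes u :: "'a::euclidean_space \<Rightarrow> 'b::euclidean_space"
  shows "u \<in> Lp_space 2 \<longleftrightarrow> u \<in> borel_measurable borel \<and> integrable lborel (\<lambda>x. (norm (u x))\<^sup>2)"
  by (simp add: Lp_space_def)

lemma L2_integrable_indicator:
  fixes u :: "'a::euclidean_space \<Rightarrow> 'b::euclidean_space"
  assumes u: "u \<in> Lp_space 2" and B: "B \<in> sets borel" "bounded B"
  shows "integrable lborel (\<lambda>x. indicator B x *\<^sub>R u x)"
proof (rule Bochner_Integration.integrable_bound)
  have "emeasure lborel B < \<infinity>" using B(2) by (rule emeasure_bounded_finite)
  then show "integrable lborel (\<lambda>x. indicator B x + (norm (u x))\<^sup>2)"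
    using u B(1) by (auto simp: Lp_space_2_iff)
  have "y \<le> 1 + y\<^sup>2" for y :: real
    using zero_le_power2[of "y - 1/2"] by (simp add: power2_eq_square algebra_simps)
  then show "AE x in lborel. norm (indicator B x *\<^sub>R u x) \<le> norm (indicator B x + (norm (u x))\<^sup>2)"
    by (intro AE_I2) (auto simp: indicator_def)
qed (use u B(1) in \<open>auto simp: Lp_space_2_iff\<close>)

text \<open>The division by the volume e^d is postponed to the places of use. The cube is open
  because its indicator is then the pointwise limit of smooth bumps; the value is the same as for
  the closed cube.\<close>

definition steklov :: "real \<Rightarrow> ('a::euclidean_space \<Rightarrow> 'b::euclidean_space) \<Rightarrow> 'a \<Rightarrow> 'b" where
  "steklov e u x = (LINT y|lborel. indicator (box 0 (e *\<^sub>R One)) (y - x) *\<^sub>R u y)"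

lemma norm_integral_le_nn_integral:
  fixes f :: "'a \<Rightarrow> 'b::{banach, second_countable_topology}"
  shows "ennreal (norm (integral\<^sup>L M f)) \<le> (\<integral>\<^sup>+ x. ennreal (norm (f x)) \<partial>M)"
  by (cases "integrable M f") (simp_all add: integral_norm_bound_ennreal not_integrable_integral_eq)

lemma indicator_translate_box:
  "(indicator (box 0 (e *\<^sub>R One)) (y - x) :: real) = indicator (box x (x + e *\<^sub>R One)) (y::'a::euclidean_space)"
  by (simp add: indicator_def mem_box inner_diff_left inner_add_left algebra_simps)

lemma steklov_integrable:
  fixes u :: "'a::euclidean_space \<Rightarrow> 'b::euclidean_space"
  assumes "u \<in> Lp_space 2"
  shows "integrable lborel (\<lambda>y. indicator (box 0 (e *\<^sub>R One)) (y - x) *\<^sub>R u y)"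
    "integrable lborel (\<lambda>y. indicator (cbox 0 (e *\<^sub>R One)) (y - x) *\<^sub>R u y)"
proof -
  show "integrable lborel (\<lambda>y. indicator (box 0 (e *\<^sub>R One)) (y - x) *\<^sub>R u y)"
    unfolding indicator_translate_box
    by (rule L2_integrable_indicator[OF assms]) (auto simp: bounded_box)
  have eq: "(indicator (cbox 0 (e *\<^sub>R One)) (y - x) :: real) = indicator (cbox x (x + e *\<^sub>R One)) y" for y
    by (simp add: indicator_def mem_box inner_diff_left inner_add_left algebra_simps)
  show "integrable lborel (\<lambda>y. indicator (cbox 0 (e *\<^sub>R One)) (y - x) *\<^sub>R u y)"
    unfolding eq by (rule L2_integrable_indicator[OF assms]) (auto simp: bounded_cbox)
qed

lemma steklov_eq_integral:
  fixes u :: "'a::euclidean_space \<Rightarrow> 'b::euclidean_space"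
  assumes "u \<in> Lp_space 2"
  shows "steklov e u x = integral (cbox x (x + e *\<^sub>R One)) u"
proof -
  have "set_integrable lborel (box x (x + e *\<^sub>R One)) u"
    unfolding set_integrable_def
    by (rule L2_integrable_indicator[OF assms]) (auto simp: bounded_box)
  from set_borel_integral_eq_integral(2)[OF this] show ?thesis
    by (simp add: steklov_def indicator_translate_box set_lebesgue_integral_def integral_open_interval)
qed

lemma L2_integrable_on_cbox:
  fixes u :: "'a::euclidean_space \<Rightarrow> 'b::euclidean_space"
  assumes "u \<in> Lp_space 2"
  shows "u integrable_on cbox a b"
proof (rule set_borel_integral_eq_integral(1))
  show "set_integrable lborel (cbox a b) u"
    unfolding set_integrable_def
    by (rule L2_integrable_indicator[OF assms]) (auto simp: bounded_cbox)
qed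

lemma steklov_continuous:
  fixes u :: "'a::euclidean_space \<Rightarrow> 'b::euclidean_space"
  assumes u: "u \<in> Lp_space 2" and e: "e > 0"
  shows "continuous_on UNIV (steklov e u)"
  unfolding continuous_on_iff
proof (intro ballI allI impI)
  fix x :: 'a and d :: real assume d: "d > 0"
  \<comment> \<open>The margin of one keeps both corners of the moving cube inside a fixed box for
    all points within distance 1 of x.\<close>
  let ?a = "x - One" and ?b = "x + (e + 1) *\<^sub>R One"
  have c: "x \<in> cbox ?a ?b" "x + e *\<^sub>R One \<in> cbox ?a ?b"
    using e by (auto simp: mem_box inner_simps)
  obtain \<delta> where \<delta>: "0 < \<delta>" "\<And>c' d'. \<lbrakk>c' \<in> cbox ?a ?b; d' \<in> cbox ?a ?b; norm (c' - x) \<le> \<delta>;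
      norm (d' - (x + e *\<^sub>R One)) \<le> \<delta>\<rbrakk>
    \<Longrightarrow> norm (integral (cbox c' d') u - integral (cbox x (x + e *\<^sub>R One)) u) < d"
    using indefinite_integral_continuous[OF L2_integrable_on_cbox[OF u] c d] by blast
  show "\<exists>\<delta>>0. \<forall>x'\<in>UNIV. dist x' x < \<delta> \<longrightarrow> dist (steklov e u x') (steklov e u x) < d"
  proof (intro exI[of _ "min \<delta> 1"] conjI ballI impI)
    fix x' assume "dist x' x < min \<delta> 1"
    then have n: "norm (x' - x) \<le> \<delta>" "norm (x' - x) < 1" by (auto simp: dist_norm)
    have "\<bar>(x' - x) \<bullet> b\<bar> \<le> 1" if "b \<in> Basis" for b
      using Basis_le_norm[OF that, of "x' - x"] n(2) by linarith
    then have "x' \<in> cbox ?a ?b" "x' + e *\<^sub>R One \<in> cbox ?a ?b"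
      using e by (fastforce simp: mem_box inner_simps abs_le_iff)+
    from \<delta>(2)[OF this] n(1) show "dist (steklov e u x') (steklov e u x) < d"
      by (simp add: steklov_eq_integral[OF u] dist_norm)
  qed (use \<delta>(1) in auto)
qed

lemma steklov_L2_bound:
  fixes u :: "'a::euclidean_space \<Rightarrow> 'b::euclidean_space"
  assumes u: "u \<in> Lp_space 2" and e: "e > 0"
  shows "(\<integral>\<^sup>+ x. (ennreal (norm (steklov e u x)))\<^sup>2 \<partial>lborel) \<le>
    (ennreal (e ^ DIM('a)))\<^sup>2 * (\<integral>\<^sup>+ x. (ennreal (norm (u x)))\<^sup>2 \<partial>lborel)"
proof -
  have [measurable]: "u \<in> borel_measurable borel" using u by (simp add: Lp_space_2_iff)
  let ?k = "indicator (box 0 (e *\<^sub>R One)) :: 'a \<Rightarrow> ennreal"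
  have "(\<integral>\<^sup>+ x. ?k x \<partial>lborel) = ennreal (e ^ DIM('a))"
    using e by (simp add: emeasure_lborel_box_eq inner_simps)
  moreover have "ennreal (norm (steklov e u x)) \<le> (\<integral>\<^sup>+ y. ?k (y - x) * ennreal (norm (u y)) \<partial>lborel)" for x
    unfolding steklov_def
    by (rule order_trans[OF norm_integral_le_nn_integral])
       (auto intro!: nn_integral_mono simp: indicator_def)
  then have "(\<integral>\<^sup>+ x. (ennreal (norm (steklov e u x)))\<^sup>2 \<partial>lborel) \<le>
    (\<integral>\<^sup>+ x. (\<integral>\<^sup>+ y. ?k (y - x) * ennreal (norm (u y)) \<partial>lborel)\<^sup>2 \<partial>lborel)"
    by (intro nn_integral_mono power_mono) auto
  ultimately show ?thesis
    using young_L1_L2[of ?k "\<lambda>y. ennreal (norm (u y))"] by auto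
qed

lemma exp_germ_1:
  "exp_germ 1 t = (if t > 0 then exp (- (1 / t)) else 0)" "0 \<le> exp_germ 1 t" "exp_germ 1 t \<le> 1"
  by (auto simp: exp_germ_def)

lemma exp_germ_1_tendsto: "(\<lambda>n. exp_germ 1 (real (Suc n) * t)) \<longlonglongrightarrow> indicator {0<..} t"
proof (cases "t > 0")
  case True
  have "(\<lambda>n. exp (- (1 / t * (1 / real (Suc n))))) \<longlonglongrightarrow> exp (- (1 / t * 0))"
    by (intro tendsto_intros LIMSEQ_Suc[OF lim_const_over_n])
  then show ?thesis using True by (simp add: exp_germ_1 mult.commute)
next
  case False
  then have "exp_germ 1 (real (Suc n) * t) = 0" for n
    by (auto simp: exp_germ_1 zero_less_mult_iff)
  then show ?thesis using False by simp
qed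

text \<open>The weak derivative is tested against swept bumps. Their j-derivatives are differences
  of translated bumps and converge to the difference of the two cubes' indicators, while the bumps
  themselves stay below \<open>cube_sweep\<close>. An inequality suffices, so no limit has to be
  taken on the side of \<open>G\<close>.\<close>

lemma steklov_difference_bound:
  fixes u :: "'a::euclidean_space \<Rightarrow> 'b::euclidean_space"
  assumes u: "u \<in> Lp_space 2" and G: "has_weak_L2_gradient u G"
    and j: "j \<in> Basis" and e: "e > 0" and h: "h > 0"
  shows "ennreal (norm (steklov e u (x + h *\<^sub>R j) - steklov e u x)) \<le>
    (\<integral>\<^sup>+ y. cube_sweep e h j (y - x) * ennreal (norm (G j y)) \<partial>lborel)"
proof -
  have [measurable]: "u \<in> borel_measurable borel" using u by (simp add: Lp_space_2_iff)
  have GL: "G j \<in> Lp_space 2" using G j by (simp add: has_weak_L2_gradient_def)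
  then have [measurable]: "G j \<in> borel_measurable borel" by (simp add: Lp_space_2_iff)
  \<comment> \<open>A smooth bump on (0, e) that tends pointwise to the indicator of the open
    interval as n grows, since exp (-1 / (n t)) tends to 1 for t > 0.\<close>
  define \<theta> where "\<theta> n t = exp_germ 1 (real (Suc n) * t) * exp_germ 1 (real (Suc n) * (e - t))" for n t
  define \<psi> where "\<psi> n y = (\<Prod>b\<in>Basis. \<theta> n (y \<bullet> b))" for n and y :: 'a
  have \<theta>1: "smooth_fn (\<theta> n)" for n
  proof -
    have "smooth_fn (\<lambda>t. exp_germ 1 (t \<bullet> real (Suc n) + 0) * exp_germ 1 (t \<bullet> (- real (Suc n)) + real (Suc n) * e))"
      by (intro smooth_fn_mult smooth_fn_exp_germ)
    moreover have "\<theta> n = (\<lambda>t. exp_germ 1 (t \<bullet> real (Suc n) + 0) * exp_germ 1 (t \<bullet> (- real (Suc n)) + real (Suc n) * e))"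
      unfolding \<theta>_def by (intro ext) (simp add: algebra_simps)
    ultimately show ?thesis by simp
  qed
  have \<theta>2: "0 \<le> \<theta> n t" "\<theta> n t \<le> 1" for n t
    unfolding \<theta>_def by (auto intro!: mult_nonneg_nonneg mult_le_one exp_germ_1)
  have \<theta>3: "0 \<le> t \<and> t \<le> e" if "\<theta> n t \<noteq> 0" for n t
    using that by (auto simp: \<theta>_def exp_germ_1 zero_less_mult_iff split: if_splits)
  have \<theta>4: "(\<lambda>n. \<theta> n t) \<longlonglongrightarrow> indicator {0<..} t * indicator {0<..} (e - t)" for t
    unfolding \<theta>_def by (intro tendsto_mult exp_germ_1_tendsto)
  let ?Q = "box 0 (e *\<^sub>R One) :: 'a set" and ?B = "cbox 0 (e *\<^sub>R One) :: 'a set"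
  have \<psi>_lim: "(\<lambda>n. \<psi> n z) \<longlonglongrightarrow> indicator ?Q z" for z
  proof -
    have "(\<lambda>n. \<psi> n z) \<longlonglongrightarrow> (\<Prod>b\<in>Basis. indicator {0<..} (z \<bullet> b) * indicator {0<..} (e - z \<bullet> b))"
      unfolding \<psi>_def by (intro tendsto_prod \<theta>4)
    moreover have "(\<Prod>b\<in>Basis. indicator {0<..} (z \<bullet> b) * indicator {0<..} (e - z \<bullet> b)) =
      (indicator ?Q z :: real)"
    proof (cases "z \<in> ?Q")
      case True
      then show ?thesis by (auto simp: mem_box intro!: prod.neutral)
    next
      case False
      then obtain b where b: "b \<in> Basis" "\<not> (0 < z \<bullet> b \<and> z \<bullet> b < e)" by (auto simp: mem_box)
      then have "(\<Prod>b\<in>Basis. indicator {0<..} (z \<bullet> b) * indicator {0<..} (e - z \<bullet> b)) = (0::real)"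
        by (intro prod_zero bexI[of _ b]) auto
      then show ?thesis using False by simp
    qed
    ultimately show ?thesis by simp
  qed
  have \<psi>_bd: "\<bar>\<psi> n z\<bar> \<le> indicator ?B z" for n z
  proof (cases "\<psi> n z = 0")
    case False
    then have "\<theta> n (z \<bullet> b) \<noteq> 0" if "b \<in> Basis" for b
      using that unfolding \<psi>_def by (auto simp: prod_zero_iff)
    then have "z \<in> ?B" using \<theta>3 by (auto simp: mem_box)
    moreover have "\<psi> n z \<le> 1" "0 \<le> \<psi> n z" unfolding \<psi>_def
      by (intro prod_le_1 prod_nonneg conjI ballI \<theta>2)+
    ultimately show ?thesis by simp
  qed simp
  have "continuous_on UNIV (\<theta> n)" for n by (rule smooth_fn_continuous[OF \<theta>1])
  then have [measurable]: "\<theta> n \<in> borel_measurable borel" for n by (rule borel_measurable_continuous_onI)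
  have [measurable]: "\<psi> n \<in> borel_measurable borel" for n unfolding \<psi>_def by measurable
  let ?s = "\<lambda>n y. (\<psi> n (y - x) - \<psi> n (y - x - h *\<^sub>R j)) *\<^sub>R u y"
  let ?l = "\<lambda>y. (indicator ?Q (y - x) - indicator ?Q (y - x - h *\<^sub>R j)) *\<^sub>R u y"
  have "(\<lambda>n. LINT y|lborel. ?s n y) \<longlonglongrightarrow> (LINT y|lborel. ?l y)"
  proof (rule integral_dominated_convergence)
    have "integrable lborel (\<lambda>y. norm (indicator ?B (y - x) *\<^sub>R u y) + norm (indicator ?B (y - (x + h *\<^sub>R j)) *\<^sub>R u y))"
      by (intro Bochner_Integration.integrable_add integrable_norm steklov_integrable u)
    then show "integrable lborel (\<lambda>y. (indicator ?B (y - x) + indicator ?B (y - x - h *\<^sub>R j)) * norm (u y))"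
      by (simp add: distrib_right diff_diff_eq)
    show "AE y in lborel. (\<lambda>n. ?s n y) \<longlonglongrightarrow> ?l y"
      by (intro AE_I2 tendsto_scaleR tendsto_diff \<psi>_lim tendsto_const)
    show "AE y in lborel. norm (?s n y) \<le> (indicator ?B (y - x) + indicator ?B (y - x - h *\<^sub>R j)) * norm (u y)" for n
    proof (rule AE_I2)
      fix y
      have "\<bar>\<psi> n (y - x) - \<psi> n (y - x - h *\<^sub>R j)\<bar> \<le> indicator ?B (y - x) + indicator ?B (y - x - h *\<^sub>R j)"
        using \<psi>_bd[of n "y - x"] \<psi>_bd[of n "y - x - h *\<^sub>R j"] by linarith
      then show "norm (?s n y) \<le> (indicator ?B (y - x) + indicator ?B (y - x - h *\<^sub>R j)) * norm (u y)"
        unfolding norm_scaleR by (intro mult_right_mono) auto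
    qed
  qed simp_all
  moreover have "(LINT y|lborel. ?l y) = steklov e u x - steklov e u (x + h *\<^sub>R j)"
    using Bochner_Integration.integral_diff[OF steklov_integrable(1)[OF u, of e x] steklov_integrable(1)[OF u, of e "x + h *\<^sub>R j"]]
    by (simp add: steklov_def scaleR_left_diff_distrib diff_diff_eq)
  ultimately have lim: "(\<lambda>n. ennreal (norm (LINT y|lborel. ?s n y))) \<longlonglongrightarrow>
      ennreal (norm (steklov e u x - steklov e u (x + h *\<^sub>R j)))"
    by (intro tendsto_ennrealI tendsto_norm) simp
  have "ennreal (norm (LINT y|lborel. ?s n y)) \<le>
    (\<integral>\<^sup>+ y. cube_sweep e h j (y - x) * ennreal (norm (G j y)) \<partial>lborel)" for n
  proof -
    obtain \<phi> where \<phi>: "test_function \<phi>"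
      "\<And>y. frechet_derivative \<phi> (at y) j = \<psi> n (y - x) - \<psi> n (y - x - h *\<^sub>R j)"
      "\<And>y. 0 \<le> \<phi> y" "\<And>y. ennreal (\<phi> y) \<le> cube_sweep e h j (y - x)" "continuous_on UNIV \<phi>"
      using swept_bump_test_function[OF \<theta>1[of n] \<theta>2[of n] \<theta>3[of n] j h, folded \<psi>_def] by blast
    have "(LINT y|lborel. ?s n y) = - (LINT y|lborel. \<phi> y *\<^sub>R G j y)"
      using G j \<phi>(1) unfolding has_weak_L2_gradient_def \<phi>(2)[symmetric] by blast
    then have "ennreal (norm (LINT y|lborel. ?s n y)) = ennreal (norm (LINT y|lborel. \<phi> y *\<^sub>R G j y))"
      by simp
    also have "\<dots> \<le> (\<integral>\<^sup>+ y. ennreal (norm (\<phi> y *\<^sub>R G j y)) \<partial>lborel)"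
      by (rule norm_integral_le_nn_integral)
    also have "\<dots> \<le> (\<integral>\<^sup>+ y. cube_sweep e h j (y - x) * ennreal (norm (G j y)) \<partial>lborel)"
      using \<phi>(3,4) by (intro nn_integral_mono) (simp add: ennreal_mult mult_right_mono)
    finally show ?thesis .
  qed
  then show ?thesis
    by (subst norm_minus_commute) (rule LIMSEQ_le_const2[OF lim], blast)
qed

text \<open>After division by \<open>h\<close> and by the volume e^d, the difference quotients of
  the averages are bounded by the L^2 norm of \<open>G j\<close> with constant one. Nothing is lost
  in the sharp inequality.\<close>

lemma steklov_difference_L2_bound:
  fixes u :: "'a::euclidean_space \<Rightarrow> 'b::euclidean_space"
  assumes u: "u \<in> Lp_space 2" and G: "has_weak_L2_gradient u G"
    and j: "j \<in> Basis" and e: "e > 0" and h: "h > 0"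
  shows "(\<integral>\<^sup>+ x. (ennreal (norm (steklov e u (x + h *\<^sub>R j) - steklov e u x)))\<^sup>2 \<partial>lborel) \<le>
    (ennreal (h * e ^ DIM('a)))\<^sup>2 * (\<integral>\<^sup>+ x. (ennreal (norm (G j x)))\<^sup>2 \<partial>lborel)"
proof -
  have "G j \<in> Lp_space 2" using G j by (simp add: has_weak_L2_gradient_def)
  then have [measurable]: "G j \<in> borel_measurable borel" by (simp add: Lp_space_2_iff)
  have "(\<integral>\<^sup>+ x. (ennreal (norm (steklov e u (x + h *\<^sub>R j) - steklov e u x)))\<^sup>2 \<partial>lborel) \<le>
    (\<integral>\<^sup>+ x. (\<integral>\<^sup>+ y. cube_sweep e h j (y - x) * ennreal (norm (G j y)) \<partial>lborel)\<^sup>2 \<partial>lborel)"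
    by (intro nn_integral_mono power_mono steklov_difference_bound assms) simp
  also have "\<dots> \<le> (ennreal (h * e ^ DIM('a)))\<^sup>2 * (\<integral>\<^sup>+ x. (ennreal (norm (G j x)))\<^sup>2 \<partial>lborel)"
    using young_L1_L2[of "cube_sweep e h j" "\<lambda>y. ennreal (norm (G j y))"]
    by (simp add: nn_integral_cube_sweep[OF e h])
  finally show ?thesis .
qed

text \<open>Lebesgue's differentiation theorem for cubes that have x as a corner; the exceptional
  set is null for the completed measure, and this transfers to \<open>lborel\<close>.\<close>

lemma steklov_AE_tendsto:
  fixes u :: "'a::euclidean_space \<Rightarrow> 'b::euclidean_space"
  assumes u: "u \<in> Lp_space 2" and e: "\<And>n. e n > 0" "e \<longlonglongrightarrow> 0"
  shows "AE x in lborel. (\<lambda>n. steklov (e n) u x /\<^sub>R e n ^ DIM('a)) \<longlonglongrightarrow> u x"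
proof -
  obtain N where N: "negligible N" "\<And>x d. \<lbrakk>x \<notin> N; 0 < d\<rbrakk> \<Longrightarrow> \<exists>\<delta>>0. \<forall>h. 0 < h \<and> h < \<delta> \<longrightarrow>
      norm (integral (cbox x (x + h *\<^sub>R One)) u /\<^sub>R h ^ DIM('a) - u x) < d"
    using integrable_ccontinuous_explicit[OF L2_integrable_on_cbox[OF u]] by blast
  have "AE x in completion lborel. x \<notin> N"
    using N(1) by (intro AE_not_in) (simp add: negligible_iff_null_sets)
  then have "AE x in lborel. x \<notin> N" by (rule AE_completion_iff[THEN iffD1])
  then show ?thesis
  proof eventually_elim
    case (elim x)
    show ?case
    proof (rule tendstoI)
      fix d :: real assume "d > 0"
      from N(2)[OF elim this] obtain \<delta> where \<delta>: "\<delta> > 0" "\<And>h. 0 < h \<Longrightarrow> h < \<delta> \<Longrightarrow>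
        norm (integral (cbox x (x + h *\<^sub>R One)) u /\<^sub>R h ^ DIM('a) - u x) < d" by blast
      have "eventually (\<lambda>n. e n < \<delta>) sequentially" using e(2) \<delta>(1) by (rule order_tendstoD)
      then show "eventually (\<lambda>n. dist (steklov (e n) u x /\<^sub>R e n ^ DIM('a)) (u x) < d) sequentially"
      proof eventually_elim
        case (elim n)
        from \<delta>(2)[OF e(1) elim] show ?case by (simp add: steklov_eq_integral[OF u] dist_norm)
      qed
    qed
  qed
qed

section \<open>Extension to the Sobolev space\<close>

lemma power2_sum_le_weighted:
  fixes a b \<eta> :: real
  assumes "\<eta> > 0"
  shows "(a + b)\<^sup>2 \<le> (1 + \<eta>) * a\<^sup>2 + (1 + 1 / \<eta>) * b\<^sup>2"
proof -
  have "0 \<le> (\<eta> * a - b)\<^sup>2 / \<eta>" using assms by simp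
  also have "\<dots> = (1 + \<eta>) * a\<^sup>2 + (1 + 1 / \<eta>) * b\<^sup>2 - (a + b)\<^sup>2"
    using assms by (simp add: power2_eq_square field_simps)
  finally show ?thesis by simp
qed

lemma integral_norm_power2_le:
  fixes f :: "'a \<Rightarrow> 'b::euclidean_space"
  assumes [measurable]: "f \<in> borel_measurable M"
    and le: "(\<integral>\<^sup>+ x. (ennreal (norm (f x)))\<^sup>2 \<partial>M) \<le> ennreal c" and c: "c \<ge> 0"
  shows "integrable M (\<lambda>x. (norm (f x))\<^sup>2)" "(LINT x|M. (norm (f x))\<^sup>2) \<le> c"
proof -
  have eq: "(\<integral>\<^sup>+ x. (ennreal (norm (f x)))\<^sup>2 \<partial>M) = (\<integral>\<^sup>+ x. ennreal ((norm (f x))\<^sup>2) \<partial>M)"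
    by (simp add: ennreal_power)
  have "(\<integral>\<^sup>+ x. ennreal ((norm (f x))\<^sup>2) \<partial>M) < \<infinity>"
    using le unfolding eq by (auto intro: le_less_trans)
  then show i: "integrable M (\<lambda>x. (norm (f x))\<^sup>2)" by (intro integrableI_nonneg) auto
  then show "(LINT x|M. (norm (f x))\<^sup>2) \<le> c"
    using le c unfolding eq by (subst (asm) nn_integral_eq_integral) auto
qed

lemma nn_integral_norm_power2:
  assumes "integrable M (\<lambda>x. (norm (f x))\<^sup>2)"
  shows "(\<integral>\<^sup>+ x. (ennreal (norm (f x)))\<^sup>2 \<partial>M) = ennreal (LINT x|M. (norm (f x))\<^sup>2)"
  using assms by (simp add: ennreal_power nn_integral_eq_integral)

text \<open>Cutting off at radius \<open>R\<close> perturbs the bounds on the difference quotients by terms of order \<open>1 / R\<close>.\<close>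

lemma gn_transport_cutoff:
  fixes v :: "'a::euclidean_space \<Rightarrow> 'b::euclidean_space" and A :: "'a \<Rightarrow> real"
  assumes cont: "continuous_on UNIV v"
    and m: "integrable lborel (\<lambda>x. (norm (v x))\<^sup>2)" "(LINT x|lborel. (norm (v x))\<^sup>2) \<le> m"
    and Ai: "\<And>b t. b \<in> Basis \<Longrightarrow> t > 0 \<Longrightarrow> integrable lborel (\<lambda>x. (norm (v (x + t *\<^sub>R b) - v x))\<^sup>2)"
    and A: "\<And>b t. b \<in> Basis \<Longrightarrow> t > 0 \<Longrightarrow>
      (LINT x|lborel. (norm (v (x + t *\<^sub>R b) - v x))\<^sup>2) \<le> t\<^sup>2 * A b"
    and K: "K > 0" and l: "l > 0" and s: "0 \<le> s" "real DIM('a) * s \<le> 1" and R: "R > 0"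
  defines "N \<equiv> integral {-K..K} (\<lambda>y. exp (-(y\<^sup>2) / 2))"
    and "D \<equiv> (real DIM('a) * K\<^sup>2)\<^sup>2 / 8 + (real DIM('a))\<^sup>2 * K\<^sup>2 / 2"
  shows "(\<integral>\<^sup>+ x. ennreal (norm (max 0 (1 - norm x / R) *\<^sub>R v x) powr (2 + 2 * s)) \<partial>lborel) \<le>
     ennreal (m powr s * (N * l) powr (- (real DIM('a) * s)) *
       (m * (1 - real DIM('a) * s + s\<^sup>2 * D) +
        2 * s * l\<^sup>2 * (\<Sum>b\<in>Basis. (1 + 1 / R) * A b + (1 + R) * (1 / R)\<^sup>2 * m)))"
proof -
  define \<kappa> where "\<kappa> x = max 0 (1 - norm x / R)" for x :: 'a
  define w where "w x = \<kappa> x *\<^sub>R v x" for x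
  have \<kappa>: "0 \<le> \<kappa> x" "\<kappa> x \<le> 1" for x using R by (auto simp: \<kappa>_def)
  have \<kappa>_lip: "\<bar>\<kappa> x - \<kappa> y\<bar> \<le> norm (x - y) / R" for x y
  proof -
    have "\<bar>\<kappa> x - \<kappa> y\<bar> \<le> \<bar>norm x / R - norm y / R\<bar>" unfolding \<kappa>_def by linarith
    also have "\<dots> = \<bar>norm x - norm y\<bar> / R" using R by (simp add: diff_divide_distrib[symmetric])
    also have "\<dots> \<le> norm (x - y) / R" using R by (intro divide_right_mono norm_triangle_ineq3) auto
    finally show ?thesis .
  qed
  have "0 \<le> (LINT x|lborel. (norm (v x))\<^sup>2)" by simp
  with m(2) have m0: "0 \<le> m" by linarith
  have wcont: "continuous_on UNIV w"
    unfolding w_def \<kappa>_def using R by (intro continuous_intros cont) auto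
  have wsupp: "\<bar>x \<bullet> b\<bar> \<le> R" if "w x \<noteq> 0" "b \<in> Basis" for x b
  proof -
    have "\<kappa> x \<noteq> 0" using that(1) by (auto simp: w_def)
    then have "norm x < R" using R by (simp add: \<kappa>_def max_def field_simps split: if_splits)
    then show ?thesis using Basis_le_norm[OF that(2), of x] by linarith
  qed
  have [measurable]: "v \<in> borel_measurable borel" "w \<in> borel_measurable borel"
    using cont wcont by (auto intro: borel_measurable_continuous_onI)
  \<comment> \<open>The square of the sum of the two increments is split with weight 1/R. The
    coefficient of \<open>A b\<close> then tends to 1, and the coefficient (1 + R) / R^2 of the mass
    tends to 0.\<close>
  define A' where "A' b = (1 + 1 / R) * A b + (1 + R) * (1 / R)\<^sup>2 * m" for b
  have A': "(LINT x|lborel. (norm (w (x + t *\<^sub>R b) - w x))\<^sup>2) \<le> t\<^sup>2 * A' b"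
    if b: "b \<in> Basis" and t: "t > 0" for b t
  proof -
    have pw: "(norm (w (x + t *\<^sub>R b) - w x))\<^sup>2 \<le>
      (1 + 1 / R) * (norm (v (x + t *\<^sub>R b) - v x))\<^sup>2 + (1 + R) * (t / R)\<^sup>2 * (norm (v x))\<^sup>2" for x
    proof -
      have "w (x + t *\<^sub>R b) - w x = \<kappa> (x + t *\<^sub>R b) *\<^sub>R (v (x + t *\<^sub>R b) - v x) + (\<kappa> (x + t *\<^sub>R b) - \<kappa> x) *\<^sub>R v x"
        by (simp add: w_def algebra_simps)
      also have "norm \<dots> \<le> \<kappa> (x + t *\<^sub>R b) * norm (v (x + t *\<^sub>R b) - v x) + \<bar>\<kappa> (x + t *\<^sub>R b) - \<kappa> x\<bar> * norm (v x)"
        using \<kappa> by (intro order_trans[OF norm_triangle_ineq]) simp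
      also have "\<dots> \<le> 1 * norm (v (x + t *\<^sub>R b) - v x) + t / R * norm (v x)"
        using \<kappa>_lip[of "x + t *\<^sub>R b" x] \<kappa> t b by (intro add_mono mult_right_mono) auto
      finally have "(norm (w (x + t *\<^sub>R b) - w x))\<^sup>2 \<le> (norm (v (x + t *\<^sub>R b) - v x) + t / R * norm (v x))\<^sup>2"
        by (intro power_mono) auto
      also have "\<dots> \<le> (1 + 1 / R) * (norm (v (x + t *\<^sub>R b) - v x))\<^sup>2 + (1 + 1 / (1 / R)) * (t / R * norm (v x))\<^sup>2"
        using R by (intro power2_sum_le_weighted) auto
      finally show ?thesis by (simp only: power_mult_distrib mult.assoc div_by_1 divide_divide_eq_right mult_1)
    qed
    have int: "integrable lborel (\<lambda>x. (1 + 1 / R) * (norm (v (x + t *\<^sub>R b) - v x))\<^sup>2 + (1 + R) * (t / R)\<^sup>2 * (norm (v x))\<^sup>2)"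
      using Ai[OF b t] m(1) by simp
    have "integrable lborel (\<lambda>x. (norm (w (x + t *\<^sub>R b) - w x))\<^sup>2)"
      by (rule Bochner_Integration.integrable_bound[OF int])
         (use pw in \<open>auto intro!: AE_I2 intro: order_trans[OF _ abs_ge_self]\<close>)
    then have "(LINT x|lborel. (norm (w (x + t *\<^sub>R b) - w x))\<^sup>2) \<le>
      (LINT x|lborel. (1 + 1 / R) * (norm (v (x + t *\<^sub>R b) - v x))\<^sup>2 + (1 + R) * (t / R)\<^sup>2 * (norm (v x))\<^sup>2)"
      using int pw by (rule integral_mono)
    also have "\<dots> = (1 + 1 / R) * (LINT x|lborel. (norm (v (x + t *\<^sub>R b) - v x))\<^sup>2) +
        (1 + R) * (t / R)\<^sup>2 * (LINT x|lborel. (norm (v x))\<^sup>2)"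
      using Ai[OF b t] m(1) by simp
    also have "\<dots> \<le> (1 + 1 / R) * (t\<^sup>2 * A b) + (1 + R) * (t / R)\<^sup>2 * m"
      using R by (intro add_mono mult_left_mono A b t m(2)) auto
    also have "\<dots> = t\<^sup>2 * A' b"
      by (simp add: A'_def power_divide algebra_simps)
    finally show ?thesis .
  qed
  define mw where "mw = (LINT x|lborel. (norm (w x))\<^sup>2)"
  note gn = gn_transport_compact_support[OF wcont wsupp A' K l s, folded N_def D_def mw_def]
  have mw: "0 \<le> mw" "mw \<le> m"
  proof -
    show "0 \<le> mw" by (simp add: mw_def)
    have "norm (w x) \<le> norm (v x)" for x
      using mult_right_mono[OF \<kappa>(2)[of x], of "norm (v x)"] \<kappa>(1)[of x] by (simp add: w_def)
    then have "mw \<le> (LINT x|lborel. (norm (v x))\<^sup>2)"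
      unfolding mw_def by (intro integral_mono gn(2) m(1) power_mono) auto
    then show "mw \<le> m" using m(2) by linarith
  qed
  have D0: "D \<ge> 0" by (simp add: D_def)
  have A'0: "0 \<le> A' b" if "b \<in> Basis" for b
  proof -
    have "0 \<le> (LINT x|lborel. (norm (w (x + 1 *\<^sub>R b) - w x))\<^sup>2)" by simp
    also note A'[OF that, of 1]
    finally show ?thesis by simp
  qed
  have "(LINT x|lborel. norm (w x) powr (2 + 2 * s)) \<le>
     mw powr s * (N * l) powr (- (real DIM('a) * s)) *
       (mw * (1 - real DIM('a) * s + s\<^sup>2 * D) + 2 * s * l\<^sup>2 * (\<Sum>b\<in>Basis. A' b))"
    by (rule gn(3))
  also have "\<dots> \<le> m powr s * (N * l) powr (- (real DIM('a) * s)) *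
       (m * (1 - real DIM('a) * s + s\<^sup>2 * D) + 2 * s * l\<^sup>2 * (\<Sum>b\<in>Basis. A' b))"
    using mw s D0 A'0 m0
    by (intro mult_mono mult_right_mono powr_mono2 add_right_mono add_nonneg_nonneg mult_nonneg_nonneg sum_nonneg) auto
  finally have "(\<integral>\<^sup>+ x. ennreal (norm (w x) powr (2 + 2 * s)) \<partial>lborel) \<le>
    ennreal (m powr s * (N * l) powr (- (real DIM('a) * s)) *
       (m * (1 - real DIM('a) * s + s\<^sup>2 * D) + 2 * s * l\<^sup>2 * (\<Sum>b\<in>Basis. A' b)))"
    using gn(1) by (subst nn_integral_eq_integral) (auto intro: ennreal_leI)
  then show ?thesis by (simp only: w_def \<kappa>_def A'_def)
qed

text \<open>The cut-off bound is applied to the normalized Steklov averages with e = 1 / (n + 1) and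
  R = n + 1. Their mass and difference quotients obey the same bounds for all n, and they converge
  to \<open>u\<close> almost everywhere, so Fatou's lemma applies. The left-hand side is a
  nonnegative integral, hence finiteness of the L^p norm is part of the conclusion and no Sobolev
  embedding is invoked.\<close>

lemma gn_transport_H1:
  fixes u :: "'a::euclidean_space \<Rightarrow> 'b::euclidean_space"
  assumes u: "u \<in> Lp_space 2" and G: "has_weak_L2_gradient u G"
    and K: "K > 0" and l: "l > 0" and s: "0 \<le> s" "real DIM('a) * s \<le> 1"
  defines "N \<equiv> integral {-K..K} (\<lambda>y. exp (-(y\<^sup>2) / 2))"
    and "D \<equiv> (real DIM('a) * K\<^sup>2)\<^sup>2 / 8 + (real DIM('a))\<^sup>2 * K\<^sup>2 / 2"
    and "m \<equiv> (LINT x|lborel. (norm (u x))\<^sup>2)"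
  shows "(\<integral>\<^sup>+ x. ennreal (norm (u x) powr (2 + 2 * s)) \<partial>lborel) \<le>
     ennreal (m powr s * (N * l) powr (- (real DIM('a) * s)) *
       (m * (1 - real DIM('a) * s + s\<^sup>2 * D) +
        2 * s * l\<^sup>2 * (\<Sum>b\<in>Basis. LINT x|lborel. (norm (G b x))\<^sup>2)))"
proof -
  have [measurable]: "u \<in> borel_measurable borel" and ui: "integrable lborel (\<lambda>x. (norm (u x))\<^sup>2)"
    using u by (auto simp: Lp_space_2_iff)
  have Gi: "integrable lborel (\<lambda>x. (norm (G b x))\<^sup>2)" if "b \<in> Basis" for b
    using G that by (auto simp: has_weak_L2_gradient_def Lp_space_2_iff)
  define A where "A b = (LINT x|lborel. (norm (G b x))\<^sup>2)" for b
  have A0: "0 \<le> A b" for b by (simp add: A_def)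
  have m0: "0 \<le> m" by (simp add: m_def)
  define e where "e n = 1 / real (Suc n)" for n
  have e: "e n > 0" "e \<longlonglongrightarrow> 0" for n
    unfolding e_def by (simp, rule LIMSEQ_Suc[OF lim_const_over_n])
  define R where "R n = real (Suc n)" for n
  have R0: "R n > 0" for n by (simp add: R_def)
  have Rlim: "filterlim R at_top sequentially"
    unfolding R_def by (rule filterlim_compose[OF filterlim_real_sequentially filterlim_Suc])
  define v where "v n x = steklov (e n) u x /\<^sub>R e n ^ DIM('a)" for n x
  have vcont: "continuous_on UNIV (v n)" for n
    unfolding v_def by (intro continuous_intros steklov_continuous u e)
  have [measurable]: "v n \<in> borel_measurable borel" for n
    using vcont by (rule borel_measurable_continuous_onI)
  let ?c = "\<lambda>n. e n ^ DIM('a)"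
  have c0: "?c n > 0" for n using e(1) by simp
  have scale: "(ennreal (norm (y /\<^sub>R ?c n)))\<^sup>2 = ennreal (1 / (?c n)\<^sup>2) * (ennreal (norm y))\<^sup>2" for y :: 'b and n
    using c0[of n] by (simp add: ennreal_power ennreal_mult[symmetric] power_mult_distrib power_divide divide_inverse power_inverse)
  have v_m: "(\<integral>\<^sup>+ x. (ennreal (norm (v n x)))\<^sup>2 \<partial>lborel) \<le> ennreal m" for n
  proof -
    have [measurable]: "steklov (e n) u \<in> borel_measurable borel"
      using steklov_continuous[OF u e(1)] by (rule borel_measurable_continuous_onI)
    have "(\<integral>\<^sup>+ x. (ennreal (norm (v n x)))\<^sup>2 \<partial>lborel) =
      ennreal (1 / (?c n)\<^sup>2) * (\<integral>\<^sup>+ x. (ennreal (norm (steklov (e n) u x)))\<^sup>2 \<partial>lborel)"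
      unfolding v_def scale by (rule nn_integral_cmult) simp
    also have "\<dots> \<le> ennreal (1 / (?c n)\<^sup>2) * ((ennreal (?c n))\<^sup>2 * ennreal m)"
      using steklov_L2_bound[OF u e(1)[of n]] unfolding nn_integral_norm_power2[OF ui] m_def
      by (rule mult_left_mono) simp
    also have "\<dots> = ennreal m"
      using e(1)[of n] m0 by (simp add: ennreal_power ennreal_mult[symmetric])
    finally show ?thesis .
  qed
  have v_A: "(\<integral>\<^sup>+ x. (ennreal (norm (v n (x + t *\<^sub>R b) - v n x)))\<^sup>2 \<partial>lborel) \<le> ennreal (t\<^sup>2 * A b)"
    if b: "b \<in> Basis" and t: "t > 0" for n b t
  proof -
    have [measurable]: "steklov (e n) u \<in> borel_measurable borel"
      using steklov_continuous[OF u e(1)] by (rule borel_measurable_continuous_onI)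
    have "(\<integral>\<^sup>+ x. (ennreal (norm (v n (x + t *\<^sub>R b) - v n x)))\<^sup>2 \<partial>lborel) =
      ennreal (1 / (?c n)\<^sup>2) * (\<integral>\<^sup>+ x. (ennreal (norm (steklov (e n) u (x + t *\<^sub>R b) - steklov (e n) u x)))\<^sup>2 \<partial>lborel)"
      unfolding v_def scaleR_right_diff_distrib[symmetric] scale by (rule nn_integral_cmult) simp
    also have "\<dots> \<le> ennreal (1 / (?c n)\<^sup>2) * ((ennreal (t * ?c n))\<^sup>2 * ennreal (A b))"
      using steklov_difference_L2_bound[OF u G b e(1)[of n] t] unfolding nn_integral_norm_power2[OF Gi[OF b]] A_def
      by (rule mult_left_mono) simp
    also have "\<dots> = ennreal (t\<^sup>2 * A b)"
      using e(1)[of n] t A0[of b] by (simp add: ennreal_power ennreal_mult[symmetric] power_mult_distrib)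
    finally show ?thesis .
  qed
  let ?p = "2 + 2 * s" and ?d = "real DIM('a)"
  define w where "w n x = max 0 (1 - norm x / R n) *\<^sub>R v n x" for n x
  define B where "B n = m powr s * (N * l) powr (- (?d * s)) *
       (m * (1 - ?d * s + s\<^sup>2 * D) + 2 * s * l\<^sup>2 * (\<Sum>b\<in>Basis. (1 + 1 / R n) * A b + (1 + R n) * (1 / R n)\<^sup>2 * m))" for n
  have wB: "(\<integral>\<^sup>+ x. ennreal (norm (w n x) powr ?p) \<partial>lborel) \<le> ennreal (B n)" for n
    unfolding w_def B_def N_def D_def
  proof (rule gn_transport_cutoff)
    show "integrable lborel (\<lambda>x. (norm (v n x))\<^sup>2)" "(LINT x|lborel. (norm (v n x))\<^sup>2) \<le> m"
      using integral_norm_power2_le[OF _ v_m m0] by auto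
    show "integrable lborel (\<lambda>x. (norm (v n (x + t *\<^sub>R b) - v n x))\<^sup>2)"
      and "(LINT x|lborel. (norm (v n (x + t *\<^sub>R b) - v n x))\<^sup>2) \<le> t\<^sup>2 * A b"
      if "b \<in> Basis" "t > 0" for b t
      using integral_norm_power2_le[OF _ v_A[OF that], of n] A0[of b] by auto
  qed (use vcont K l s R0 in auto)
  have Blim: "B \<longlonglongrightarrow> m powr s * (N * l) powr (- (?d * s)) *
       (m * (1 - ?d * s + s\<^sup>2 * D) + 2 * s * l\<^sup>2 * (\<Sum>b\<in>Basis. (1 + 0) * A b + 0 * m))"
  proof -
    have R1: "(\<lambda>n. 1 / R n) \<longlonglongrightarrow> 0" using e(2) by (simp add: e_def[abs_def] R_def[abs_def])
    have "(\<lambda>n. (1 / R n)\<^sup>2 + 1 / R n) \<longlonglongrightarrow> 0\<^sup>2 + 0" by (intro tendsto_intros R1)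
    moreover have "(1 / R n)\<^sup>2 + 1 / R n = (1 + R n) * (1 / R n)\<^sup>2" for n
      using R0[of n] by (simp add: power2_eq_square field_simps)
    ultimately have R2: "(\<lambda>n. (1 + R n) * (1 / R n)\<^sup>2) \<longlonglongrightarrow> 0" by simp
    show ?thesis unfolding B_def by (intro tendsto_intros R1 R2)
  qed
  have ae: "AE x in lborel. (\<lambda>n. norm (w n x) powr ?p) \<longlonglongrightarrow> norm (u x) powr ?p"
    using steklov_AE_tendsto[OF u e]
  proof eventually_elim
    case (elim x)
    have "(\<lambda>n. max 0 (1 - norm x * e n)) \<longlonglongrightarrow> max 0 (1 - norm x * 0)"
      by (intro tendsto_intros e)
    then have "(\<lambda>n. max 0 (1 - norm x / R n)) \<longlonglongrightarrow> 1" by (simp add: e_def R_def)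
    then have "(\<lambda>n. w n x) \<longlonglongrightarrow> 1 *\<^sub>R u x"
      unfolding w_def v_def by (rule tendsto_scaleR) (rule elim)
    then show ?case
      using s by (intro tendsto_powr' tendsto_norm tendsto_const) auto
  qed
  have "(\<integral>\<^sup>+ x. ennreal (norm (u x) powr ?p) \<partial>lborel) =
    (\<integral>\<^sup>+ x. liminf (\<lambda>n. ennreal (norm (w n x) powr ?p)) \<partial>lborel)"
    using ae by (intro nn_integral_cong_AE)
      (auto elim!: eventually_mono intro!: lim_imp_Liminf[symmetric] tendsto_ennrealI)
  also have "\<dots> \<le> liminf (\<lambda>n. \<integral>\<^sup>+ x. ennreal (norm (w n x) powr ?p) \<partial>lborel)"
    unfolding w_def by (rule nn_integral_liminf) measurable
  also have "\<dots> \<le> liminf (\<lambda>n. ennreal (B n))"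
    by (intro Liminf_mono always_eventually allI wB)
  also have "\<dots> = ennreal (m powr s * (N * l) powr (- (?d * s)) *
       (m * (1 - ?d * s + s\<^sup>2 * D) + 2 * s * l\<^sup>2 * (\<Sum>b\<in>Basis. (1 + 0) * A b + 0 * m)))"
    by (rule lim_imp_Liminf) (use tendsto_ennrealI[OF Blim] in auto)
  finally show ?thesis by (simp add: A_def)
qed

lemma gradient_L2_norm_eq:
  fixes G :: "'a::euclidean_space \<Rightarrow> 'a \<Rightarrow> 'b::euclidean_space"
  assumes "\<And>b. b \<in> Basis \<Longrightarrow> integrable lborel (\<lambda>x. (norm (G b x))\<^sup>2)"
  shows "gradient_L2_norm G = (\<Sum>b\<in>Basis. LINT x|lborel. (norm (G b x))\<^sup>2) powr (1 / 2)"
proof -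
  have "norm (L2_set (\<lambda>i. norm (G i x)) Basis) powr 2 = (\<Sum>b\<in>Basis. (norm (G b x))\<^sup>2)" for x
    by (simp add: L2_set_def sum_nonneg)
  then show ?thesis
    using assms by (simp add: gradient_L2_norm_def Lp_norm_def Bochner_Integration.integral_sum)
qed

text \<open>The bound with a free scale is made homogeneous by the choice of \<open>l\<close>, and
  the power 1 / (1 + s) turns the integral of |u|^p into the squared norm. The energy term
  contributes + d s / 2, which is why 1 - d s becomes 1 - d s / 2.\<close>

lemma GN_inequality_upper:
  fixes K s :: real
  assumes K: "K > 0" and s: "0 < s" "real DIM('a::euclidean_space) * s \<le> 1"
  defines "N \<equiv> integral {-K..K} (\<lambda>y. exp (-(y\<^sup>2) / 2))"
    and "D \<equiv> (real DIM('a) * K\<^sup>2)\<^sup>2 / 8 + (real DIM('a))\<^sup>2 * K\<^sup>2 / 2"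
  shows "GN_inequality TYPE('a) TYPE('b::{real_normed_field,euclidean_space}) (2 + 2 * s)
    ((N\<^sup>2 * real DIM('a) / 4) powr (- (real DIM('a) * s / (2 * (1 + s)))) *
     (1 - real DIM('a) * s / 2 + s\<^sup>2 * D) powr (1 / (1 + s)))"
  unfolding GN_inequality_def
proof (intro ballI allI impI)
  fix u :: "'a \<Rightarrow> 'b" and G
  assume uH: "u \<in> H1" and G: "has_weak_L2_gradient u G"
  let ?d = "real DIM('a)"
  let ?p = "2 + 2 * s"
  have d0: "?d > 0" by simp
  have u: "u \<in> Lp_space 2" using uH by (simp add: H1_def)
  then have [measurable]: "u \<in> borel_measurable borel" by (simp add: Lp_space_2_iff)
  have N0: "N > 0" unfolding N_def using K by (rule truncated_gaussian_mass_pos)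
  have D0: "D \<ge> 0" by (simp add: D_def)
  define m where "m = (LINT x|lborel. (norm (u x))\<^sup>2)"
  define A where "A = (\<Sum>b\<in>Basis. LINT x|lborel. (norm (G b x))\<^sup>2)"
  have m0: "0 \<le> m" by (simp add: m_def)
  have A0: "0 \<le> A" unfolding A_def by (intro sum_nonneg) simp
  define I where "I = (LINT x|lborel. norm (u x) powr ?p)"
  define B where "B l = m powr s * (N * l) powr (- (?d * s)) *
       (m * (1 - ?d * s + s\<^sup>2 * D) + 2 * s * l\<^sup>2 * A)" for l
  have nn: "(\<integral>\<^sup>+ x. ennreal (norm (u x) powr ?p) \<partial>lborel) \<le> ennreal (B l)" if "l > 0" for l
    unfolding B_def A_def m_def N_def D_def using s
    by (intro gn_transport_H1[OF u G K that]) auto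
  have int: "integrable lborel (\<lambda>x. norm (u x) powr ?p)"
    using nn[of 1] by (intro integrableI_nonneg) (auto intro: le_less_trans)
  have B0: "0 \<le> B l" for l
    unfolding B_def using s m0 A0 D0 by (intro mult_nonneg_nonneg add_nonneg_nonneg) auto
  have I: "I \<le> B l" if "l > 0" for l
    using nn[OF that] B0[of l] unfolding nn_integral_eq_integral[OF int AE_I2[OF powr_ge_zero]] I_def by simp
  have I0: "0 \<le> I" unfolding I_def by simp
  define \<theta> where "\<theta> = ?d * s / (2 * (1 + s))"
  define E where "E = 1 - ?d * s / 2 + s\<^sup>2 * D"
  have E0: "E > 0"
  proof -
    have "1 - ?d * s / 2 > 0" using s by simp
    moreover have "0 \<le> s\<^sup>2 * D" using D0 by simp
    ultimately show ?thesis unfolding E_def by linarith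
  qed
  define U where "U = (N\<^sup>2 * ?d / 4) powr (- \<theta>) * E powr (1 / (1 + s))"
  have main: "I powr (1 / (1 + s)) \<le> U * A powr \<theta> * m powr (1 - \<theta>)"
  proof (cases "m = 0 \<or> A = 0")
    case True
    have "I = 0"
    proof (cases "m = 0")
      case True
      then show ?thesis using I[of 1] I0 by (simp add: B_def)
    next
      case False
      with \<open>m = 0 \<or> A = 0\<close> have A: "A = 0" by simp
      \<comment> \<open>With zero energy no finite scale is best: the bound tends to 0 as l tends to
        infinity, so the integral vanishes.\<close>
      have "((\<lambda>l. l powr (- (?d * s))) \<longlongrightarrow> 0) at_top"
        using d0 s by (intro tendsto_neg_powr filterlim_ident) simp
      then have "((\<lambda>l. (m powr s * N powr (- (?d * s)) * (m * (1 - ?d * s + s\<^sup>2 * D))) * l powr (- (?d * s))) \<longlongrightarrow>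
        (m powr s * N powr (- (?d * s)) * (m * (1 - ?d * s + s\<^sup>2 * D))) * 0) at_top"
        by (rule tendsto_mult_left)
      moreover have "(m powr s * N powr (- (?d * s)) * (m * (1 - ?d * s + s\<^sup>2 * D))) * l powr (- (?d * s)) = B l" for l
        by (simp add: B_def A powr_mult)
      ultimately have "(B \<longlongrightarrow> 0) at_top" by simp
      then have "I \<le> 0"
        by (rule tendsto_lowerbound) (auto intro: eventually_mono[OF eventually_gt_at_top[of 0]] I)
      then show ?thesis using I0 by simp
    qed
    then show ?thesis by (simp add: U_def)
  next
    case False
    then have m: "m > 0" and A: "A > 0" using m0 A0 by auto
    \<comment> \<open>The minimizer of the bound to leading order in s; it gives 2 s l^2 A = s d m /
      2.\<close>
    define l where "l = sqrt (?d * m / (4 * A))"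
    have l: "l > 0" "l\<^sup>2 = ?d * m / (4 * A)" using m A d0 by (simp_all add: l_def)
    have "B l = m powr s * (N * l) powr (- (?d * s)) * (m * E)"
      using A by (simp add: B_def l(2) E_def field_simps)
    also have "(N * l) powr (- (?d * s)) = ((N * l) powr 2) powr (- (?d * s / 2))"
      by (subst powr_powr) simp
    also have "(N * l) powr 2 = N\<^sup>2 * ?d / 4 * (m / A)"
      using N0 l A by (simp add: power_mult_distrib)
    finally have "I \<le> m powr (1 + s) * (N\<^sup>2 * ?d / 4 * (m / A)) powr (- (?d * s / 2)) * E"
      using I[OF l(1)] m by (simp add: powr_add mult_ac)
    then have "I powr (1 / (1 + s)) \<le>
      (m powr (1 + s) * (N\<^sup>2 * ?d / 4 * (m / A)) powr (- (?d * s / 2)) * E) powr (1 / (1 + s))"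
      using I0 s by (intro powr_mono2) auto
    also have "\<dots> = m * (N\<^sup>2 * ?d / 4 * (m / A)) powr (- \<theta>) * E powr (1 / (1 + s))"
      using s m unfolding powr_mult powr_powr by (simp add: \<theta>_def)
    also have "\<dots> = U * A powr \<theta> * m powr (1 - \<theta>)"
    proof -
      have "(m / A) powr (- \<theta>) = m powr (- \<theta>) * A powr \<theta>"
        using m A by (simp add: powr_divide powr_minus field_simps)
      moreover have "m powr (1 - \<theta>) = m * m powr (- \<theta>)"
        using m by (simp add: powr_diff powr_minus field_simps)
      ultimately show ?thesis unfolding U_def powr_mult[of "N\<^sup>2 * ?d / 4"] by (simp only: mult_ac)
    qed
    finally show ?thesis .
  qed
  have th: "GN_theta ?p DIM('a) = \<theta>" using s by (simp add: GN_theta_def \<theta>_def field_simps)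
  have n2: "Lp_norm 2 u = m powr (1 / 2)" by (simp add: Lp_norm_def m_def)
  have g2: "gradient_L2_norm G = A powr (1 / 2)"
    unfolding A_def by (rule gradient_L2_norm_eq) (use G in \<open>auto simp: has_weak_L2_gradient_def Lp_space_2_iff\<close>)
  have np: "(Lp_norm ?p u)\<^sup>2 = I powr (1 / (1 + s))"
  proof -
    have "(Lp_norm ?p u)\<^sup>2 = I powr (1 / ?p + 1 / ?p)"
      by (simp only: Lp_norm_def I_def power2_eq_square powr_add)
    also have "1 / ?p + 1 / ?p = 1 / (1 + s)" using s by (simp add: field_simps)
    finally show ?thesis .
  qed
  have "u \<in> Lp_space ?p" using int by (simp add: Lp_space_def)
  moreover have "(Lp_norm ?p u)\<^sup>2 \<le> U * gradient_L2_norm G powr (2 * \<theta>) * Lp_norm 2 u powr (2 * (1 - \<theta>))"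
  proof -
    have "1 / 2 * (2 * \<theta>) = \<theta>" "1 / 2 * (2 * (1 - \<theta>)) = 1 - \<theta>" by simp_all
    then show ?thesis unfolding np n2 g2 powr_powr using main by (simp only:)
  qed
  ultimately show "u \<in> Lp_space ?p \<and> (Lp_norm ?p u)\<^sup>2 \<le>
     (N\<^sup>2 * ?d / 4) powr (- (?d * s / (2 * (1 + s)))) *
     (1 - ?d * s / 2 + s\<^sup>2 * D) powr (1 / (1 + s)) *
     gradient_L2_norm G powr (2 * GN_theta ?p DIM('a)) * Lp_norm 2 u powr (2 * (1 - GN_theta ?p DIM('a)))"
    unfolding th U_def E_def \<theta>_def[symmetric] by blast
qed

section \<open>Gaussians\<close>

lemma has_bochner_integral_gaussian:
  fixes a :: real
  assumes "a > 0"
  shows "has_bochner_integral lborel (\<lambda>t. exp (- a * t\<^sup>2)) (sqrt (pi / a))"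
    "has_bochner_integral lborel (\<lambda>t. t\<^sup>2 * exp (- a * t\<^sup>2)) (sqrt (pi / a) / (2 * a))"
proof -
  define \<sigma> where "\<sigma> = sqrt (1 / (2 * a))"
  have \<sigma>: "\<sigma> > 0" "\<sigma>\<^sup>2 = 1 / (2 * a)" using assms by (simp_all add: \<sigma>_def)
  have nd: "exp (- a * t\<^sup>2) = sqrt (pi / a) * normal_density 0 \<sigma> t" for t
    using assms by (simp add: normal_density_def \<sigma>(2) real_sqrt_divide field_simps)
  have "has_bochner_integral lborel (\<lambda>t. sqrt (pi / a) * normal_density 0 \<sigma> t) (sqrt (pi / a) * 1)"
    using normal_moment_even[OF \<sigma>(1), of 0 0] by (intro has_bochner_integral_mult_right) simp
  then show "has_bochner_integral lborel (\<lambda>t. exp (- a * t\<^sup>2)) (sqrt (pi / a))"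
    by (simp only: nd mult_1_right)
  have "has_bochner_integral lborel (\<lambda>t. normal_density 0 \<sigma> t * t\<^sup>2) (1 / (2 * a))"
    using normal_moment_even[OF \<sigma>(1), of 0 1] \<sigma>(2) by (simp add: fact_numeral)
  then have "has_bochner_integral lborel (\<lambda>t. sqrt (pi / a) * (normal_density 0 \<sigma> t * t\<^sup>2)) (sqrt (pi / a) * (1 / (2 * a)))"
    by (rule has_bochner_integral_mult_right)
  moreover have "sqrt (pi / a) * (normal_density 0 \<sigma> t * t\<^sup>2) = t\<^sup>2 * exp (- a * t\<^sup>2)" for t
    by (simp only: nd mult_ac)
  ultimately show "has_bochner_integral lborel (\<lambda>t. t\<^sup>2 * exp (- a * t\<^sup>2)) (sqrt (pi / a) / (2 * a))"
    by simp
qed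

lemma has_bochner_integral_lborel_prod:
  fixes f :: "'a::euclidean_space \<Rightarrow> real \<Rightarrow> real"
  assumes nonneg: "\<And>b t. b \<in> Basis \<Longrightarrow> 0 \<le> f b t"
    and f: "\<And>b. b \<in> Basis \<Longrightarrow> has_bochner_integral lborel (f b) (c b)"
  shows "has_bochner_integral lborel (\<lambda>x. \<Prod>b\<in>Basis. f b (x \<bullet> b)) (\<Prod>b\<in>Basis. c b)"
proof (rule has_bochner_integral_nn_integral)
  have [measurable]: "f b \<in> borel_measurable borel" if "b \<in> Basis" for b
    using f[OF that] by (auto simp: has_bochner_integral_iff dest: borel_measurable_integrable)
  show "(\<lambda>x::'a. \<Prod>b\<in>Basis. f b (x \<bullet> b)) \<in> borel_measurable lborel" by measurable
  show "AE x::'a in lborel. 0 \<le> (\<Prod>b\<in>Basis. f b (x \<bullet> b))" by (intro AE_I2 prod_nonneg nonneg)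
  have c0: "0 \<le> c b" if "b \<in> Basis" for b
    using has_bochner_integral_integral_eq[OF f[OF that], symmetric] nonneg[OF that] by simp
  show "0 \<le> (\<Prod>b\<in>Basis. c b)" by (intro prod_nonneg c0)
  have "(\<integral>\<^sup>+ x. ennreal (\<Prod>b\<in>Basis. f b (x \<bullet> b)) \<partial>lborel) =
    (\<integral>\<^sup>+ x. (\<Prod>b\<in>Basis. ennreal (f b (x \<bullet> b))) \<partial>(lborel :: 'a measure))"
    by (intro nn_integral_cong) (simp add: prod_ennreal nonneg)
  also have "\<dots> = (\<Prod>b\<in>(Basis :: 'a set). (\<integral>\<^sup>+ t. ennreal (f b t) \<partial>lborel))"
    by (rule nn_integral_lborel_prod) auto
  also have "\<dots> = (\<Prod>b\<in>(Basis :: 'a set). ennreal (c b))"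
    using f nonneg
    by (intro prod.cong refl) (auto simp: has_bochner_integral_iff nn_integral_eq_integral)
  also have "\<dots> = ennreal (\<Prod>b\<in>Basis. c b)" by (simp add: prod_ennreal c0)
  finally show "(\<integral>\<^sup>+ x. ennreal (\<Prod>b\<in>Basis. f b (x \<bullet> b)) \<partial>lborel) = ennreal (\<Prod>b\<in>Basis. c b)" .
qed

lemma exp_norm_power2_prod:
  "exp (- a * (norm (x::'a::euclidean_space))\<^sup>2) = (\<Prod>b\<in>Basis. exp (- a * (x \<bullet> b)\<^sup>2))"
  by (subst power2_norm_eq_inner, subst euclidean_inner)
     (simp add: exp_sum[symmetric] sum_distrib_left power2_eq_square)

lemma has_bochner_integral_gaussian_euclidean:
  fixes a :: real
  assumes a: "a > 0"
  shows "has_bochner_integral lborel (\<lambda>x::'a::euclidean_space. exp (- a * (norm x)\<^sup>2)) ((pi / a) powr (real DIM('a) / 2))"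
    "i \<in> Basis \<Longrightarrow> has_bochner_integral lborel
       (\<lambda>x::'a. (x \<bullet> i)\<^sup>2 * exp (- a * (norm x)\<^sup>2)) ((pi / a) powr (real DIM('a) / 2) / (2 * a))"
proof -
  have pw: "sqrt (pi / a) ^ DIM('a) = (pi / a) powr (real DIM('a) / 2)"
    using a by (simp add: powr_half_sqrt[symmetric] powr_realpow[symmetric] powr_powr)
  have "has_bochner_integral lborel (\<lambda>x::'a. \<Prod>b\<in>Basis. exp (- a * (x \<bullet> b)\<^sup>2)) (\<Prod>b\<in>(Basis::'a set). sqrt (pi / a))"
    by (rule has_bochner_integral_lborel_prod) (use has_bochner_integral_gaussian(1)[OF a] in auto)
  then show "has_bochner_integral lborel (\<lambda>x::'a. exp (- a * (norm x)\<^sup>2)) ((pi / a) powr (real DIM('a) / 2))"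
    unfolding exp_norm_power2_prod by (simp add: pw)
  assume i: "i \<in> Basis"
  let ?f = "\<lambda>b t. (if b = i then t\<^sup>2 else 1) * exp (- a * t\<^sup>2)"
  let ?c = "\<lambda>b. (if b = i then 1 / (2 * a) else 1) * sqrt (pi / a)"
  have "has_bochner_integral lborel (\<lambda>x::'a. \<Prod>b\<in>Basis. ?f b (x \<bullet> b)) (\<Prod>b\<in>(Basis::'a set). ?c b)"
    by (rule has_bochner_integral_lborel_prod)
       (use has_bochner_integral_gaussian[OF a] in auto)
  moreover have "(\<Prod>b\<in>Basis. ?f b (x \<bullet> b)) = (x \<bullet> i)\<^sup>2 * exp (- a * (norm x)\<^sup>2)" for x
    unfolding exp_norm_power2_prod using i by (simp add: prod.distrib prod.delta)
  moreover have "(\<Prod>b\<in>(Basis::'a set). ?c b) = (pi / a) powr (real DIM('a) / 2) / (2 * a)"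
    using i by (simp add: prod.distrib prod.delta pw)
  ultimately show "has_bochner_integral lborel
       (\<lambda>x::'a. (x \<bullet> i)\<^sup>2 * exp (- a * (norm x)\<^sup>2)) ((pi / a) powr (real DIM('a) / 2) / (2 * a))"
    by simp
qed

text \<open>Difference quotients of \<open>F\<close> have integral zero by translation invariance.
  The mean value theorem and the bounded support dominate them, so the limit also has integral zero;
  only the derivative in the direction \<open>i\<close> is involved.\<close>

lemma integral_directional_derivative_eq_0:
  fixes F F' :: "'a::euclidean_space \<Rightarrow> real"
  assumes i: "i \<in> Basis"
    and D: "\<And>x. ((\<lambda>r. F (x + r *\<^sub>R i)) has_real_derivative F' x) (at 0)"
    and cont: "continuous_on UNIV F" "continuous_on UNIV F'"
    and supp: "\<And>x. F x \<noteq> 0 \<Longrightarrow> norm x \<le> R"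
  shows "integrable lborel F'" "(LINT x|lborel. F' x) = 0"
proof -
  have [measurable]: "F \<in> borel_measurable borel" "F' \<in> borel_measurable borel"
    using cont by (auto intro: borel_measurable_continuous_onI)
  have Fi: "integrable lborel F"
  proof -
    have "integrable lborel (\<lambda>x. indicator (cball 0 R) x *\<^sub>R F x)"
      by (rule borel_integrable_compact) (auto intro: continuous_on_subset[OF cont(1)])
    moreover have "(\<lambda>x. indicator (cball 0 R) x *\<^sub>R F x) = F"
    proof
      show "indicator (cball 0 R) x *\<^sub>R F x = F x" for x
        using supp[of x] by (cases "F x = 0") (auto simp: indicator_def)
    qed
    ultimately show ?thesis by simp
  qed
  have "bounded (F' ` cball 0 (R + 2))"
    by (intro compact_imp_bounded compact_continuous_image continuous_on_subset[OF cont(2)]) auto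
  then obtain M where "\<forall>x\<in>cball 0 (R + 2). \<bar>F' x\<bar> \<le> M"
    by (auto simp: bounded_iff)
  then have M: "\<bar>F' x\<bar> \<le> M" if "norm x \<le> R + 2" for x
    using that by simp
  \<comment> \<open>\<open>R\<close> may be negative; the ball can then be empty and
    \<open>M\<close> negative.\<close>
  define M' where "M' = max M 0"
  define h where "h n = 1 / real (Suc n)" for n
  have h: "h n > 0" "h n \<le> 1" for n by (auto simp: h_def)
  have hlim: "h \<longlonglongrightarrow> 0" unfolding h_def by (rule LIMSEQ_Suc[OF lim_const_over_n])
  let ?q = "\<lambda>n x. (F (x + h n *\<^sub>R i) - F x) / h n"
  have D': "((\<lambda>r. F (x + r *\<^sub>R i)) has_real_derivative F' (x + r *\<^sub>R i)) (at r)" for x r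
    using D[of "x + r *\<^sub>R i"] DERIV_shift[of "\<lambda>r. F (x + r *\<^sub>R i)" "F' (x + r *\<^sub>R i)" 0 r]
    by (simp add: algebra_simps)
  \<comment> \<open>Steps are at most 1, so the quotients vanish outside the ball of radius R + 1,
    and for points of that ball the intermediate point lies in the ball of radius R + 2, where
    \<open>M\<close> is a bound.\<close>
  have bd: "\<bar>?q n x\<bar> \<le> M' * indicator (cball 0 (R + 1)) x" for n x
  proof (cases "norm x \<le> R + 1")
    case True
    obtain t where t: "0 < t" "t < h n" "F (x + h n *\<^sub>R i) - F (x + 0 *\<^sub>R i) = (h n - 0) * F' (x + t *\<^sub>R i)"
      using MVT2[OF h(1), where f = "\<lambda>r. F (x + r *\<^sub>R i)" and f' = "\<lambda>r. F' (x + r *\<^sub>R i)"] D' by blast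
    have "norm (x + t *\<^sub>R i) \<le> norm x + t"
      using norm_triangle_ineq[of x "t *\<^sub>R i"] i t by simp
    then have "\<bar>F' (x + t *\<^sub>R i)\<bar> \<le> M'"
      using True t h(2)[of n] M[of "x + t *\<^sub>R i"] by (simp add: M'_def)
    moreover have "?q n x = F' (x + t *\<^sub>R i)" using t h(1)[of n] by (simp add: field_simps)
    ultimately show ?thesis using True by simp
  next
    case False
    have "norm x \<le> norm (x + h n *\<^sub>R i) + h n"
      using norm_triangle_ineq4[of "x + h n *\<^sub>R i" "h n *\<^sub>R i"] i h(1)[of n] by simp
    then have "\<not> norm (x + h n *\<^sub>R i) \<le> R" "\<not> norm x \<le> R" using False h(2)[of n] by auto
    then have "F (x + h n *\<^sub>R i) = 0" "F x = 0" using supp by blast+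
    then show ?thesis by (simp add: M'_def)
  qed
  have lim: "(\<lambda>n. ?q n x) \<longlonglongrightarrow> F' x" for x
  proof -
    have "((\<lambda>t. (F (x + t *\<^sub>R i) - F x) / t) \<longlongrightarrow> F' x) (at 0)"
      using D[of x] by (simp add: has_field_derivative_iff)
    then show ?thesis
      by (rule filterlim_compose)
         (use h hlim in \<open>auto simp: filterlim_at less_imp_neq[OF h(1), symmetric]\<close>)
  qed
  have w: "integrable lborel (\<lambda>x::'a. M' * indicator (cball 0 (R + 1)) x)"
    using emeasure_bounded_finite[OF bounded_cball] by (intro integrable_mult_right integrable_real_indicator) auto
  have lim': "AE x in lborel. (\<lambda>n. ?q n x) \<longlonglongrightarrow> F' x" using lim by simp
  have bd': "AE x in lborel. norm (?q n x) \<le> M' * indicator (cball 0 (R + 1)) x" for n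
    using bd by simp
  show "integrable lborel F'"
    by (rule integrable_dominated_convergence[OF _ _ w lim' bd']) simp_all
  have "(\<lambda>n. LINT x|lborel. ?q n x) \<longlonglongrightarrow> (LINT x|lborel. F' x)"
    by (rule integral_dominated_convergence[OF _ _ w lim' bd']) simp_all
  moreover have "(LINT x|lborel. ?q n x) = 0" for n
    using Fi integrable_lborel_shift[OF Fi, of "h n *\<^sub>R i"] integral_lborel_shift[of F "h n *\<^sub>R i"]
    by simp
  ultimately have "(\<lambda>n::nat. 0) \<longlonglongrightarrow> (LINT x|lborel. F' x)" by (simp only:)
  then show "(LINT x|lborel. F' x) = 0" by (simp add: LIMSEQ_const_iff)
qed

text \<open>The square of \<open>g\<close> is the standard Gaussian up to normalization, an extremal
  of the logarithmic Sobolev inequality; hence it is the right trial function to first order.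
  Multiplication by \<open>1::'b\<close> embeds it in the value field. The identity follows by
  integrating the derivative of the product of \<open>g\<close> and the test function.\<close>

lemma gaussian_weak_gradient:
  defines "g \<equiv> \<lambda>x::'a::euclidean_space. exp (- (norm x)\<^sup>2 / 4)"
  shows "has_weak_L2_gradient (\<lambda>x. g x *\<^sub>R (1::'b::{real_normed_field,euclidean_space}))
    (\<lambda>i x. (- (x \<bullet> i) / 2 * g x) *\<^sub>R 1)"
  unfolding has_weak_L2_gradient_def
proof (intro ballI conjI allI impI)
  fix i :: 'a assume i: "i \<in> Basis"
  have gcont: "continuous_on UNIV g" unfolding g_def by (intro continuous_intros) auto
  have [measurable]: "g \<in> borel_measurable borel" using gcont by (rule borel_measurable_continuous_onI)
  have g2: "(g x)\<^sup>2 = exp (- (1 / 2) * (norm x)\<^sup>2)" for x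
    by (simp add: g_def exp_double[symmetric])
  have "integrable lborel (\<lambda>x. 1 / 4 * ((x \<bullet> i)\<^sup>2 * exp (- (1 / 2) * (norm x)\<^sup>2)))"
    using has_bochner_integral_gaussian_euclidean(2)[of "1 / 2" i] i
    by (intro integrable_mult_right) (auto simp: has_bochner_integral_iff)
  moreover have "(norm ((- (x \<bullet> i) / 2 * g x) *\<^sub>R (1::'b)))\<^sup>2 = 1 / 4 * ((x \<bullet> i)\<^sup>2 * exp (- (1 / 2) * (norm x)\<^sup>2))" for x
    unfolding g2[symmetric] by (simp add: power_mult_distrib power_divide)
  ultimately have "integrable lborel (\<lambda>x. (norm ((- (x \<bullet> i) / 2 * g x) *\<^sub>R (1::'b)))\<^sup>2)"
    by (simp only:)
  moreover have "(\<lambda>x. (- (x \<bullet> i) / 2 * g x) *\<^sub>R (1::'b)) \<in> borel_measurable borel"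
    by measurable
  ultimately show "(\<lambda>x. (- (x \<bullet> i) / 2 * g x) *\<^sub>R (1::'b)) \<in> Lp_space 2"
    unfolding Lp_space_2_iff by blast
  fix \<phi> :: "'a \<Rightarrow> real" assume \<phi>: "test_function \<phi>"
  let ?\<phi>' = "\<lambda>x. frechet_derivative \<phi> (at x) i"
  have "C_k 1 \<phi>" and cmp: "compact (closure {x. \<phi> x \<noteq> 0})" using \<phi> by (auto simp: test_function_def)
  then have diff: "\<phi> differentiable (at x)" and \<phi>'cont: "continuous_on UNIV ?\<phi>'" for x
    by auto
  have \<phi>cont: "continuous_on UNIV \<phi>"
    by (rule continuous_at_imp_continuous_on) (blast intro: differentiable_imp_continuous_within diff)
  have "bounded {x. \<phi> x \<noteq> 0}"
    using compact_imp_bounded[OF cmp] closure_subset by (rule bounded_subset)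
  then obtain R where R: "\<And>x. \<phi> x \<noteq> 0 \<Longrightarrow> norm x \<le> R" by (auto simp: bounded_iff)
  let ?F' = "\<lambda>x. ?\<phi>' x * g x + (- (x \<bullet> i) / 2 * g x) * \<phi> x"
  have D\<phi>: "((\<lambda>r. \<phi> (x + r *\<^sub>R i)) has_real_derivative ?\<phi>' x) (at 0)" for x
    using diff by (rule differentiable_directional_derivative)
  have Dg: "((\<lambda>r. g (x + r *\<^sub>R i)) has_real_derivative - (x \<bullet> i) / 2 * g x) (at 0)" for x
  proof -
    have "g (x + r *\<^sub>R i) = exp (- ((norm x)\<^sup>2 + 2 * r * (x \<bullet> i) + r\<^sup>2) / 4)" for r
    proof -
      have "(norm (x + r *\<^sub>R i))\<^sup>2 = (norm x)\<^sup>2 + 2 * r * (x \<bullet> i) + r\<^sup>2"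
        unfolding power2_norm_eq_inner using i
        by (simp add: inner_add_left inner_add_right inner_commute[of i x] power2_eq_square inner_same_Basis algebra_simps)
      then show ?thesis by (simp only: g_def)
    qed
    moreover have "((\<lambda>r. exp (- ((norm x)\<^sup>2 + 2 * r * (x \<bullet> i) + r\<^sup>2) / 4)) has_real_derivative - (x \<bullet> i) / 2 * g x) (at 0)"
      by (auto intro!: derivative_eq_intros simp: g_def)
    ultimately show ?thesis by simp
  qed
  have DF: "((\<lambda>r. \<phi> (x + r *\<^sub>R i) * g (x + r *\<^sub>R i)) has_real_derivative ?F' x) (at 0)" for x
    using DERIV_mult[OF D\<phi>[of x] Dg[of x]] by simp
  have F'cont: "continuous_on UNIV ?F'" by (intro continuous_intros gcont \<phi>cont \<phi>'cont) auto
  have Fcont: "continuous_on UNIV (\<lambda>x. \<phi> x * g x)" by (intro continuous_intros gcont \<phi>cont)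
  have Fsupp: "\<And>x. \<phi> x * g x \<noteq> 0 \<Longrightarrow> norm x \<le> R" using R by auto
  note F = integral_directional_derivative_eq_0[OF i DF Fcont F'cont Fsupp]
  have 2: "integrable lborel (\<lambda>x. (- (x \<bullet> i) / 2 * g x) * \<phi> x)"
  proof -
    have "integrable lborel (\<lambda>x. indicator (cball 0 R) x *\<^sub>R ((- (x \<bullet> i) / 2 * g x) * \<phi> x))"
      by (rule borel_integrable_compact)
         (auto intro!: continuous_intros continuous_on_subset[OF gcont] continuous_on_subset[OF \<phi>cont])
    moreover have "(\<lambda>x. indicator (cball 0 R) x *\<^sub>R ((- (x \<bullet> i) / 2 * g x) * \<phi> x)) =
      (\<lambda>x. (- (x \<bullet> i) / 2 * g x) * \<phi> x)"
    proof
      show "indicator (cball 0 R) x *\<^sub>R ((- (x \<bullet> i) / 2 * g x) * \<phi> x) = (- (x \<bullet> i) / 2 * g x) * \<phi> x" for x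
        using R[of x] by (cases "\<phi> x = 0") (auto simp: indicator_def)
    qed
    ultimately show ?thesis by (simp only:)
  qed
  have 1: "integrable lborel (\<lambda>x. ?\<phi>' x * g x)"
    using Bochner_Integration.integrable_diff[OF F(1) 2] by simp
  have sum0: "(LINT x|lborel. ?\<phi>' x * g x) + (LINT x|lborel. (- (x \<bullet> i) / 2 * g x) * \<phi> x) = 0"
    using F(2) 1 2 by simp
  have "(LINT x|lborel. ?\<phi>' x *\<^sub>R (g x *\<^sub>R (1::'b))) = (LINT x|lborel. ?\<phi>' x * g x) *\<^sub>R 1"
    using integral_scaleR_left[where M = lborel and f = "\<lambda>x. ?\<phi>' x * g x" and c = "1::'b"] 1 by simp
  moreover have "(LINT x|lborel. \<phi> x *\<^sub>R ((- (x \<bullet> i) / 2 * g x) *\<^sub>R (1::'b))) =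
    (LINT x|lborel. (- (x \<bullet> i) / 2 * g x) * \<phi> x) *\<^sub>R 1"
    using integral_scaleR_left[where M = lborel and f = "\<lambda>x. (- (x \<bullet> i) / 2 * g x) * \<phi> x" and c = "1::'b"] 2
    by (simp add: mult.commute[of "\<phi> _"])
  ultimately show "(LINT x|lborel. ?\<phi>' x *\<^sub>R (g x *\<^sub>R (1::'b))) =
    - (LINT x|lborel. \<phi> x *\<^sub>R ((- (x \<bullet> i) / 2 * g x) *\<^sub>R (1::'b)))"
    using sum0 by (simp add: add_eq_0_iff2 scaleR_minus_left[symmetric] del: scaleR_minus_left)
qed

text \<open>The left-hand side is the quotient of the inequality for u = exp (-|x|^2 / 4). The
  integral of u^p is (4 pi / p)^(d/2), the squared L^2 norm is m = (2 pi)^(d/2), and the energy is d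
  m / 4. The powers of m combine to m itself, as the two exponents add up to 1.\<close>

lemma GN_inequality_lower:
  assumes GN: "GN_inequality TYPE('a::euclidean_space) TYPE('b::{real_normed_field,euclidean_space}) p C"
    and p: "p > 2"
  shows "(4 * pi / p) powr (real DIM('a) / p) * (2 * pi) powr (- (real DIM('a) / 2)) *
    (real DIM('a) / 4) powr (- GN_theta p DIM('a)) \<le> C"
proof -
  let ?d = "real DIM('a)"
  define g where "g x = exp (- (norm x)\<^sup>2 / 4)" for x :: 'a
  define u where "u x = g x *\<^sub>R (1::'b)" for x
  define G where "G i x = (- (x \<bullet> i) / 2 * g x) *\<^sub>R (1::'b)" for i x
  have weak: "has_weak_L2_gradient u G"
    using gaussian_weak_gradient[where 'a = 'a and 'b = 'b] by (simp add: u_def[abs_def] G_def[abs_def] g_def)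
  have nu: "norm (u x) powr q = exp (- (q / 4) * (norm x)\<^sup>2)" for x q
    by (simp add: u_def g_def powr_def)
  have gauss: "has_bochner_integral lborel (\<lambda>x. norm (u x) powr q) ((4 * pi / q) powr (?d / 2))" if "q > 0" for q
    using has_bochner_integral_gaussian_euclidean(1)[of "q / 4", where 'a = 'a] that
    by (simp add: nu mult.commute)
  have [measurable]: "u \<in> borel_measurable borel"
    unfolding u_def g_def by measurable
  define m where "m = (2 * pi) powr (?d / 2)"
  have m0: "m > 0" by (simp add: m_def)
  have n2: "(LINT x|lborel. norm (u x) powr 2) = m"
    using has_bochner_integral_integral_eq[OF gauss[of 2]] by (simp add: m_def)
  have uL: "u \<in> Lp_space 2"
    using gauss[of 2] by (simp add: Lp_space_def has_bochner_integral_iff)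
  then have uH: "u \<in> H1" using weak by (auto simp: H1_def)
  have Gb: "has_bochner_integral lborel (\<lambda>x. (norm (G b x))\<^sup>2) (m / 4)" if "b \<in> Basis" for b
  proof -
    have "has_bochner_integral lborel (\<lambda>x::'a. 1 / 4 * ((x \<bullet> b)\<^sup>2 * exp (- (1 / 2) * (norm x)\<^sup>2))) (1 / 4 * m)"
      using has_bochner_integral_gaussian_euclidean(2)[of "1 / 2" b] that
      by (intro has_bochner_integral_mult_right) (simp add: m_def mult.commute)
    moreover have "1 / 4 * ((x \<bullet> b)\<^sup>2 * exp (- (1 / 2) * (norm x)\<^sup>2)) = (norm (G b x))\<^sup>2" for x
      by (simp add: G_def g_def power_mult_distrib power_divide exp_double[symmetric])
    ultimately show ?thesis by (simp only:) simp
  qed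
  have g2: "gradient_L2_norm G = (?d * m / 4) powr (1 / 2)"
  proof -
    have "(\<Sum>b\<in>Basis. LINT x|lborel. (norm (G b x))\<^sup>2) = (\<Sum>b\<in>(Basis::'a set). m / 4)"
      by (rule sum.cong[OF refl]) (rule has_bochner_integral_integral_eq[OF Gb])
    moreover have "gradient_L2_norm G = (\<Sum>b\<in>Basis. LINT x|lborel. (norm (G b x))\<^sup>2) powr (1 / 2)"
      by (rule gradient_L2_norm_eq) (use Gb in \<open>auto simp: has_bochner_integral_iff\<close>)
    ultimately show ?thesis by (simp only: sum_constant times_divide_eq_right)
  qed
  define \<theta> where "\<theta> = GN_theta p DIM('a)"
  have "(Lp_norm p u)\<^sup>2 \<le> C * gradient_L2_norm G powr (2 * \<theta>) * Lp_norm 2 u powr (2 * (1 - \<theta>))"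
    using GN uH weak unfolding GN_inequality_def \<theta>_def by blast
  also have "Lp_norm 2 u powr (2 * (1 - \<theta>)) = m powr (1 - \<theta>)"
  proof -
    have "1 / 2 * (2 * (1 - \<theta>)) = 1 - \<theta>" by simp
    then show ?thesis unfolding Lp_norm_def n2 powr_powr by (simp only:)
  qed
  also have "gradient_L2_norm G powr (2 * \<theta>) = (?d / 4) powr \<theta> * m powr \<theta>"
  proof -
    have "1 / 2 * (2 * \<theta>) = \<theta>" by simp
    then have "gradient_L2_norm G powr (2 * \<theta>) = (?d / 4 * m) powr \<theta>"
      unfolding g2 powr_powr by (simp only: times_divide_eq_left)
    then show ?thesis by (simp only: powr_mult)
  qed
  also have "C * ((?d / 4) powr \<theta> * m powr \<theta>) * m powr (1 - \<theta>) = C * ((?d / 4) powr \<theta> * m)"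
    using m0 by (simp add: powr_diff)
  finally have le: "(Lp_norm p u)\<^sup>2 \<le> C * ((?d / 4) powr \<theta> * m)" .
  have np: "(Lp_norm p u)\<^sup>2 = (4 * pi / p) powr (?d / p)"
  proof -
    have "Lp_norm p u = (4 * pi / p) powr (?d / 2 * (1 / p))"
      using has_bochner_integral_integral_eq[OF gauss[of p]] p
      by (simp add: Lp_norm_def powr_powr)
    then have "(Lp_norm p u)\<^sup>2 = (4 * pi / p) powr (?d / 2 * (1 / p) + ?d / 2 * (1 / p))"
      by (simp only: power2_eq_square powr_add)
    also have "?d / 2 * (1 / p) + ?d / 2 * (1 / p) = ?d / p" by (simp add: field_simps)
    finally show ?thesis .
  qed
  have "(4 * pi / p) powr (?d / p) * inverse ((?d / 4) powr \<theta> * m) \<le> C"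
    using le m0 unfolding np by (simp add: field_simps)
  then show ?thesis
    by (simp add: powr_minus m_def \<theta>_def mult_ac)
qed

section \<open>First-order asymptotics\<close>

lemma truncated_gaussian_mass_tendsto:
  "(\<lambda>n. integral {- real (Suc n)..real (Suc n)} (\<lambda>y. exp (- (y\<^sup>2) / 2))) \<longlonglongrightarrow> sqrt (2 * pi)"
proof -
  let ?g = "\<lambda>y::real. exp (- (y\<^sup>2) / 2)"
  have g: "has_bochner_integral lborel ?g (sqrt (2 * pi))"
    using has_bochner_integral_gaussian(1)[of "1 / 2"] by (simp add: mult.commute)
  have "(\<lambda>n. LINT y|lborel. indicator {- real (Suc n)..real (Suc n)} y *\<^sub>R ?g y) \<longlonglongrightarrow> (LINT y|lborel. ?g y)"
  proof (rule integral_dominated_convergence)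
    show "integrable lborel ?g" using g by (simp add: has_bochner_integral_iff)
    show "AE y in lborel. (\<lambda>n. indicator {- real (Suc n)..real (Suc n)} y *\<^sub>R ?g y) \<longlonglongrightarrow> ?g y"
    proof (rule AE_I2)
      fix y :: real
      obtain k :: nat where k: "\<bar>y\<bar> \<le> real k" using real_arch_simple by blast
      have "indicator {- real (Suc n)..real (Suc n)} y *\<^sub>R ?g y = ?g y" if "n \<ge> k" for n
        using k that by (auto simp: indicator_def)
      then show "(\<lambda>n. indicator {- real (Suc n)..real (Suc n)} y *\<^sub>R ?g y) \<longlonglongrightarrow> ?g y"
        by (intro tendsto_eventually) (auto simp: eventually_sequentially)
    qed
    show "AE y in lborel. norm (indicator {- real (Suc n)..real (Suc n)} y *\<^sub>R ?g y) \<le> ?g y" for n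
      by (intro AE_I2) (auto simp: indicator_def)
  qed auto
  moreover have "(LINT y|lborel. indicator {- real (Suc n)..real (Suc n)} y *\<^sub>R ?g y) =
    integral {- real (Suc n)..real (Suc n)} ?g" for n
  proof -
    have "set_integrable lborel {- real (Suc n)..real (Suc n)} ?g"
      by (rule borel_integrable_atLeastAtMost') (intro continuous_intros, auto)
    from set_borel_integral_eq_integral(2)[OF this] show ?thesis
      by (simp add: set_lebesgue_integral_def)
  qed
  moreover have "(LINT y|lborel. ?g y) = sqrt (2 * pi)" using g by (rule has_bochner_integral_integral_eq)
  ultimately show ?thesis by (simp only:)
qed

lemma difference_quotient_tendsto_at_right:
  fixes f :: "real \<Rightarrow> real"
  assumes "(f has_real_derivative a) (at 2)" "f 2 = 1"
  shows "((\<lambda>p. (f p - 1) / (p - 2)) \<longlongrightarrow> a) (at_right 2)"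
proof -
  have "((\<lambda>p. (f p - f 2) / (p - 2)) \<longlongrightarrow> a) (at 2)"
    using assms(1) by (simp add: has_field_derivative_iff)
  then have "((\<lambda>p. (f p - 1) / (p - 2)) \<longlongrightarrow> a) (at 2)" by (simp only: assms(2))
  then show ?thesis by (rule filterlim_mono[OF _ order_refl at_le]) auto
qed

lemma lower_bound_derivative:
  fixes d :: real
  assumes d: "d > 0"
  shows "((\<lambda>p. (4 * pi / p) powr (d / p) * (2 * pi) powr (- (d / 2)) * (d / 4) powr (- (d * (p - 2) / (2 * p))))
     has_real_derivative - (d / 4) * (ln (2 * pi * d / 4) + 1)) (at 2)"
proof -
  let ?f = "\<lambda>p. exp (d / p * (ln (4 * pi) - ln p) - d / 2 * ln (2 * pi) - d * (p - 2) / (2 * p) * ln (d / 4))"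
  have l: "ln (4 * pi) = ln 2 + ln (2 * pi)" using ln_mult[of 2 "2 * pi"] by simp
  have l2: "ln (2 * pi * d / 4) = ln (2 * pi) + ln (d / 4)"
    using ln_mult[of "2 * pi" "d / 4"] d by simp
  have 1: "(?f has_real_derivative - (d / 4) * (ln (2 * pi * d / 4) + 1)) (at 2)"
    unfolding l2
    by (rule derivative_eq_intros refl | simp add: l)+ (simp add: l field_simps)
  have 2: "?f p = (4 * pi / p) powr (d / p) * (2 * pi) powr (- (d / 2)) * (d / 4) powr (- (d * (p - 2) / (2 * p)))"
    if "p \<in> {0<..}" for p
    using that d by (simp add: powr_def exp_add[symmetric] ln_div algebra_simps)
  show ?thesis
    by (rule has_field_derivative_transform_within_open[OF 1 open_greaterThan _ 2]) auto
qed

text \<open>The error term with \<open>D\<close> is quadratic in p - 2 and has derivative zero at 2.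
  Therefore K can be sent to infinity afterwards although \<open>D\<close> grows with it. For c = 2
  pi d / 4 the slope is that of \<open>lower_bound_derivative\<close>.\<close>

lemma upper_bound_derivative:
  fixes c d D :: real
  assumes c: "c > 0"
  shows "((\<lambda>p. c powr (- (d * ((p - 2) / 2) / (2 * (1 + (p - 2) / 2)))) *
       (1 - d * ((p - 2) / 2) / 2 + ((p - 2) / 2)\<^sup>2 * D) powr (1 / (1 + (p - 2) / 2)))
     has_real_derivative - (d / 4) * (ln c + 1)) (at 2)"
  (is "(?g has_real_derivative _) _")
proof -
  let ?E = "\<lambda>p. 1 - d * ((p - 2) / 2) / 2 + ((p - 2) / 2)\<^sup>2 * D"
  let ?f = "\<lambda>p. exp (- (d * ((p - 2) / 2) / (2 * (1 + (p - 2) / 2))) * ln c + 1 / (1 + (p - 2) / 2) * ln (?E p))"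
  have 1: "(?f has_real_derivative - (d / 4) * (ln c + 1)) (at 2)"
    by (rule derivative_eq_intros refl | simp)+ (simp add: field_simps)
  have 3: "open {p. ?E p > 0}"
    by (intro open_Collect_less continuous_intros) auto
  have 2: "?f p = ?g p" if "p \<in> {p. ?E p > 0}" for p
    using that c by (simp add: powr_def exp_add[symmetric])
  show ?thesis
    by (rule has_field_derivative_transform_within_open[OF 1 3 _ 2]) auto
qed

theorem proposition2:
  assumes "DIM('a::euclidean_space) \<ge> 2"
  shows "((\<lambda>p. (C_GN TYPE('a) TYPE('b::{real_normed_field,euclidean_space}) p - 1) / (p - 2))
           \<longlongrightarrow> real DIM('a) / 4 * ln (C_LS DIM('a)))
         (at 2 within {p. 2 < p \<and> ereal p < critical_exponent DIM('a)})"
proof -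
  let ?d = "real DIM('a)"
  have d0: "?d > 0" by simp
  define f where "f p = C_GN TYPE('a) TYPE('b) p" for p
  define N where "N n = integral {- real (Suc n)..real (Suc n)} (\<lambda>y. exp (- (y\<^sup>2) / 2))" for n
  define D where "D n = (?d * (real (Suc n))\<^sup>2)\<^sup>2 / 8 + ?d\<^sup>2 * (real (Suc n))\<^sup>2 / 2" for n
  define L where "L p = (4 * pi / p) powr (?d / p) * (2 * pi) powr (- (?d / 2)) * (?d / 4) powr (- (?d * (p - 2) / (2 * p)))" for p
  define U where "U n p = ((N n)\<^sup>2 * ?d / 4) powr (- (?d * ((p - 2) / 2) / (2 * (1 + (p - 2) / 2)))) *
       (1 - ?d * ((p - 2) / 2) / 2 + ((p - 2) / 2)\<^sup>2 * D n) powr (1 / (1 + (p - 2) / 2))" for n p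
  have N0: "N n > 0" for n unfolding N_def by (rule truncated_gaussian_mass_pos) simp
  let ?a = "- (?d / 4) * (ln (2 * pi * ?d / 4) + 1)"
  \<comment> \<open>The reciprocal of \<open>C_LS\<close> is (pi d / 2) e, and pi d / 2 = 2 pi d / 4
    is the limit of N^2 d / 4.\<close>
  have a: "?d / 4 * ln (C_LS DIM('a)) = ?a"
  proof -
    have "C_LS DIM('a) = inverse ((2 * pi * ?d / 4) * exp 1)"
      by (simp add: C_LS_def field_simps)
    moreover have "ln ((2 * pi * ?d / 4) * exp 1) = ln (2 * pi * ?d / 4) + ln (exp 1)"
      using ln_mult[of "2 * pi * ?d / 4" "exp 1"] by simp
    ultimately have "ln (C_LS DIM('a)) = - (ln (2 * pi * ?d / 4) + 1)"
      by (simp only: ln_inverse) simp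
    then show ?thesis by (simp only:)
  qed
  \<comment> \<open>With s = (p - 2) / 2 the restriction p < 2 + 2/d ensures d s <= 1, as the
    weights in the mean inequality require.\<close>
  have bounds: "L p \<le> f p" "f p \<le> U n p" if p: "2 < p" "p < 2 + 2 / ?d" for n p
  proof -
    have s: "0 < (p - 2) / 2" "?d * ((p - 2) / 2) \<le> 1" using p d0 by (auto simp: field_simps)
    have p2: "2 + 2 * ((p - 2) / 2) = p" by (simp add: field_simps)
    \<comment> \<open>By \<open>mem\<close> this set is nonempty and by \<open>low\<close> it is
      bounded below, so \<open>Inf\<close> is a genuine infimum.\<close>
    let ?S = "{C. GN_inequality TYPE('a) TYPE('b) p C}"
    have mem: "U n p \<in> ?S" for n
      using GN_inequality_upper[where 'a = 'a and 'b = 'b, of "real (Suc n)" "(p - 2) / 2"] s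
      unfolding p2 U_def N_def D_def by simp
    have low: "L p \<le> C" if "C \<in> ?S" for C
      using GN_inequality_lower[of p C, where 'a = 'a and 'b = 'b] that p by (simp add: L_def GN_theta_def)
    show "L p \<le> f p" unfolding f_def C_GN_def
      by (rule cInf_greatest) (use mem low in auto)
    show "f p \<le> U n p" unfolding f_def C_GN_def
      by (rule cInf_lower[OF mem]) (use low in \<open>auto intro!: bdd_belowI\<close>)
  qed
  have ev: "eventually (\<lambda>p. 2 < p \<and> p < 2 + 2 / ?d) (at_right 2)"
    using d0 by (auto simp: eventually_at_right_field intro!: exI[of _ "2 + 2 / ?d"])
  have Llim: "((\<lambda>p. (L p - 1) / (p - 2)) \<longlongrightarrow> ?a) (at_right 2)"
  proof (rule difference_quotient_tendsto_at_right)
    show "(L has_real_derivative ?a) (at 2)"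
      unfolding L_def by (rule lower_bound_derivative[OF d0])
    show "L 2 = 1" by (simp add: L_def powr_minus)
  qed
  have Ulim: "((\<lambda>p. (U n p - 1) / (p - 2)) \<longlongrightarrow> - (?d / 4) * (ln ((N n)\<^sup>2 * ?d / 4) + 1)) (at_right 2)" for n
  proof (rule difference_quotient_tendsto_at_right)
    show "(U n has_real_derivative - (?d / 4) * (ln ((N n)\<^sup>2 * ?d / 4) + 1)) (at 2)"
      unfolding U_def by (rule upper_bound_derivative) (use N0[of n] in simp)
    show "U n 2 = 1" using N0[of n] by (simp add: U_def)
  qed
  have Nlim: "(\<lambda>n. - (?d / 4) * (ln ((N n)\<^sup>2 * ?d / 4) + 1)) \<longlonglongrightarrow> - (?d / 4) * (ln ((sqrt (2 * pi))\<^sup>2 * ?d / 4) + 1)"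
    unfolding N_def by (intro tendsto_intros truncated_gaussian_mass_tendsto) auto
  have "((\<lambda>p. (f p - 1) / (p - 2)) \<longlongrightarrow> ?a) (at_right 2)"
  proof (rule order_tendstoI)
    fix y assume y: "y < ?a"
    show "eventually (\<lambda>p. y < (f p - 1) / (p - 2)) (at_right 2)"
      using ev order_tendstoD(1)[OF Llim y]
    proof eventually_elim
      case (elim p)
      then have "(L p - 1) / (p - 2) \<le> (f p - 1) / (p - 2)"
        using bounds(1)[of p] by (intro divide_right_mono) auto
      then show ?case using elim by linarith
    qed
  next
    fix y assume y: "?a < y"
    \<comment> \<open>The truncation level is fixed first, so that the slope of the upper bound lies
      below \<open>y\<close>; only then does p tend to 2.\<close>
    have "eventually (\<lambda>n. - (?d / 4) * (ln ((N n)\<^sup>2 * ?d / 4) + 1) < y) sequentially"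
      by (rule order_tendstoD(2)[OF Nlim]) (use y in simp)
    then obtain n where n: "- (?d / 4) * (ln ((N n)\<^sup>2 * ?d / 4) + 1) < y"
      by (auto simp: eventually_sequentially)
    show "eventually (\<lambda>p. (f p - 1) / (p - 2) < y) (at_right 2)"
      using ev order_tendstoD(2)[OF Ulim n]
    proof eventually_elim
      case (elim p)
      then have "(f p - 1) / (p - 2) \<le> (U n p - 1) / (p - 2)"
        using bounds(2)[of p n] by (intro divide_right_mono) auto
      then show ?case using elim by linarith
    qed
  qed
  \<comment> \<open>The admissible exponents form a subset of the half-line p > 2, so the one-sided
    limit restricts to them.\<close>
  then show ?thesis
    unfolding a f_def by (rule tendsto_within_subset) auto
qed

end
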